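(* Consider the MSSA sequences of the context for $k\in[K]$. Suppose that Assumptions 1--5 of the context hold. If the step sizes are chosen as $\alpha^k=\Theta\left(\frac{\log K}{K}\right)$ and $\beta^k_n=\Theta\left(\frac{\log K}{K}\right)$, then it holds that $$\mathbb{E}\|x^{K}-x^\ast\|^2+\sum_{n=1}^N\mathbb{E}\|y_n^K-y_n^\ast(x^K,y_{1:n-1}^K)\|^2=\tilde{\mathcal{O}}\left(\frac{1}{K}\right),$$ which implies that $$\mathbb{E}\|x^{K}-x^\ast\|^2+\sum_{n=1}^N\mathbb{E}\|y_n^K-y_n^\diamond(x^\ast)\|^2=\tilde{\mathcal{O}}\left(\frac{1}{K}\right).$$
   Context: Setting (multi-sequence stochastic approximation, MSSA). $[N]=\{1,\dots,N\}$, $[K]=\{1,\dots,K\}$ with $K$ the total number of iterations, $y_{1:n}=(y_1,\dots,y_n)$, $\|\cdot\|$ is the $\ell_2$-norm. $v:\mathbb{R}^{d_0}\times\mathbb{R}^{d_1}\times\cdots\times\mathbb{R}^{d_N}\to\mathbb{R}^{d_0}$ and $h_n:\mathbb{R}^{d_0}\times\mathbb{R}^{d_1}\times\cdots\times\mathbb{R}^{d_n}\to\mathbb{R}^{d_n}$, $n\in[N]$. The MSSA updates are $$y_n^{k+1}=y_n^k-\beta_n^k\big(h_n(x^k,y_{1:n}^k)+\psi_n^k\big)\ (n\in[N]),\qquad x^{k+1}=x^k-\alpha^k\big(v(x^k,y_{1:N}^k)+\xi^k\big),$$ with positive step sizes $\alpha^k,\beta_n^k$ and random noise $\xi^k,\psi_n^k$.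 $\mathcal{F}^k=\sigma\big(\bigcup_{l=0}^k\{x^l,y_1^l,\dots,y_N^l\}\big)$. Assumption 1. For each $n\in[N]$, given $x$ and $y_{1:n-1}$, there is a constant $\mu_n>0$ such that for all $\hat y_n,\bar y_n$: $\langle h_n(x,y_{1:n-1},\hat y_n)-h_n(x,y_{1:n-1},\bar y_n),\hat y_n-\bar y_n\rangle\ge\mu_n\|\hat y_n-\bar y_n\|^2$. Assumption 2. For each $n\in[N]$ one of the following holds: (a) $h_n(x,y_{1:n})$ is $\ell_n$-Lipschitz continuous w.r.t. any variable among $x$ and $y_{1:n}$; (b) $h_n(x,y_{1:n})=A_n(x,y_{1:n-1})y_n+b_n(x,y_{1:n-1})$, where the matrix-valued map $A_n$ (values in $\mathbb{R}^{d_n\times d_n}$) is $\ell_{A,n}$-Lipschitz continuous w.r.t. any variable among $x$ and $y_{1:n-1}$ and bounded by $\ell_{A,n}'$ in spectral norm, and $b_n$ (values in $\mathbb{R}^{d_n}$) is $\ell_{b,n}$-Lipschitz continuous w.r.t. any variable among $x$ and $y_{1:n-1}$ and bounded by $\ell_{b,n}'$ in $\ell_2$-norm. Under Assumptions 1--2, for given $x,y_{1:n-1}$ there is a unique $y_n^\ast(x,y_{1:n-1})$ with $h_n(x,y_{1:n-1},y_n^\ast(x,y_{1:n-1}))=0$. Define $y_1^\diamond(x)=y_1^\ast(x)$ and $y_n^\diamond(x)=y_n^\ast(x,y_1^\diamond(x),\dots,y_{n-1}^\diamond(x))$; $y_{1:N}^\diamond(x)=(y_1^\diamond(x),\dots,y_N^\diamond(x))$.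 Assumption 3. There is $\ell_0>0$ such that for all $\hat x,\bar x,y_{1:N}$: $\|v(\hat x,y^\diamond_{1:N}(\hat x))-v(\bar x,y_{1:N})\|\le\ell_0\big(\|\hat x-\bar x\|+\sum_{n=1}^N\|y_n-y_n^\diamond(\hat x)\|\big)$. Assumption 4. $\{\xi^k\}_k$ and $\{\psi_n^k\}_k$ ($n\in[N]$) are martingale difference sequences (zero mean conditionally on $\mathcal{F}^k$), and for positive constants $\omega_0,\omega_1,\omega_2,\sigma$: $\operatorname{Var}[\psi_n^k|\mathcal{F}^k]\le\omega_0\|h_n(x^k,y_{1:n}^k)\|^2+\sigma^2$ for all $n\in[N]$, and $\operatorname{Var}[\xi^k|\mathcal{F}^k]\le\omega_1\|v(x^k,y_{1:N}^k)\|^2+\sigma^2+\omega_2\sum_{n=1}^N\|h_n(x^k,y_{1:n}^k)\|^2$. Here the variance of a random vector is its expected squared $\ell_2$-distance to its mean. Assumption 5. There exists a unique $x^\ast$ with $v(x^\ast,y_{1:N}^\diamond(x^\ast))=0$, and there is $\mu_0>0$ such that for all $x$: $\langle v(x,y_{1:N}^\diamond(x)),x-x^\ast\rangle\ge\mu_0\|x-x^\ast\|^2$. Asymptotic notation (in $K$): $f=\mathcal{O}(g)$ if there are constants $c<\infty$, $M>0$ with $f(K)\le c\,g(K)$ for all $K\ge M$; $f=\Omega(g)$ if there are $c>0$, $M>0$ with $f(K)\ge c\,g(K)$ for all $K\ge M$; $f=\Theta(g)$ if both hold; $f=\tilde{\mathcal{O}}(g)$ means $f=\mathcal{O}(g\max\{1,|\log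 g|\})$.
   Formalization: The step sizes are Θ(log K/K) with the implied constant of α large enough and the ratio α/β small enough (thresholds depend on v, h and the spread of the β constants), since arbitrary constants fail; the initial iterates have second moments bounded uniformly in K. *)

theory Defs
  imports "HOL-Probability.Probability" "HOL-Library.Landau_Symbols"
begin

(* The dimensions d_1, ..., d_N are arbitrary and need not agree, whereas a function n |-> y_n has
   a single value type.  The space R^(d_n) is therefore a linear subspace V n (of dimension d_n) of
   a common Euclidean space 'b, with the inner product, norm and Borel sets of 'b; every finite
   family of dimensions arises in this way.  The space R^(d_0) is the Euclidean space 'a.
   A tuple y_{1:n} is an element of Pi_E {1..n} V, that is, a function undefined outside {1..n};
   if y is y_{1:n-1}, then y(n := z) is the tuple (y_{1:n-1}, z). *)

definition well_typed ::
    "nat \<Rightarrow> (nat \<Rightarrow> 'b::euclidean_space set) \<Rightarrow> (nat \<Rightarrow> 'a::euclidean_space \<Rightarrow> (nat \<Rightarrow> 'b) \<Rightarrow> 'b) \<Rightarrow> bool"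
  where "well_typed N V h \<longleftrightarrow>
    (\<forall>n\<in>{1..N}. subspace (V n) \<and> (\<forall>x. \<forall>y\<in>Pi\<^sub>E {1..n} V. h n x y \<in> V n))"

definition strongly_monotone_h ::
    "nat \<Rightarrow> (nat \<Rightarrow> 'b::euclidean_space set) \<Rightarrow> (nat \<Rightarrow> 'a::euclidean_space \<Rightarrow> (nat \<Rightarrow> 'b) \<Rightarrow> 'b) \<Rightarrow> bool"
  where "strongly_monotone_h N V h \<longleftrightarrow>
    (\<forall>n\<in>{1..N}. \<exists>\<mu>>0. \<forall>x. \<forall>y\<in>Pi\<^sub>E {1..<n} V. \<forall>z\<in>V n. \<forall>z'\<in>V n.
       (h n x (y(n := z)) - h n x (y(n := z'))) \<bullet> (z - z') \<ge> \<mu> * (norm (z - z'))\<^sup>2)"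

definition lipschitz_in_each_variable ::
    "real \<Rightarrow> nat set \<Rightarrow> (nat \<Rightarrow> 'b::euclidean_space set) \<Rightarrow>
     ('a::euclidean_space \<Rightarrow> (nat \<Rightarrow> 'b) \<Rightarrow> 'c::metric_space) \<Rightarrow> bool"
  where "lipschitz_in_each_variable L I V f \<longleftrightarrow>
    (\<forall>y\<in>Pi\<^sub>E I V. L-lipschitz_on UNIV (\<lambda>x. f x y)) \<and>
    (\<forall>x. \<forall>y\<in>Pi\<^sub>E I V. \<forall>i\<in>I. L-lipschitz_on (V i) (\<lambda>z. f x (y(i := z))))"

(* Matrices in R^(d_n x d_n) are bounded linear maps of 'b that leave V n invariant.  The norm of
   such a map is its operator norm, i.e. the spectral norm; a linear map on V n is extended to 'b
   with the same norm by composing it with the orthogonal projection onto V n. *)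
definition regular_h ::
    "nat \<Rightarrow> (nat \<Rightarrow> 'b::euclidean_space set) \<Rightarrow> (nat \<Rightarrow> 'a::euclidean_space \<Rightarrow> (nat \<Rightarrow> 'b) \<Rightarrow> 'b) \<Rightarrow> bool"
  where "regular_h N V h \<longleftrightarrow>
    (\<forall>n\<in>{1..N}.
      (\<exists>L. lipschitz_in_each_variable L {1..n} V (h n)) \<or>
      (\<exists>(A :: 'a \<Rightarrow> (nat \<Rightarrow> 'b) \<Rightarrow> 'b \<Rightarrow>\<^sub>L 'b) (b :: 'a \<Rightarrow> (nat \<Rightarrow> 'b) \<Rightarrow> 'b) LA LA' Lb Lb'.
         (\<forall>x. \<forall>y\<in>Pi\<^sub>E {1..<n} V.
            (\<forall>z\<in>V n. blinfun_apply (A x y) z \<in> V n \<and> h n x (y(n := z)) = blinfun_apply (A x y) z + b x y) \<and>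
            b x y \<in> V n \<and> norm (A x y) \<le> LA' \<and> norm (b x y) \<le> Lb') \<and>
         lipschitz_in_each_variable LA {1..<n} V A \<and>
         lipschitz_in_each_variable Lb {1..<n} V b))"

definition y_star ::
    "(nat \<Rightarrow> 'b::euclidean_space set) \<Rightarrow> (nat \<Rightarrow> 'a::euclidean_space \<Rightarrow> (nat \<Rightarrow> 'b) \<Rightarrow> 'b) \<Rightarrow>
     nat \<Rightarrow> 'a \<Rightarrow> (nat \<Rightarrow> 'b) \<Rightarrow> 'b"
  where "y_star V h n x y = (THE z. z \<in> V n \<and> h n x (y(n := z)) = 0)"

lemma restrict_fundef_cong [fundef_cong]:
  "I = J \<Longrightarrow> (\<And>i. i \<in> J \<Longrightarrow> f i = g i) \<Longrightarrow> restrict f I = restrict g J"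
  by (auto simp: restrict_def)

function y_diamond ::
    "(nat \<Rightarrow> 'b::euclidean_space set) \<Rightarrow> (nat \<Rightarrow> 'a::euclidean_space \<Rightarrow> (nat \<Rightarrow> 'b) \<Rightarrow> 'b) \<Rightarrow>
     nat \<Rightarrow> 'a \<Rightarrow> 'b"
  where "y_diamond V h n x = y_star V h n x (\<lambda>i\<in>{1..<n}. y_diamond V h i x)"
  by auto
termination
  by (relation "Wellfounded.measure (\<lambda>(V, h, n, x). n)") auto

declare y_diamond.simps [simp del]

definition y_diamonds ::
    "(nat \<Rightarrow> 'b::euclidean_space set) \<Rightarrow> (nat \<Rightarrow> 'a::euclidean_space \<Rightarrow> (nat \<Rightarrow> 'b) \<Rightarrow> 'b) \<Rightarrow>
     nat \<Rightarrow> 'a \<Rightarrow> nat \<Rightarrow> 'b"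
  where "y_diamonds V h N x = (\<lambda>n\<in>{1..N}. y_diamond V h n x)"

definition lipschitz_v ::
    "nat \<Rightarrow> (nat \<Rightarrow> 'b::euclidean_space set) \<Rightarrow> ('a::euclidean_space \<Rightarrow> (nat \<Rightarrow> 'b) \<Rightarrow> 'a) \<Rightarrow>
     (nat \<Rightarrow> 'a \<Rightarrow> (nat \<Rightarrow> 'b) \<Rightarrow> 'b) \<Rightarrow> bool"
  where "lipschitz_v N V v h \<longleftrightarrow>
    (\<exists>L>0. \<forall>x x'. \<forall>y\<in>Pi\<^sub>E {1..N} V.
       norm (v x (y_diamonds V h N x) - v x' y)
         \<le> L * (norm (x - x') + (\<Sum>n=1..N. norm (y n - y_diamond V h n x))))"

definition strongly_monotone_v ::
    "nat \<Rightarrow> (nat \<Rightarrow> 'b::euclidean_space set) \<Rightarrow> ('a::euclidean_space \<Rightarrow> (nat \<Rightarrow> 'b) \<Rightarrow> 'a) \<Rightarrow>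
     (nat \<Rightarrow> 'a \<Rightarrow> (nat \<Rightarrow> 'b) \<Rightarrow> 'b) \<Rightarrow> 'a \<Rightarrow> bool"
  where "strongly_monotone_v N V v h xs \<longleftrightarrow>
    v xs (y_diamonds V h N xs) = 0 \<and>
    (\<forall>x. v x (y_diamonds V h N x) = 0 \<longrightarrow> x = xs) \<and>
    (\<exists>\<mu>>0. \<forall>x. v x (y_diamonds V h N x) \<bullet> (x - xs) \<ge> \<mu> * (norm (x - xs))\<^sup>2)"

definition history ::
    "nat \<Rightarrow> 'w measure \<Rightarrow> (nat \<Rightarrow> 'w \<Rightarrow> 'a::euclidean_space) \<Rightarrow> (nat \<Rightarrow> nat \<Rightarrow> 'w \<Rightarrow> 'b::euclidean_space) \<Rightarrow>
     nat \<Rightarrow> 'w measure"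
  where "history N M X Y k = sigma (space M)
    ({X l -` S \<inter> space M | l S. l \<le> k \<and> S \<in> sets borel} \<union>
     {Y n l -` S \<inter> space M | n l S. n \<in> {1..N} \<and> l \<le> k \<and> S \<in> sets borel})"

definition vec_cond_exp :: "'w measure \<Rightarrow> 'w measure \<Rightarrow> ('w \<Rightarrow> 'c::euclidean_space) \<Rightarrow> 'w \<Rightarrow> 'c"
  where "vec_cond_exp M F f \<omega> = (\<Sum>i\<in>Basis. real_cond_exp M F (\<lambda>\<omega>. f \<omega> \<bullet> i) \<omega> *\<^sub>R i)"

(* Extended nonnegative values, because real_cond_exp is 0 where the conditional expectation of a
   nonnegative function is infinite, so that real upper bounds would not exclude that case. *)
definition cond_variance :: "'w measure \<Rightarrow> 'w measure \<Rightarrow> ('w \<Rightarrow> 'c::euclidean_space) \<Rightarrow> 'w \<Rightarrow> ennreal"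
  where "cond_variance M F f =
    nn_cond_exp M F (\<lambda>\<omega>. ennreal ((norm (f \<omega> - vec_cond_exp M F f \<omega>))\<^sup>2))"

(* The noise of step k enters the iterates with index k + 1, hence the shift by one. *)
definition martingale_differences ::
    "nat \<Rightarrow> 'w measure \<Rightarrow> (nat \<Rightarrow> 'w measure) \<Rightarrow> (nat \<Rightarrow> 'w \<Rightarrow> 'c::euclidean_space) \<Rightarrow> bool"
  where "martingale_differences K M F \<xi> \<longleftrightarrow>
    (\<forall>k<K. \<xi> k \<in> borel_measurable (F (Suc k)) \<and> integrable M (\<xi> k) \<and>
           (AE \<omega> in M. vec_cond_exp M (F k) (\<xi> k) \<omega> = 0))"

(* A run of K iterations, from the initial point with index 0 to the iterate with index K. *)
definition mssa_run ::
    "nat \<Rightarrow> (nat \<Rightarrow> 'b::euclidean_space set) \<Rightarrow> ('a::euclidean_space \<Rightarrow> (nat \<Rightarrow> 'b) \<Rightarrow> 'a) \<Rightarrow>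
     (nat \<Rightarrow> 'a \<Rightarrow> (nat \<Rightarrow> 'b) \<Rightarrow> 'b) \<Rightarrow> nat \<Rightarrow> (nat \<Rightarrow> real) \<Rightarrow> (nat \<Rightarrow> nat \<Rightarrow> real) \<Rightarrow> 'w measure \<Rightarrow>
     (nat \<Rightarrow> 'w \<Rightarrow> 'a) \<Rightarrow> (nat \<Rightarrow> nat \<Rightarrow> 'w \<Rightarrow> 'b) \<Rightarrow>
     (nat \<Rightarrow> 'w \<Rightarrow> 'a) \<Rightarrow> (nat \<Rightarrow> nat \<Rightarrow> 'w \<Rightarrow> 'b) \<Rightarrow> bool"
  where "mssa_run N V v h K \<alpha> \<beta> M X Y \<xi> \<psi> \<longleftrightarrow>
    prob_space M \<and>
    (\<forall>k<K. \<alpha> k > 0 \<and> (\<forall>n\<in>{1..N}. \<beta> n k > 0)) \<and>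
    (\<forall>k\<le>K. X k \<in> borel_measurable M) \<and>
    (\<forall>n\<in>{1..N}. \<forall>k\<le>K. Y n k \<in> borel_measurable M \<and> (\<forall>\<omega>\<in>space M. Y n k \<omega> \<in> V n)) \<and>
    (\<forall>k<K. \<forall>\<omega>\<in>space M.
       X (Suc k) \<omega> = X k \<omega> - \<alpha> k *\<^sub>R (v (X k \<omega>) (\<lambda>i\<in>{1..N}. Y i k \<omega>) + \<xi> k \<omega>) \<and>
       (\<forall>n\<in>{1..N}. Y n (Suc k) \<omega> =
          Y n k \<omega> - \<beta> n k *\<^sub>R (h n (X k \<omega>) (\<lambda>i\<in>{1..n}. Y i k \<omega>) + \<psi> n k \<omega>)))"

definition noise_conditions ::
    "nat \<Rightarrow> ('a::euclidean_space \<Rightarrow> (nat \<Rightarrow> 'b::euclidean_space) \<Rightarrow> 'a) \<Rightarrow>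
     (nat \<Rightarrow> 'a \<Rightarrow> (nat \<Rightarrow> 'b) \<Rightarrow> 'b) \<Rightarrow> real \<Rightarrow> real \<Rightarrow> real \<Rightarrow> real \<Rightarrow> nat \<Rightarrow> 'w measure \<Rightarrow>
     (nat \<Rightarrow> 'w \<Rightarrow> 'a) \<Rightarrow> (nat \<Rightarrow> nat \<Rightarrow> 'w \<Rightarrow> 'b) \<Rightarrow>
     (nat \<Rightarrow> 'w \<Rightarrow> 'a) \<Rightarrow> (nat \<Rightarrow> nat \<Rightarrow> 'w \<Rightarrow> 'b) \<Rightarrow> bool"
  where "noise_conditions N v h \<omega>\<^sub>0 \<omega>\<^sub>1 \<omega>\<^sub>2 \<sigma> K M X Y \<xi> \<psi> \<longleftrightarrow>
    martingale_differences K M (history N M X Y) \<xi> \<and>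
    (\<forall>n\<in>{1..N}. martingale_differences K M (history N M X Y) (\<psi> n)) \<and>
    (\<forall>n\<in>{1..N}. \<forall>k<K. AE \<omega> in M.
       cond_variance M (history N M X Y k) (\<psi> n k) \<omega>
         \<le> ennreal (\<omega>\<^sub>0 * (norm (h n (X k \<omega>) (\<lambda>i\<in>{1..n}. Y i k \<omega>)))\<^sup>2 + \<sigma>\<^sup>2)) \<and>
    (\<forall>k<K. AE \<omega> in M.
       cond_variance M (history N M X Y k) (\<xi> k) \<omega>
         \<le> ennreal (\<omega>\<^sub>1 * (norm (v (X k \<omega>) (\<lambda>i\<in>{1..N}. Y i k \<omega>)))\<^sup>2 + \<sigma>\<^sup>2
             + \<omega>\<^sub>2 * (\<Sum>n=1..N. (norm (h n (X k \<omega>) (\<lambda>i\<in>{1..n}. Y i k \<omega>)))\<^sup>2)))"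

(* The step sizes, and with them the whole run, depend on the number K of iterations.  The squared
   norms of the initial points are bounded in mean uniformly in K; this covers a deterministic
   initial point that is independent of K. *)
definition bounded_initial_moments ::
    "nat \<Rightarrow> (nat \<Rightarrow> 'w measure) \<Rightarrow> (nat \<Rightarrow> nat \<Rightarrow> 'w \<Rightarrow> 'a::euclidean_space) \<Rightarrow>
     (nat \<Rightarrow> nat \<Rightarrow> nat \<Rightarrow> 'w \<Rightarrow> 'b::euclidean_space) \<Rightarrow> bool"
  where "bounded_initial_moments N M X Y \<longleftrightarrow>
    (\<exists>B. \<forall>K. integrable (M K) (\<lambda>\<omega>. (norm (X K 0 \<omega>))\<^sup>2) \<and>
             (\<integral>\<omega>. (norm (X K 0 \<omega>))\<^sup>2 \<partial>M K) \<le> B \<and>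
             (\<forall>n\<in>{1..N}. integrable (M K) (\<lambda>\<omega>. (norm (Y K n 0 \<omega>))\<^sup>2) \<and>
                          (\<integral>\<omega>. (norm (Y K n 0 \<omega>))\<^sup>2 \<partial>M K) \<le> B))"

(* s K k = Theta(log K / K), uniformly in the iteration k, with implied constants lo and hi.
   The choice of the implied constants matters.  For v(x) = x without noise and alpha = c log K / K
   the error decays only like K^(-2c), so c must be large; and for v(x,y) = 11 y - 10 x,
   h_1(x,y) = y - x the iteration with alpha = beta is unstable, so alpha / beta must be small. *)
definition step_size_theta :: "real \<Rightarrow> real \<Rightarrow> (nat \<Rightarrow> nat \<Rightarrow> real) \<Rightarrow> bool"
  where "step_size_theta lo hi s \<longleftrightarrow>
    (\<forall>\<^sub>F K in sequentially. \<forall>k<K.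
       lo * (ln (real K) / real K) \<le> s K k \<and> s K k \<le> hi * (ln (real K) / real K))"

definition soft_O :: "(nat \<Rightarrow> real) \<Rightarrow> (nat \<Rightarrow> real) set"
  where "soft_O g = O(\<lambda>K. g K * max 1 \<bar>ln (g K)\<bar>)"

end

theory Submission
  imports Defs
begin

text \<open>The error \<open>y n - y_diamond V h n x\<close> is not a good Lyapunov variable: \<open>y_diamond\<close> is only Lipschitz, so
  the noise in \<open>x\<close> shifts it by a first-order amount without zero mean. Instead \<open>x\<close> is compared with an
  auxiliary low-pass filter \<open>t\<close>, \<open>t' = t + \<gamma> (x - t)\<close> with \<open>\<gamma>\<close> of the order of the fast step sizes, which is
  predictable and moves slowly. With \<open>w = x - xs\<close>, \<open>p = x - t\<close> and \<open>u n = y n - y_diamond V h n t\<close> every noise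
  term enters with zero mean up to second order, the drift of \<open>u n\<close> involves only \<open>p\<close> and \<open>u i\<close> for \<open>i < n\<close>, and
  \<open>E|w|^2 + l E|p|^2 + sum_n e^n E|u n|^2\<close> contracts at the rate of the slow step size, for \<open>l\<close> large, \<open>e\<close>
  small, and the ratio of slow and fast step sizes small.\<close>

section \<open>Perturbation of zeros of strongly monotone maps\<close>

text \<open>The couplings between the error components have the same order as their decay, so a
  plain sum of mean squares need not decrease; the weights create the missing smallness. Tracking
  errors feed only from \<open>i < n\<close> into \<open>n\<close>, so the weight
  \<open>e ^ n\<close> gives each such coupling an extra factor \<open>e\<close>. The delay enters
  every tracking error at rate \<gamma>, and its own decay at rate \<gamma> pays for this once
  \<open>l\<close> is large. The slow error feeds the delay with strength \<alpha>^2/\<gamma>, which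
  its decay at rate \<alpha> can pay only if \<alpha>/\<gamma> is small. With s = ln K / K, the
  lower constant 8 C of the slow steps gives a contraction by 1 - 2 s. One s absorbs the
  second-order terms proportional to the Lyapunov function; the other leaves (1 - s)^K \<le> 1 / K
  for the initial error. The remaining source of order s^2 per step accumulates to order s. A
  separate obstacle is the affine form of \<open>h\<close>, which need not be globally Lipschitz in
  \<open>x\<close>. Perturbation bounds are therefore sought only at zeros, where monotonicity
  bounds the last variable.\<close>

lemma strongly_monotone_unique_zero:
  fixes f :: "'b::euclidean_space \<Rightarrow> 'b"
  assumes S: "subspace S" "f ` S \<subseteq> S"
    and lip: "\<And>z z'. z \<in> S \<Longrightarrow> z' \<in> S \<Longrightarrow> norm (f z - f z') \<le> L * norm (z - z')"
    and mono: "\<And>z z'. z \<in> S \<Longrightarrow> z' \<in> S \<Longrightarrow> m * (norm (z - z'))\<^sup>2 \<le> (f z - f z') \<bullet> (z - z')"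
    and "m > 0"
  shows "\<exists>!z. z \<in> S \<and> f z = 0"
proof -
  define B where "B = max L m"
  \<comment> \<open>The damped map z - t f(z) has squared Lipschitz constant at most 1 - 2 t m + t^2
    B^2. This \<open>t\<close> minimises it, with value 1 - m^2/B^2; taking \<open>B\<close> at
    least \<open>m\<close> keeps that value nonnegative, so that \<open>c\<close> is a genuine
    square root.\<close>
  define t where "t = m / B\<^sup>2"
  define c where "c = sqrt (1 - m\<^sup>2 / B\<^sup>2)"
  have B: "B > 0" "m \<le> B" "L \<le> B"
    using \<open>m > 0\<close> by (auto simp: B_def)
  have t: "t > 0"
    using B \<open>m > 0\<close> by (simp add: t_def)
  have "m\<^sup>2 \<le> B\<^sup>2"
    using B \<open>m > 0\<close> by (intro power_mono) auto
  hence c: "0 \<le> c" "c < 1" "c\<^sup>2 = 1 - m\<^sup>2 / B\<^sup>2"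
    using B \<open>m > 0\<close> by (auto simp: c_def real_sqrt_lt_1_iff)
  have "\<exists>!z. z \<in> S \<and> z - t *\<^sub>R f z = z"
  proof (rule Banach_fix)
    show "Topological_Spaces.complete S" "S \<noteq> {}"
      using S closed_subspace subspace_0 by (auto simp: complete_eq_closed)
    show "(\<lambda>z. z - t *\<^sub>R f z) ` S \<subseteq> S"
      using S by (auto intro!: subspace_diff subspace_scale)
    fix z z' assume z: "z \<in> S" "z' \<in> S"
    let ?d = "z - z'" and ?e = "f z - f z'"
    have "norm ?e \<le> B * norm ?d"
      using lip[OF z] B by (smt (verit) mult_right_mono norm_ge_zero)
    hence e: "(norm ?e)\<^sup>2 \<le> B\<^sup>2 * (norm ?d)\<^sup>2"
      by (metis norm_ge_zero power_mono power_mult_distrib)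
    have "(norm (?d - t *\<^sub>R ?e))\<^sup>2 = (norm ?d)\<^sup>2 - 2 * t * (?e \<bullet> ?d) + t\<^sup>2 * (norm ?e)\<^sup>2"
      unfolding power2_norm_eq_inner
      by (simp add: inner_diff_left inner_diff_right inner_commute power2_eq_square algebra_simps)
    also have "\<dots> \<le> (norm ?d)\<^sup>2 - 2 * t * (m * (norm ?d)\<^sup>2) + t\<^sup>2 * (B\<^sup>2 * (norm ?d)\<^sup>2)"
      using mono[OF z] e t by (intro add_mono diff_mono mult_left_mono) auto
    also have "\<dots> = (c * norm ?d)\<^sup>2"
    proof -
      have "t * m = m\<^sup>2 / B\<^sup>2" "t\<^sup>2 * B\<^sup>2 = m\<^sup>2 / B\<^sup>2"
        using B by (simp_all add: t_def power_divide power2_eq_square)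
      hence "(norm ?d)\<^sup>2 - 2 * t * (m * (norm ?d)\<^sup>2) + t\<^sup>2 * (B\<^sup>2 * (norm ?d)\<^sup>2) = (1 - m\<^sup>2 / B\<^sup>2) * (norm ?d)\<^sup>2"
        by (simp add: algebra_simps) (simp add: mult.assoc[symmetric])
      thus ?thesis
        by (simp add: power_mult_distrib c(3))
    qed
    finally have "norm (?d - t *\<^sub>R ?e) \<le> c * norm ?d"
      using c by (simp add: power2_le_iff_abs_le)
    moreover have "?d - t *\<^sub>R ?e = (z - t *\<^sub>R f z) - (z' - t *\<^sub>R f z')"
      by (simp add: algebra_simps)
    ultimately show "dist (z - t *\<^sub>R f z) (z' - t *\<^sub>R f z') \<le> c * dist z z'"
      by (simp add: dist_norm)
  qed (use c in auto)
  thus ?thesis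
    using t by simp
qed

lemma PiE_fun_upd_last:
  fixes n :: nat
  assumes "n \<ge> 1" "y \<in> Pi\<^sub>E {1..<n} V" "z \<in> V n"
  shows "y(n := z) \<in> Pi\<^sub>E {1..n} V"
proof -
  have "{1..n} = insert n {1..<n}"
    using assms(1) by auto
  thus ?thesis
    using assms by (simp add: PiE_fun_upd)
qed

lemma PiE_fun_upd_same:
  assumes "y \<in> Pi\<^sub>E I V" "i \<in> I" "w \<in> V i"
  shows "y(i := w) \<in> Pi\<^sub>E I V"
  using assms by (auto simp: PiE_iff extensional_def)

lemma lipschitz_in_each_variableD:
  assumes "lipschitz_in_each_variable L I V f" "y \<in> Pi\<^sub>E I V"
  shows "dist (f x y) (f x' y) \<le> L * dist x x'"
    and "i \<in> I \<Longrightarrow> w \<in> V i \<Longrightarrow> w' \<in> V i \<Longrightarrow>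
      dist (f x (y(i := w))) (f x (y(i := w'))) \<le> L * dist w w'"
    and "0 \<le> L"
  using assms unfolding lipschitz_in_each_variable_def lipschitz_on_def by blast+

lemma le_of_sq_le_mult:
  fixes x b :: real
  assumes "m > 0" "x \<ge> 0" "m * x\<^sup>2 \<le> b * x"  "b \<ge> 0"
  shows "x \<le> b / m"
proof (cases "x = 0")
  case False
  then have "m * x \<le> b" using assms by (simp add: power2_eq_square)
  then show ?thesis using assms by (simp add: field_simps)
qed (use assms in auto)

text \<open>Only the estimate in the last variable holds at all points. In the affine case
  \<open>A x y z\<close> varies with \<open>x\<close> and \<open>y\<close> in proportion to the norm
  of \<open>z\<close>, so the other two estimates are restricted to zeros, whose norm is bounded
  uniformly. This is enough to perturb zeros, and it lets both regularity cases share one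
  interface.\<close>

lemma regular_operator_estimates:
  fixes h :: "nat \<Rightarrow> 'a::euclidean_space \<Rightarrow> (nat \<Rightarrow> 'b::euclidean_space) \<Rightarrow> 'b"
  assumes "well_typed N V h" "regular_h N V h" and n: "n \<in> {1..N}" and "m > 0"
    and mono: "\<And>x y z z'. y \<in> Pi\<^sub>E {1..<n} V \<Longrightarrow> z \<in> V n \<Longrightarrow> z' \<in> V n \<Longrightarrow>
       m * (norm (z - z'))\<^sup>2 \<le> (h n x (y(n := z)) - h n x (y(n := z'))) \<bullet> (z - z')"
  obtains L where "L > 0"
    and "\<And>x y z z'. y \<in> Pi\<^sub>E {1..<n} V \<Longrightarrow> z \<in> V n \<Longrightarrow> z' \<in> V n \<Longrightarrow>
      norm (h n x (y(n := z)) - h n x (y(n := z'))) \<le> L * norm (z - z')"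
    and "\<And>x x' y z. y \<in> Pi\<^sub>E {1..<n} V \<Longrightarrow> z \<in> V n \<Longrightarrow> h n x (y(n := z)) = 0 \<Longrightarrow>
      norm (h n x' (y(n := z))) \<le> L * norm (x - x')"
    and "\<And>x y z i w. y \<in> Pi\<^sub>E {1..<n} V \<Longrightarrow> z \<in> V n \<Longrightarrow> h n x (y(n := z)) = 0 \<Longrightarrow> i \<in> {1..<n} \<Longrightarrow>
      w \<in> V i \<Longrightarrow> norm (h n x ((y(i := w))(n := z))) \<le> L * norm (y i - w)"
proof -
  have n1: "n \<ge> 1" and S: "subspace (V n)"
    using assms by (auto simp: well_typed_def)
  have V0: "0 \<in> V n"
    using S by (rule subspace_0)
  consider (a) L where "lipschitz_in_each_variable L {1..n} V (h n)"
    | (b) A b LA LA' Lb Lb' where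
         "\<forall>x. \<forall>y\<in>Pi\<^sub>E {1..<n} V.
            (\<forall>z\<in>V n. blinfun_apply (A x y) z \<in> V n \<and> h n x (y(n := z)) = blinfun_apply (A x y) z + b x y) \<and>
            b x y \<in> V n \<and> norm (A x y :: 'b \<Rightarrow>\<^sub>L 'b) \<le> LA' \<and> norm (b x y) \<le> Lb'"
         "lipschitz_in_each_variable LA {1..<n} V A"
         "lipschitz_in_each_variable Lb {1..<n} V b"
    using \<open>regular_h N V h\<close> n unfolding regular_h_def by metis
  thus ?thesis
  proof cases
    case (a L)
    have up: "(y(n := z)) \<in> Pi\<^sub>E {1..n} V" if "y \<in> Pi\<^sub>E {1..<n} V" "z \<in> V n" for y z
      using n1 that by (rule PiE_fun_upd_last)
    have ax: "norm (h n x y - h n x' y) \<le> L * norm (x - x')" if "y \<in> Pi\<^sub>E {1..n} V" for x x' y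
      using lipschitz_in_each_variableD(1)[OF a that] by (simp add: dist_norm)
    have ay: "norm (h n x (y(i := w)) - h n x (y(i := w'))) \<le> L * norm (w - w')"
      if "y \<in> Pi\<^sub>E {1..n} V" "i \<in> {1..n}" "w \<in> V i" "w' \<in> V i" for x y i w w'
      using lipschitz_in_each_variableD(2)[OF a that] by (simp add: dist_norm)
    have le: "L * norm q \<le> (\<bar>L\<bar> + 1) * norm q" for q :: "'z::real_normed_vector"
      by (intro mult_right_mono) auto
    show ?thesis
    proof (rule that[of "\<bar>L\<bar> + 1"])
      show "norm (h n x (y(n := z)) - h n x (y(n := z'))) \<le> (\<bar>L\<bar> + 1) * norm (z - z')"
        if "y \<in> Pi\<^sub>E {1..<n} V" "z \<in> V n" "z' \<in> V n" for x y z z'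
      proof -
        have "norm (h n x (y(n := z)) - h n x (y(n := z'))) \<le> L * norm (z - z')"
          using ay[OF up[OF that(1) V0], of n z z' x] that n1 by simp
        thus ?thesis
          using le order_trans by blast
      qed
      show "norm (h n x' (y(n := z))) \<le> (\<bar>L\<bar> + 1) * norm (x - x')"
        if "y \<in> Pi\<^sub>E {1..<n} V" "z \<in> V n" "h n x (y(n := z)) = 0" for x x' y z
      proof -
        have "norm (h n x' (y(n := z))) \<le> L * norm (x - x')"
          using ax[OF up[OF that(1,2)], of x x'] that by simp
        thus ?thesis
          using le order_trans by blast
      qed
      show "norm (h n x ((y(i := w))(n := z))) \<le> (\<bar>L\<bar> + 1) * norm (y i - w)"
        if "y \<in> Pi\<^sub>E {1..<n} V" "z \<in> V n" "h n x (y(n := z)) = 0" "i \<in> {1..<n}" "w \<in> V i"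
        for x y z i w
      proof -
        have "(y(n := z))(i := y i) = y(n := z)" "(y(i := w))(n := z) = (y(n := z))(i := w)"
          using that(4) by auto
        moreover have "y i \<in> V i"
          using that by auto
        ultimately have "norm (h n x ((y(i := w))(n := z))) \<le> L * norm (y i - w)"
          using ay[OF up[OF that(1,2)], of i "y i" w x] that(3-5) by simp
        thus ?thesis
          using le order_trans by blast
      qed
    qed auto
  next
    case (b A b LA LA' Lb Lb')
    have eq: "h n x (y(n := z)) = A x y z + b x y" if "y \<in> Pi\<^sub>E {1..<n} V" "z \<in> V n" for x y z
      using b(1) that by blast
    have A: "norm (A x y) \<le> LA'" and Bb: "norm (b x y) \<le> Lb'" if "y \<in> Pi\<^sub>E {1..<n} V" for x y
      using b(1) that by blast+
    \<comment> \<open>Some tuple is needed to read off the signs of the constants, because they are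
      given only through bounds at tuples.\<close>
    have ex: "(\<lambda>i\<in>{1..<n}. 0) \<in> Pi\<^sub>E {1..<n} V"
      using assms(1) n by (auto simp: well_typed_def intro!: subspace_0)
    have nn: "LA \<ge> 0" "Lb \<ge> 0" "LA' \<ge> 0" "Lb' \<ge> 0"
      using lipschitz_in_each_variableD(3)[OF b(2) ex] lipschitz_in_each_variableD(3)[OF b(3) ex]
        order_trans[OF norm_ge_zero A[OF ex]] order_trans[OF norm_ge_zero Bb[OF ex]] by auto
    \<comment> \<open>\<open>LA'\<close> serves the last variable, and
      \<open>Lb + LA * (Lb' / m)\<close> serves perturbations at a zero of norm at most
      \<open>Lb' / m\<close>. The summand 1 makes \<open>L\<close> positive.\<close>
    define L where "L = LA' + (Lb + LA * (Lb' / m)) + 1"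
    have L: "LA' \<le> L" "Lb + LA * (Lb' / m) \<le> L" "L > 0"
      using nn \<open>m > 0\<close> by (auto simp: L_def add_nonneg_nonneg add_nonneg_pos)
    \<comment> \<open>Monotonicity between the zero \<open>z\<close> and the point 0 of
      \<open>V n\<close>: the value at 0 is \<open>b x y\<close>, which is bounded by
      \<open>Lb'\<close>.\<close>
    have root: "norm z \<le> Lb' / m"
      if y: "y \<in> Pi\<^sub>E {1..<n} V" and z: "z \<in> V n" and z0: "h n x (y(n := z)) = 0" for x y z
    proof (rule le_of_sq_le_mult[OF \<open>m > 0\<close>])
      have "m * (norm z)\<^sup>2 \<le> A x y z \<bullet> z"
        using mono[OF y z V0, of x] eq[OF y z] eq[OF y V0] by simp
      also have "A x y z = - b x y"
        using eq[OF y z] z0 by (metis eq_neg_iff_add_eq_0)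
      also have "- b x y \<bullet> z \<le> Lb' * norm z"
        by (smt (verit) Bb[OF y] mult_right_mono norm_cauchy_schwarz norm_ge_zero norm_minus_cancel)
      finally show "m * (norm z)\<^sup>2 \<le> Lb' * norm z" .
    qed (use nn in auto)
    have pert: "norm (h n x' (y'(n := z))) \<le> L * d"
      if y: "y \<in> Pi\<^sub>E {1..<n} V" "y' \<in> Pi\<^sub>E {1..<n} V" and z: "z \<in> V n" and z0: "h n x (y(n := z)) = 0"
        and dA: "norm (A x y - A x' y') \<le> LA * d" and db: "norm (b x y - b x' y') \<le> Lb * d" and d: "d \<ge> 0"
      for x x' y y' z d
    proof -
      have "h n x' (y'(n := z)) = - ((A x y - A x' y') z + (b x y - b x' y'))"
        using eq[OF y(1) z, of x] eq[OF y(2) z, of x'] z0 by (simp add: blinfun.diff_left algebra_simps)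
      hence "norm (h n x' (y'(n := z))) \<le> norm ((A x y - A x' y') z) + norm (b x y - b x' y')"
        using norm_triangle_ineq by (metis norm_minus_cancel)
      also have "\<dots> \<le> LA * d * (Lb' / m) + Lb * d"
      proof (rule add_mono[OF _ db])
        have "norm ((A x y - A x' y') z) \<le> norm (A x y - A x' y') * norm z"
          by (rule norm_blinfun)
        also have "\<dots> \<le> (LA * d) * (Lb' / m)"
          using dA root[OF y(1) z z0] nn d by (intro mult_mono) auto
        finally show "norm ((A x y - A x' y') z) \<le> LA * d * (Lb' / m)" .
      qed
      also have "\<dots> = (Lb + LA * (Lb' / m)) * d"
        by (simp add: algebra_simps)
      also have "\<dots> \<le> L * d"
        using L d by (intro mult_right_mono) auto
      finally show ?thesis .
    qed
    show ?thesis
    proof (rule that[of L])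
      show "norm (h n x (y(n := z)) - h n x (y(n := z'))) \<le> L * norm (z - z')"
        if "y \<in> Pi\<^sub>E {1..<n} V" "z \<in> V n" "z' \<in> V n" for x y z z'
      proof -
        have "h n x (y(n := z)) - h n x (y(n := z')) = A x y (z - z')"
          using eq that by (simp add: blinfun.diff_right)
        also have "norm \<dots> \<le> norm (A x y) * norm (z - z')"
          by (rule norm_blinfun)
        also have "\<dots> \<le> L * norm (z - z')"
          using A[OF that(1), of x] L by (intro mult_right_mono) auto
        finally show ?thesis .
      qed
      show "norm (h n x' (y(n := z))) \<le> L * norm (x - x')"
        if "y \<in> Pi\<^sub>E {1..<n} V" "z \<in> V n" "h n x (y(n := z)) = 0" for x x' y z
        using that lipschitz_in_each_variableD(1)[OF b(2)] lipschitz_in_each_variableD(1)[OF b(3)]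
        by (intro pert[of y]) (auto simp: dist_norm)
      show "norm (h n x ((y(i := w))(n := z))) \<le> L * norm (y i - w)"
        if "y \<in> Pi\<^sub>E {1..<n} V" "z \<in> V n" "h n x (y(n := z)) = 0" "i \<in> {1..<n}" "w \<in> V i"
        for x y z i w
      proof -
        have "y i \<in> V i"
          using that by auto
        hence "norm (A x (y(i := y i)) - A x (y(i := w))) \<le> LA * norm (y i - w)"
          "norm (b x (y(i := y i)) - b x (y(i := w))) \<le> Lb * norm (y i - w)"
          using that lipschitz_in_each_variableD(2)[OF b(2)] lipschitz_in_each_variableD(2)[OF b(3)]
          by (metis dist_norm)+
        thus ?thesis
          using that PiE_fun_upd_same[of y "{1..<n}" V i w] by (intro pert[of y]) auto
      qed
    qed (use L in auto)
  qed
qed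


text \<open>Telescoping: first \<open>x\<close> is changed, then one coordinate after another. The
  intermediate tuples \<open>override_on y y' J\<close> mix values of two admissible tuples and so
  stay in the product.\<close>

lemma lipschitz_jointly:
  fixes f :: "'a::real_normed_vector \<Rightarrow> (nat \<Rightarrow> 'b::real_normed_vector) \<Rightarrow> 'c::real_normed_vector"
  assumes "finite I"
    and x: "\<And>x x' y. y \<in> Pi\<^sub>E I V \<Longrightarrow> norm (f x y - f x' y) \<le> c * norm (x - x')"
    and y: "\<And>x y i w. y \<in> Pi\<^sub>E I V \<Longrightarrow> i \<in> I \<Longrightarrow> w \<in> V i \<Longrightarrow>
      norm (f x y - f x (y(i := w))) \<le> c * norm (y i - w)"
    and yy: "y \<in> Pi\<^sub>E I V" "y' \<in> Pi\<^sub>E I V"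
  shows "norm (f x y - f x' y') \<le> c * (norm (x - x') + (\<Sum>i\<in>I. norm (y i - y' i)))"
proof -
  have mixed: "override_on y y' J \<in> Pi\<^sub>E I V" if "J \<subseteq> I" for J
    using that yy by (auto simp: override_on_def PiE_iff extensional_def)
  have "norm (f x' y - f x' (override_on y y' J)) \<le> c * (\<Sum>i\<in>J. norm (y i - y' i))" if "J \<subseteq> I" for J
    using finite_subset[OF that \<open>finite I\<close>] that
  proof (induction J rule: finite_induct)
    case (insert i J)
    have "norm (f x' (override_on y y' J) - f x' ((override_on y y' J)(i := y' i)))
        \<le> c * norm (override_on y y' J i - y' i)"
      using insert.prems yy by (intro y mixed) auto
    moreover have "override_on y y' J i = y i"
      using insert.hyps by simp
    ultimately have "norm (f x' (override_on y y' J) - f x' (override_on y y' (insert i J)))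
        \<le> c * norm (y i - y' i)"
      by (simp add: override_on_insert)
    moreover have "norm (f x' y - f x' (override_on y y' J)) \<le> c * (\<Sum>i\<in>J. norm (y i - y' i))"
      using insert by blast
    ultimately show ?case
      using insert.hyps norm_triangle_ineq[of "f x' y - f x' (override_on y y' J)"
          "f x' (override_on y y' J) - f x' (override_on y y' (insert i J))"]
      by (simp add: distrib_left)
  qed simp
  from this[of I] have "norm (f x' y - f x' (override_on y y' I)) \<le> c * (\<Sum>i\<in>I. norm (y i - y' i))"
    by simp
  moreover have "override_on y y' I = y'"
  proof
    show "override_on y y' I i = y' i" for i
      using yy by (cases "i \<in> I") (auto simp: PiE_iff extensional_def)
  qed
  ultimately show ?thesis
    using x[OF yy(1), of x x'] norm_triangle_ineq[of "f x y - f x' y" "f x' y - f x' y'"]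
    by (simp add: distrib_left)
qed

text \<open>Everything later required of layer \<open>n\<close>, with a single constant.
  Monotonicity is recorded with modulus \<open>1 / C\<close>, so the whole statement survives an
  increase of \<open>C\<close> and finitely many layers can share one constant.\<close>

definition nested_estimate ::
    "(nat \<Rightarrow> 'b::euclidean_space set) \<Rightarrow> (nat \<Rightarrow> 'a::euclidean_space \<Rightarrow> (nat \<Rightarrow> 'b) \<Rightarrow> 'b) \<Rightarrow>
     nat \<Rightarrow> real \<Rightarrow> bool"
  where "nested_estimate V h n C \<longleftrightarrow> (\<forall>x. \<forall>y\<in>Pi\<^sub>E {1..<n} V.
    y_star V h n x y \<in> V n \<and> h n x (y(n := y_star V h n x y)) = 0 \<and>
    (\<forall>z\<in>V n. \<forall>z'\<in>V n.
      norm (h n x (y(n := z)) - h n x (y(n := z'))) \<le> C * norm (z - z') \<and>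
      (norm (z - z'))\<^sup>2 / C \<le> (h n x (y(n := z)) - h n x (y(n := z'))) \<bullet> (z - z')) \<and>
    (\<forall>x'. \<forall>y'\<in>Pi\<^sub>E {1..<n} V.
      norm (y_star V h n x y - y_star V h n x' y')
        \<le> C * (norm (x - x') + (\<Sum>i\<in>{1..<n}. norm (y i - y' i)))))"

lemma nested_estimate_mono:
  assumes "nested_estimate V h n C" "0 < C" "C \<le> C'"
  shows "nested_estimate V h n C'"
proof -
  have "a \<le> C' * b" if "a \<le> C * b" "0 \<le> b" for a b
    using that assms(3) by (meson mult_right_mono order_trans)
  moreover have "a / C' \<le> b" if "a / C \<le> b" "0 \<le> a" for a b
    using that assms(2,3) by (meson divide_left_mono mult_pos_pos order_less_le_trans order_trans)
  ultimately show ?thesis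
    using assms(1) unfolding nested_estimate_def by (simp add: sum_nonneg)
qed

lemma nested_estimate_exists:
  assumes "well_typed N V h" "strongly_monotone_h N V h" "regular_h N V h" and n: "n \<in> {1..N}"
  shows "\<exists>C>0. nested_estimate V h n C"
proof -
  obtain m where "m > 0" and mono: "\<And>x y z z'. y \<in> Pi\<^sub>E {1..<n} V \<Longrightarrow> z \<in> V n \<Longrightarrow> z' \<in> V n \<Longrightarrow>
       m * (norm (z - z'))\<^sup>2 \<le> (h n x (y(n := z)) - h n x (y(n := z'))) \<bullet> (z - z')"
    using assms(2) n unfolding strongly_monotone_h_def by metis
  obtain L where L: "L > 0"
    and lip: "\<And>x y z z'. y \<in> Pi\<^sub>E {1..<n} V \<Longrightarrow> z \<in> V n \<Longrightarrow> z' \<in> V n \<Longrightarrow>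
      norm (h n x (y(n := z)) - h n x (y(n := z'))) \<le> L * norm (z - z')"
    and px: "\<And>x x' y z. y \<in> Pi\<^sub>E {1..<n} V \<Longrightarrow> z \<in> V n \<Longrightarrow> h n x (y(n := z)) = 0 \<Longrightarrow>
      norm (h n x' (y(n := z))) \<le> L * norm (x - x')"
    and py: "\<And>x y z i w. y \<in> Pi\<^sub>E {1..<n} V \<Longrightarrow> z \<in> V n \<Longrightarrow> h n x (y(n := z)) = 0 \<Longrightarrow> i \<in> {1..<n} \<Longrightarrow>
      w \<in> V i \<Longrightarrow> norm (h n x ((y(i := w))(n := z))) \<le> L * norm (y i - w)"
    by (rule regular_operator_estimates[OF assms(1,3) n \<open>m > 0\<close> mono that])
  let ?s = "y_star V h n"
  have star: "?s x y \<in> V n \<and> h n x (y(n := ?s x y)) = 0" if y: "y \<in> Pi\<^sub>E {1..<n} V" for x y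
  proof -
    have "\<exists>!z. z \<in> V n \<and> h n x (y(n := z)) = 0"
    proof (rule strongly_monotone_unique_zero[where L = L and m = m])
      show "subspace (V n)" "(\<lambda>z. h n x (y(n := z))) ` V n \<subseteq> V n"
        using assms(1) n PiE_fun_upd_last[OF _ y] by (auto simp: well_typed_def)
    qed (use lip mono y \<open>m > 0\<close> in auto)
    thus ?thesis
      unfolding y_star_def by (rule theI')
  qed
  \<comment> \<open>An error bound: strong monotonicity makes the distance to the zero at most the
    residual divided by \<open>m\<close>. Continuity of \<open>y_star\<close> follows by testing the
    zero for one argument as an approximate zero for a perturbed argument.\<close>
  have root_near: "norm (?s x y - z) \<le> d / m"
    if y: "y \<in> Pi\<^sub>E {1..<n} V" and z: "z \<in> V n" and d: "norm (h n x (y(n := z))) \<le> d" for x y z d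
  proof (rule le_of_sq_le_mult[OF \<open>m > 0\<close>])
    have "m * (norm (?s x y - z))\<^sup>2 \<le> (- h n x (y(n := z))) \<bullet> (?s x y - z)"
      using mono[OF y _ z, of "?s x y" x] star[OF y, of x] by simp
    also have "\<dots> \<le> norm (h n x (y(n := z))) * norm (?s x y - z)"
      by (metis norm_cauchy_schwarz norm_minus_cancel)
    also have "\<dots> \<le> d * norm (?s x y - z)"
      using d by (intro mult_right_mono) auto
    finally show "m * (norm (?s x y - z))\<^sup>2 \<le> d * norm (?s x y - z)" .
  qed (use d norm_ge_zero order_trans in blast)+
  define C where "C = max (max L (L / m)) (1 / m)"
  have C: "L \<le> C" "L / m \<le> C" "1 / m \<le> C" "C > 0"
    using L by (auto simp: C_def)
  have slip: "norm (?s x y - ?s x' y') \<le> L / m * (norm (x - x') + (\<Sum>i\<in>{1..<n}. norm (y i - y' i)))"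
    if "y \<in> Pi\<^sub>E {1..<n} V" "y' \<in> Pi\<^sub>E {1..<n} V" for x x' y y'
  proof (rule lipschitz_jointly[OF _ _ _ that])
    show "norm (?s x y - ?s x' y) \<le> L / m * norm (x - x')" if "y \<in> Pi\<^sub>E {1..<n} V" for x x' y
      using root_near[OF that _ px[of y "?s x y" x x']] star[OF that, of x] that
      by (simp add: norm_minus_commute)
    show "norm (?s x y - ?s x (y(i := w))) \<le> L / m * norm (y i - w)"
      if "y \<in> Pi\<^sub>E {1..<n} V" "i \<in> {1..<n}" "w \<in> V i" for x y i w
      using root_near[OF PiE_fun_upd_same[OF that] _ py[of y "?s x y" x i w]] star[OF that(1), of x] that
      by (simp add: norm_minus_commute)
  qed simp
  have "nested_estimate V h n C"
    unfolding nested_estimate_def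
  proof (intro allI ballI conjI)
    fix x y z z' assume y: "y \<in> Pi\<^sub>E {1..<n} V" and z: "z \<in> V n" "z' \<in> V n"
    show "norm (h n x (y(n := z)) - h n x (y(n := z'))) \<le> C * norm (z - z')"
      using lip[OF y z, of x] mult_right_mono[OF C(1) norm_ge_zero] order_trans by blast
    have "(norm (z - z'))\<^sup>2 / C \<le> m * (norm (z - z'))\<^sup>2"
      using C \<open>m > 0\<close> mult_right_mono[of 1 "m * C" "(norm (z - z'))\<^sup>2"] by (simp add: field_simps)
    thus "(norm (z - z'))\<^sup>2 / C \<le> (h n x (y(n := z)) - h n x (y(n := z'))) \<bullet> (z - z')"
      using mono[OF y z, of x] by linarith
  next
    fix x y x' y' assume "y \<in> Pi\<^sub>E {1..<n} V" "y' \<in> Pi\<^sub>E {1..<n} V"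
    thus "norm (?s x y - ?s x' y') \<le> C * (norm (x - x') + (\<Sum>i\<in>{1..<n}. norm (y i - y' i)))"
      using slip C(2) by (meson add_nonneg_nonneg mult_right_mono norm_ge_zero order_trans sum_nonneg)
  qed (use star in auto)
  thus ?thesis
    using C by blast
qed

section \<open>Uniform constants and Lipschitz continuity of the composed zeros\<close>

lemma finite_uniform_constant:
  assumes "finite I" "\<And>i. i \<in> I \<Longrightarrow> \<exists>c>0. P i c"
    and "\<And>i c c'. i \<in> I \<Longrightarrow> P i c \<Longrightarrow> 0 < c \<Longrightarrow> c \<le> c' \<Longrightarrow> P i c'"
  shows "\<exists>c\<ge>1::real. \<forall>i\<in>I. P i c"
proof -
  obtain c where c: "\<And>i. i \<in> I \<Longrightarrow> 0 < c i \<and> P i (c i)"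
    using assms(2) by metis
  have "P i (1 + sum c I)" if "i \<in> I" for i
  proof (rule assms(3)[OF that])
    show "c i \<le> 1 + sum c I"
      using member_le_sum[of i I c] that c assms(1) by (simp add: less_imp_le add_increasing)
  qed (use c that in auto)
  moreover have "sum c I \<ge> 0"
    using c by (intro sum_nonneg) (auto intro: less_imp_le)
  ultimately show ?thesis
    by (intro exI[of _ "1 + sum c I"]) auto
qed

lemma y_diamond_star:
  "y_diamond V h n x = y_star V h n x (restrict (\<lambda>i. y_diamond V h i x) {1..<n})"
  by (subst y_diamond.simps) rule

text \<open>Strong induction, since layer \<open>n\<close> is \<open>y_star\<close> evaluated at all
  earlier layers. Membership in \<open>V n\<close> has to be carried along, because
  \<open>nested_estimate\<close> speaks only of tuples in the product.\<close>

lemma y_diamond_estimates: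
  assumes "\<And>n. n \<in> {1..N} \<Longrightarrow> nested_estimate V h n C" "C \<ge> 0" "n \<in> {1..N}"
  shows "(\<forall>x. y_diamond V h n x \<in> V n) \<and>
    (\<exists>c>0. \<forall>x x'. norm (y_diamond V h n x - y_diamond V h n x') \<le> c * norm (x - x'))"
  using assms(3)
proof (induction n rule: less_induct)
  case (less n)
  let ?D = "y_diamond V h" and ?r = "\<lambda>x. restrict (\<lambda>i. y_diamond V h i x) {1..<n}"
  have r: "?r x \<in> Pi\<^sub>E {1..<n} V" for x
    using less by (intro restrict_PiE_iff[THEN iffD2]) auto
  have "\<exists>c\<ge>1. \<forall>i\<in>{1..<n}. \<forall>x x'. norm (?D i x - ?D i x') \<le> c * norm (x - x')"
  proof (rule finite_uniform_constant)
    fix i assume "i \<in> {1..<n}"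
    thus "\<exists>c>0. \<forall>x x'. norm (?D i x - ?D i x') \<le> c * norm (x - x')"
      using less by auto
  qed (meson finite_atLeastLessThan mult_right_mono norm_ge_zero order_trans)+
  then obtain c where c: "c \<ge> 1" "\<And>i x x'. i \<in> {1..<n} \<Longrightarrow> norm (?D i x - ?D i x') \<le> c * norm (x - x')"
    by blast
  have "norm (?D n x - ?D n x') \<le> (C * (1 + n * c) + 1) * norm (x - x')" for x x'
  proof -
    have "(\<Sum>i\<in>{1..<n}. norm (?r x i - ?r x' i)) \<le> of_nat (card {1..<n}) * (c * norm (x - x'))"
      using c(2) by (intro sum_bounded_above) auto
    also have "\<dots> \<le> n * (c * norm (x - x'))"
      using c(1) by (intro mult_right_mono) auto
    finally have s: "(\<Sum>i\<in>{1..<n}. norm (?r x i - ?r x' i)) \<le> n * c * norm (x - x')"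
      by simp
    have "norm (?D n x - ?D n x') \<le> C * (norm (x - x') + (\<Sum>i\<in>{1..<n}. norm (?r x i - ?r x' i)))"
      using assms(1)[OF less.prems] r unfolding nested_estimate_def
      by (subst (1 2) y_diamond_star) blast
    also have "\<dots> \<le> C * (norm (x - x') + n * c * norm (x - x'))"
      using s assms(2) by (intro mult_left_mono add_left_mono)
    finally show ?thesis
      by (simp add: algebra_simps add_increasing)
  qed
  moreover have "?D n x \<in> V n" for x
    using assms(1)[OF less.prems] r unfolding nested_estimate_def by (subst y_diamond_star) blast
  moreover have "C * (1 + n * c) + 1 > 0"
    using assms(2) c(1) by (simp add: add_nonneg_pos)
  ultimately show ?case
    by blast
qed

section \<open>Estimates along a delayed target\<close>

text \<open>The point \<open>t\<close> stands for a delayed copy of \<open>x\<close>, and \<open>y n\<close> is compared with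
  \<open>y_diamond V h n t\<close> instead of \<open>y_diamond V h n x\<close>.\<close>

locale tracking_estimates =
  fixes N :: nat
    and V :: "nat \<Rightarrow> 'b::euclidean_space set"
    and v :: "'a::euclidean_space \<Rightarrow> (nat \<Rightarrow> 'b) \<Rightarrow> 'a"
    and h :: "nat \<Rightarrow> 'a \<Rightarrow> (nat \<Rightarrow> 'b) \<Rightarrow> 'b"
    and xs :: 'a
    and C :: real
  assumes C_ge_1: "1 \<le> C"
    and star_lipschitz: "\<And>n x x' y y'. n \<in> {1..N} \<Longrightarrow> y \<in> Pi\<^sub>E {1..<n} V \<Longrightarrow> y' \<in> Pi\<^sub>E {1..<n} V \<Longrightarrow>
      norm (y_star V h n x y - y_star V h n x' y')
        \<le> C * (norm (x - x') + (\<Sum>i\<in>{1..<n}. norm (y i - y' i)))"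
    and diamond_lipschitz: "\<And>n x x'. n \<in> {1..N} \<Longrightarrow>
      norm (y_diamond V h n x - y_diamond V h n x') \<le> C * norm (x - x')"
    and gap_bound: "\<And>n x t y. n \<in> {1..N} \<Longrightarrow> (\<And>i. i \<in> {1..N} \<Longrightarrow> y i \<in> V i) \<Longrightarrow>
      (norm (y n - y_star V h n x (restrict y {1..<n})))\<^sup>2
        \<le> C * ((norm (x - t))\<^sup>2 + (\<Sum>i=1..N. (norm (y i - y_diamond V h i t))\<^sup>2))"
    and h_bound: "\<And>n x t y. n \<in> {1..N} \<Longrightarrow> (\<And>i. i \<in> {1..N} \<Longrightarrow> y i \<in> V i) \<Longrightarrow>
      (norm (h n x (restrict y {1..n})))\<^sup>2
        \<le> C * ((norm (x - t))\<^sup>2 + (\<Sum>i=1..N. (norm (y i - y_diamond V h i t))\<^sup>2))"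
    and h_coercive: "\<And>n x t y. n \<in> {1..N} \<Longrightarrow> (\<And>i. i \<in> {1..N} \<Longrightarrow> y i \<in> V i) \<Longrightarrow>
      (norm (y n - y_diamond V h n t))\<^sup>2 / C
        \<le> h n x (restrict y {1..n}) \<bullet> (y n - y_diamond V h n t)
          + C * ((norm (x - t))\<^sup>2 + (\<Sum>i\<in>{1..<n}. (norm (y i - y_diamond V h i t))\<^sup>2))"
    and v_bound: "\<And>x t y. (\<And>i. i \<in> {1..N} \<Longrightarrow> y i \<in> V i) \<Longrightarrow>
      (norm (v x (restrict y {1..N})))\<^sup>2
        \<le> C * ((norm (x - xs))\<^sup>2 + (norm (x - t))\<^sup>2 + (\<Sum>i=1..N. (norm (y i - y_diamond V h i t))\<^sup>2))"
    and v_coercive: "\<And>x t y. (\<And>i. i \<in> {1..N} \<Longrightarrow> y i \<in> V i) \<Longrightarrow>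
      (norm (x - xs))\<^sup>2 / C
        \<le> v x (restrict y {1..N}) \<bullet> (x - xs)
          + C * ((norm (x - t))\<^sup>2 + (\<Sum>i=1..N. (norm (y i - y_diamond V h i t))\<^sup>2))"

text \<open>Cauchy-Schwarz for the sum. The factor depends on \<open>N\<close> and not on
  \<open>I\<close>, so one constant serves both the full sum and the sums over earlier
  layers.\<close>

lemma square_add_sum_le:
  fixes a :: real and b :: "'i \<Rightarrow> real"
  assumes "finite I" "card I \<le> N"
  shows "(a + sum b I)\<^sup>2 \<le> 2 * (real N + 1) * (a\<^sup>2 + (\<Sum>i\<in>I. (b i)\<^sup>2))"
proof -
  have "(sum b I)\<^sup>2 \<le> card I * (\<Sum>i\<in>I. (b i)\<^sup>2)"
    using sum_squared_le_sum_of_squares[of b I] assms(1) by (simp add: mult.commute)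
  also have "\<dots> \<le> N * (\<Sum>i\<in>I. (b i)\<^sup>2)"
    using assms(2) by (intro mult_right_mono sum_nonneg) auto
  finally have "(sum b I)\<^sup>2 \<le> N * (\<Sum>i\<in>I. (b i)\<^sup>2)" .
  moreover have "(a + sum b I)\<^sup>2 \<le> 2 * a\<^sup>2 + 2 * (sum b I)\<^sup>2"
    using sum_squares_bound[of a "sum b I"] by (simp add: power2_sum)
  ultimately have "(a + sum b I)\<^sup>2 \<le> 2 * a\<^sup>2 + 2 * (N * (\<Sum>i\<in>I. (b i)\<^sup>2))"
    by linarith
  also have "\<dots> \<le> 2 * (real N + 1) * (a\<^sup>2 + (\<Sum>i\<in>I. (b i)\<^sup>2))"
    by (simp add: algebra_simps sum_nonneg)
  finally show ?thesis .
qed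

text \<open>Young's inequality: half of the coercive term pays for the term linear in
  \<open>a\<close>.\<close>

lemma absorb_linear_term:
  fixes a B K i :: real
  assumes "a\<^sup>2 / B \<le> i + K * a" "B > 0"
  shows "a\<^sup>2 / (2 * B) \<le> i + B / 2 * K\<^sup>2"
proof -
  have "0 \<le> (a - B * K)\<^sup>2 / (2 * B)"
    using assms(2) by simp
  also have "\<dots> = a\<^sup>2 / (2 * B) - K * a + B / 2 * K\<^sup>2"
    using assms(2) by (simp add: power2_eq_square field_simps)
  finally have "K * a \<le> a\<^sup>2 / (2 * B) + B / 2 * K\<^sup>2"
    by simp
  moreover have "a\<^sup>2 / B = a\<^sup>2 / (2 * B) + a\<^sup>2 / (2 * B)"
    by simp
  ultimately show ?thesis
    using assms(1) by linarith
qed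

text \<open>All bounds are first proved linearly in \<open>T\<close>, the sum of the distances, and
  then squared into \<open>Q\<close>. The index set is an argument of both because coercivity of
  layer \<open>n\<close> may involve earlier layers only, whereas the size of \<open>h\<close> may
  involve all of them.\<close>

lemma tracking_estimates_exist:
  fixes h :: "nat \<Rightarrow> 'a::euclidean_space \<Rightarrow> (nat \<Rightarrow> 'b::euclidean_space) \<Rightarrow> 'b"
  assumes "well_typed N V h" "strongly_monotone_h N V h" "regular_h N V h"
    "lipschitz_v N V v h" "strongly_monotone_v N V v h xs"
  obtains C where "tracking_estimates N V v h xs C"
proof -
  let ?D = "y_diamond V h" and ?s = "y_star V h"
  have "\<exists>C\<ge>1. \<forall>n\<in>{1..N}. nested_estimate V h n C"
    using nested_estimate_exists[OF assms(1-3)]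
    by (intro finite_uniform_constant) (auto intro: nested_estimate_mono)
  then obtain B1 where B1: "B1 \<ge> 1" "\<And>n. n \<in> {1..N} \<Longrightarrow> nested_estimate V h n B1"
    by blast
  have D_in: "?D n x \<in> V n" if "n \<in> {1..N}" for n x
    using y_diamond_estimates[of N V h B1, OF B1(2)] B1(1) that by auto
  have "\<exists>c\<ge>1. \<forall>n\<in>{1..N}. \<forall>x x'. norm (?D n x - ?D n x') \<le> c * norm (x - x')"
  proof (rule finite_uniform_constant)
    show "\<exists>c>0. \<forall>x x'. norm (?D n x - ?D n x') \<le> c * norm (x - x')" if "n \<in> {1..N}" for n
      using y_diamond_estimates[of N V h B1, OF B1(2)] B1(1) that by auto
  qed (meson finite_atLeastAtMost mult_right_mono norm_ge_zero order_trans)+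
  then obtain B2 where B2: "B2 \<ge> 1"
    "\<And>n x x'. n \<in> {1..N} \<Longrightarrow> norm (?D n x - ?D n x') \<le> B2 * norm (x - x')"
    by blast
  obtain B3 where B3: "B3 > 0" "\<And>x x' y. y \<in> Pi\<^sub>E {1..N} V \<Longrightarrow>
      norm (v x (y_diamonds V h N x) - v x' y) \<le> B3 * (norm (x - x') + (\<Sum>n=1..N. norm (y n - ?D n x)))"
    using assms(4) unfolding lipschitz_v_def by blast
  obtain m where m: "m > 0" "\<And>x. m * (norm (x - xs))\<^sup>2 \<le> v x (y_diamonds V h N x) \<bullet> (x - xs)"
    using assms(5) unfolding strongly_monotone_v_def by blast
  have v0: "v xs (y_diamonds V h N xs) = 0"
    using assms(5) unfolding strongly_monotone_v_def by blast
  define B where "B = B1 + B2 + B3 + 1 / m"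
  have B: "B1 \<le> B" "B2 \<le> B" "B3 \<le> B" "1 / m \<le> B" "1 \<le> B"
    using B1(1) B2(1) B3(1) divide_pos_pos[OF zero_less_one m(1)] unfolding B_def by linarith+
  have nest: "nested_estimate V h n B" if "n \<in> {1..N}" for n
    using nested_estimate_mono[OF B1(2)[OF that]] B1(1) B(1) by simp
  have D_lip: "norm (?D n x - ?D n x') \<le> B * norm (x - x')" if "n \<in> {1..N}" for n x x'
    using B2(2)[OF that] B(2) by (meson mult_right_mono norm_ge_zero order_trans)
  have v_lip: "norm (v x (y_diamonds V h N x) - v x' y) \<le> B * (norm (x - x') + (\<Sum>n=1..N. norm (y n - ?D n x)))"
    if "y \<in> Pi\<^sub>E {1..N} V" for x x' y
    using B3(2)[OF that, of x x'] B(3)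
    by (meson add_nonneg_nonneg mult_right_mono norm_ge_zero order_trans sum_nonneg)
  have v_mono: "(norm (x - xs))\<^sup>2 / B \<le> v x (y_diamonds V h N x) \<bullet> (x - xs)" for x
  proof -
    have "(norm (x - xs))\<^sup>2 / B \<le> m * (norm (x - xs))\<^sup>2"
      using B m(1) mult_right_mono[of 1 "m * B" "(norm (x - xs))\<^sup>2"] by (simp add: field_simps)
    thus ?thesis
      using m(2)[of x] by linarith
  qed
  have D_PiE: "restrict (\<lambda>i. ?D i x) {1..<n} \<in> Pi\<^sub>E {1..<n} V" if "n \<in> {1..N}" for n x
    using D_in that by auto
  have dD: "y_diamonds V h N x \<in> Pi\<^sub>E {1..N} V" for x
    using D_in by (auto simp: y_diamonds_def)
  define T where "T x t y I = norm (x - t) + (\<Sum>i\<in>I. norm (y i - ?D i t))" for x t y and I :: "nat set"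
  define Q where "Q x t y I = (norm (x - t))\<^sup>2 + (\<Sum>i\<in>I. (norm (y i - ?D i t))\<^sup>2)" for x t y and I :: "nat set"
  have T_nonneg: "T x t y I \<ge> 0" and Q_nonneg: "Q x t y I \<ge> 0" for x t y I
    by (simp_all add: T_def Q_def sum_nonneg)
  have TQ: "(T x t y I)\<^sup>2 \<le> 2 * (real N + 1) * Q x t y I" if "I \<subseteq> {1..N}" for x t y I
  proof -
    have "card I \<le> N" "finite I"
      using card_mono[OF _ that] finite_subset[OF that] by auto
    thus ?thesis
      unfolding T_def Q_def by (intro square_add_sum_le)
  qed
  \<comment> \<open>\<open>y_diamond\<close> at \<open>t\<close> is \<open>y_star\<close> at the
    earlier diamonds of \<open>t\<close>, so only layers before \<open>n\<close> enter. This is the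
    source of the triangular structure.\<close>
  have star_near: "norm (?s n x (restrict y {1..<n}) - ?D n t) \<le> B * T x t y {1..<n}"
    if n: "n \<in> {1..N}" and y: "\<And>i. i \<in> {1..N} \<Longrightarrow> y i \<in> V i" for n x t y
  proof -
    have "restrict y {1..<n} \<in> Pi\<^sub>E {1..<n} V"
      using y n by auto
    hence "norm (?s n x (restrict y {1..<n}) - ?s n t (restrict (\<lambda>i. ?D i t) {1..<n}))
        \<le> B * (norm (x - t) + (\<Sum>i\<in>{1..<n}. norm (restrict y {1..<n} i - restrict (\<lambda>i. ?D i t) {1..<n} i)))"
      using nest[OF n] D_PiE[OF n] unfolding nested_estimate_def by blast
    thus ?thesis
      unfolding T_def by (subst y_diamond_star) simp
  qed
  have gap: "norm (y n - ?s n x (restrict y {1..<n})) \<le> B * T x t y {1..N}"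
    if n: "n \<in> {1..N}" and y: "\<And>i. i \<in> {1..N} \<Longrightarrow> y i \<in> V i" for n x t y
  proof -
    have "norm (y n - ?s n x (restrict y {1..<n})) \<le> norm (y n - ?D n t) + B * T x t y {1..<n}"
      using star_near[OF n y, of x t] norm_triangle_ineq4[of "y n - ?D n t" "?s n x (restrict y {1..<n}) - ?D n t"]
      by simp
    also have "norm (y n - ?D n t) \<le> B * norm (y n - ?D n t)"
      using B mult_right_mono[of 1 B] by fastforce
    also have "B * norm (y n - ?D n t) + B * T x t y {1..<n} = B * T x t y (insert n {1..<n})"
      by (simp add: T_def algebra_simps)
    also have "\<dots> \<le> B * T x t y {1..N}"
      using n B unfolding T_def by (intro mult_left_mono add_left_mono sum_mono2) auto
    finally show ?thesis by simp
  qed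
  have h_eq: "restrict y {1..n} = (restrict y {1..<n})(n := y n)" if "n \<in> {1..N}" for n and y :: "nat \<Rightarrow> 'b"
    using that by (auto simp: restrict_def)
  have h_est: "norm (h n x ((restrict y {1..<n})(n := z)) - h n x ((restrict y {1..<n})(n := z'))) \<le> B * norm (z - z')"
    "(norm (z - z'))\<^sup>2 / B \<le> (h n x ((restrict y {1..<n})(n := z)) - h n x ((restrict y {1..<n})(n := z'))) \<bullet> (z - z')"
    "?s n x (restrict y {1..<n}) \<in> V n" "h n x ((restrict y {1..<n})(n := ?s n x (restrict y {1..<n}))) = 0"
    if "n \<in> {1..N}" "\<And>i. i \<in> {1..N} \<Longrightarrow> y i \<in> V i" "z \<in> V n" "z' \<in> V n" for n x y z z'
  proof -
    have "restrict y {1..<n} \<in> Pi\<^sub>E {1..<n} V"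
      using that by auto
    thus "norm (h n x ((restrict y {1..<n})(n := z)) - h n x ((restrict y {1..<n})(n := z'))) \<le> B * norm (z - z')"
      "(norm (z - z'))\<^sup>2 / B \<le> (h n x ((restrict y {1..<n})(n := z)) - h n x ((restrict y {1..<n})(n := z'))) \<bullet> (z - z')"
      "?s n x (restrict y {1..<n}) \<in> V n" "h n x ((restrict y {1..<n})(n := ?s n x (restrict y {1..<n}))) = 0"
      using nest[OF that(1)] that(3,4) unfolding nested_estimate_def by blast+
  qed
  \<comment> \<open>The operator vanishes at \<open>y_star\<close>, so its size is controlled by the
    distance of \<open>y n\<close> from \<open>y_star\<close>.\<close>
  have h_norm: "norm (h n x (restrict y {1..n})) \<le> B\<^sup>2 * T x t y {1..N}"
    if n: "n \<in> {1..N}" and y: "\<And>i. i \<in> {1..N} \<Longrightarrow> y i \<in> V i" for n x t y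
  proof -
    let ?r = "restrict y {1..<n}"
    have "norm (h n x (?r(n := y n)) - h n x (?r(n := ?s n x ?r))) \<le> B * norm (y n - ?s n x ?r)"
      by (rule h_est(1)[OF n y y[OF n] h_est(3)[OF n y y[OF n] y[OF n]]])
    moreover have "h n x (?r(n := ?s n x ?r)) = 0"
      by (rule h_est(4)[OF n y y[OF n] y[OF n]])
    ultimately have "norm (h n x (restrict y {1..n})) \<le> B * norm (y n - ?s n x ?r)"
      unfolding h_eq[OF n] by (simp only: diff_zero)
    also have "\<dots> \<le> B * (B * T x t y {1..N})"
      using gap[OF n y] B by (intro mult_left_mono) auto
    finally show ?thesis
      by (simp add: power2_eq_square algebra_simps)
  qed
  \<comment> \<open>Monotonicity is applied between \<open>y n\<close> and the diamond of
    \<open>t\<close>, although the latter is not a zero for the actual \<open>x\<close> and earlier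
    layers. The residual there is controlled by \<open>star_near\<close>, hence by \<open>T\<close>
    over \<open>{1..<n}\<close>; \<open>absorb_linear_term\<close> then removes its product with the
    tracking error.\<close>
  have h_coerc: "(norm (y n - ?D n t))\<^sup>2 / (2 * B) \<le> h n x (restrict y {1..n}) \<bullet> (y n - ?D n t)
      + B / 2 * (B\<^sup>2 * T x t y {1..<n})\<^sup>2"
    if n: "n \<in> {1..N}" and y: "\<And>i. i \<in> {1..N} \<Longrightarrow> y i \<in> V i" for n x t y
  proof (rule absorb_linear_term)
    let ?r = "restrict y {1..<n}" and ?u = "y n - ?D n t"
    note 0 = y[OF n] D_in[OF n, of t]
    have "norm (h n x (?r(n := ?D n t)) - h n x (?r(n := ?s n x ?r))) \<le> B * norm (?D n t - ?s n x ?r)"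
      by (rule h_est(1)[OF n y 0(2) h_est(3)[OF n y 0]])
    moreover have "h n x (?r(n := ?s n x ?r)) = 0"
      by (rule h_est(4)[OF n y 0])
    ultimately have "norm (h n x (?r(n := ?D n t))) \<le> B * norm (?D n t - ?s n x ?r)"
      by (simp only: diff_zero)
    also have "\<dots> \<le> B * (B * T x t y {1..<n})"
      using star_near[OF n y, of x t] B by (intro mult_left_mono) (auto simp: norm_minus_commute)
    finally have "norm (h n x (?r(n := ?D n t))) \<le> B\<^sup>2 * T x t y {1..<n}"
      by (simp add: power2_eq_square algebra_simps)
    hence "norm (h n x (?r(n := ?D n t))) * norm ?u \<le> B\<^sup>2 * T x t y {1..<n} * norm ?u"
      by (rule mult_right_mono) simp
    hence "- (h n x (?r(n := ?D n t)) \<bullet> ?u) \<le> B\<^sup>2 * T x t y {1..<n} * norm ?u"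
      using Cauchy_Schwarz_ineq2[of "h n x (?r(n := ?D n t))" ?u] by linarith
    moreover have "(norm ?u)\<^sup>2 / B \<le> h n x (restrict y {1..n}) \<bullet> ?u - h n x (?r(n := ?D n t)) \<bullet> ?u"
      using h_est(2)[OF n y 0, of x] h_eq[OF n, of y] by (simp add: inner_diff_left)
    ultimately show "(norm ?u)\<^sup>2 / B \<le> h n x (restrict y {1..n}) \<bullet> ?u + B\<^sup>2 * T x t y {1..<n} * norm ?u"
      by linarith
  qed (use B in auto)
  have D_diff: "(\<Sum>n=1..N. norm (?D n x - ?D n x')) \<le> N * B * norm (x - x')" for x x'
    using sum_bounded_above[of "{1..N}" "\<lambda>n. norm (?D n x - ?D n x')" "B * norm (x - x')"] D_lip
    by (simp add: mult.assoc)
  have near_diamond: "(\<Sum>n=1..N. norm (y n - ?D n x)) \<le> (1 + N * B) * T x t y {1..N}" for x t y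
  proof -
    have "(\<Sum>n=1..N. norm (y n - ?D n x)) \<le> (\<Sum>n=1..N. norm (y n - ?D n t) + norm (?D n t - ?D n x))"
      by (intro sum_mono) (metis norm_triangle_ineq diff_add_cancel add_diff_eq)
    also have "\<dots> \<le> (\<Sum>n=1..N. norm (y n - ?D n t)) + N * B * norm (x - t)"
      using D_diff[of t x] by (simp add: sum.distrib norm_minus_commute)
    also have "\<dots> \<le> (1 + N * B) * T x t y {1..N}"
      unfolding T_def using B by (simp add: algebra_simps sum_nonneg)
    finally show ?thesis .
  qed
  let ?G = "1 + N * B"
  have G: "?G \<ge> 1"
    using B by simp
  have y_PiE: "restrict y {1..N} \<in> Pi\<^sub>E {1..N} V" if "\<And>i. i \<in> {1..N} \<Longrightarrow> y i \<in> V i" for y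
    using that by auto
  have v_near: "norm (v x (restrict y {1..N}) - v x (y_diamonds V h N x)) \<le> B * ?G * T x t y {1..N}"
    if y: "\<And>i. i \<in> {1..N} \<Longrightarrow> y i \<in> V i" for x t y
  proof -
    have "norm (v x (restrict y {1..N}) - v x (y_diamonds V h N x)) \<le> B * (\<Sum>n=1..N. norm (y n - ?D n x))"
      using v_lip[OF y_PiE[OF y], of x x] by (simp add: norm_minus_commute)
    also have "\<dots> \<le> B * (?G * T x t y {1..N})"
      using near_diamond B by (intro mult_left_mono) auto
    finally show ?thesis by (simp add: mult.assoc)
  qed
  \<comment> \<open>The first argument of \<open>v_lip\<close> must sit on the diamond branch.
    Taking it at \<open>xs\<close>, where \<open>v\<close> vanishes, and the diamonds of
    \<open>x\<close> as the other tuple bounds \<open>v\<close> on the branch; \<open>v_near\<close>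
    then leaves the branch.\<close>
  have v_norm: "norm (v x (restrict y {1..N})) \<le> B * ?G * (norm (x - xs) + T x t y {1..N})"
    if y: "\<And>i. i \<in> {1..N} \<Longrightarrow> y i \<in> V i" for x t y
  proof -
    have "norm (v x (y_diamonds V h N x)) \<le> B * (norm (xs - x) + (\<Sum>n=1..N. norm (?D n x - ?D n xs)))"
      using v_lip[OF dD, of xs x x] v0 by (simp add: y_diamonds_def)
    also have "\<dots> \<le> B * (norm (x - xs) + N * B * norm (x - xs))"
      using D_diff[of x xs] B by (intro mult_left_mono add_mono) (auto simp: norm_minus_commute)
    finally have "norm (v x (y_diamonds V h N x)) \<le> B * ?G * norm (x - xs)"
      by (simp add: algebra_simps)
    thus ?thesis
      using v_near[OF y, of x t]
        norm_triangle_ineq[of "v x (y_diamonds V h N x)" "v x (restrict y {1..N}) - v x (y_diamonds V h N x)"]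
      by (simp add: distrib_left)
  qed
  have v_coerc: "(norm (x - xs))\<^sup>2 / (2 * B) \<le> v x (restrict y {1..N}) \<bullet> (x - xs)
      + B / 2 * (B * ?G * T x t y {1..N})\<^sup>2"
    if y: "\<And>i. i \<in> {1..N} \<Longrightarrow> y i \<in> V i" for x t y
  proof (rule absorb_linear_term)
    let ?e = "v x (restrict y {1..N}) - v x (y_diamonds V h N x)"
    have "- (?e \<bullet> (x - xs)) \<le> norm ?e * norm (x - xs)"
      using Cauchy_Schwarz_ineq2[of ?e "x - xs"] by linarith
    also have "\<dots> \<le> B * ?G * T x t y {1..N} * norm (x - xs)"
      using v_near[OF y] by (intro mult_right_mono) auto
    finally show "(norm (x - xs))\<^sup>2 / B \<le> v x (restrict y {1..N}) \<bullet> (x - xs) + B * ?G * T x t y {1..N} * norm (x - xs)"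
      using v_mono[of x] by (simp add: inner_diff_left)
  qed (use B in auto)
  have square: "(c * T x t y I)\<^sup>2 \<le> c\<^sup>2 * (2 * (real N + 1)) * Q x t y I" if "I \<subseteq> {1..N}" for c x t y I
    using mult_left_mono[OF TQ[OF that, of x t y], of "c\<^sup>2"] by (simp add: power_mult_distrib mult.assoc)
  define C1 where "C1 = (B\<^sup>2)\<^sup>2 * (2 * (real N + 1))"
  define C2 where "C2 = (B * ?G)\<^sup>2 * (2 * (real N + 1))"
  define C where "C = B + 2 * B + 2 * C1 + B / 2 * C1 + 2 * C2 + 2 * (B * ?G)\<^sup>2 + B / 2 * C2"
  have C12: "C1 \<ge> 0" "C2 \<ge> 0"
    by (simp_all add: C1_def C2_def)
  have CC: "1 \<le> C" "B \<le> C" "2 * B \<le> C" "C1 \<le> C" "B / 2 * C1 \<le> C" "2 * C2 \<le> C" "2 * (B * ?G)\<^sup>2 \<le> C"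
    "B / 2 * C2 \<le> C"
    using B C12 by (auto simp: C_def add_increasing add_increasing2)
  have divC: "a / C \<le> a / (2 * B)" if "a \<ge> 0" for a
    using that CC B by (intro divide_left_mono) auto
  have "tracking_estimates N V v h xs C"
  proof
    fix n x t and y :: "nat \<Rightarrow> 'b"
    assume n: "n \<in> {1..N}" and y: "\<And>i. i \<in> {1..N} \<Longrightarrow> y i \<in> V i"
    have "(norm (y n - ?s n x (restrict y {1..<n})))\<^sup>2 \<le> (B\<^sup>2 * T x t y {1..N})\<^sup>2"
    proof (rule power_mono)
      have "B * T x t y {1..N} \<le> B\<^sup>2 * T x t y {1..N}"
        using B T_nonneg by (intro mult_right_mono) (auto simp: power2_eq_square)
      thus "norm (y n - ?s n x (restrict y {1..<n})) \<le> B\<^sup>2 * T x t y {1..N}"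
        using gap[OF n y, of x t] by linarith
    qed simp
    also have "\<dots> \<le> C1 * Q x t y {1..N}"
      unfolding C1_def by (rule square) simp
    also have "\<dots> \<le> C * Q x t y {1..N}"
      using CC Q_nonneg by (intro mult_right_mono)
    finally show "(norm (y n - ?s n x (restrict y {1..<n})))\<^sup>2 \<le>
        C * ((norm (x - t))\<^sup>2 + (\<Sum>i=1..N. (norm (y i - ?D i t))\<^sup>2))"
      by (simp add: Q_def)
    have "(norm (h n x (restrict y {1..n})))\<^sup>2 \<le> (B\<^sup>2 * T x t y {1..N})\<^sup>2"
      using h_norm[OF n y] by (intro power_mono) auto
    also have "\<dots> \<le> C1 * Q x t y {1..N}"
      unfolding C1_def by (rule square) simp
    also have "\<dots> \<le> C * Q x t y {1..N}"
      using CC Q_nonneg by (intro mult_right_mono)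
    finally show "(norm (h n x (restrict y {1..n})))\<^sup>2 \<le>
        C * ((norm (x - t))\<^sup>2 + (\<Sum>i=1..N. (norm (y i - ?D i t))\<^sup>2))"
      by (simp add: Q_def)
    have "B / 2 * (B\<^sup>2 * T x t y {1..<n})\<^sup>2 \<le> B / 2 * (C1 * Q x t y {1..<n})"
      unfolding C1_def using B n by (intro mult_left_mono square) auto
    also have "\<dots> \<le> C * Q x t y {1..<n}"
      using mult_right_mono[OF CC(5) Q_nonneg] by (simp add: mult.assoc)
    finally show "(norm (y n - ?D n t))\<^sup>2 / C \<le> h n x (restrict y {1..n}) \<bullet> (y n - ?D n t)
        + C * ((norm (x - t))\<^sup>2 + (\<Sum>i\<in>{1..<n}. (norm (y i - ?D i t))\<^sup>2))"
      using h_coerc[OF n y, of t x] divC[of "(norm (y n - ?D n t))\<^sup>2"] by (simp add: Q_def)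
  next
    fix x t and y :: "nat \<Rightarrow> 'b"
    assume y: "\<And>i. i \<in> {1..N} \<Longrightarrow> y i \<in> V i"
    let ?w = "norm (x - xs)" and ?T = "T x t y {1..N}" and ?Q = "Q x t y {1..N}"
    have "(norm (v x (restrict y {1..N})))\<^sup>2 \<le> (B * ?G * (?w + ?T))\<^sup>2"
      using v_norm[OF y] by (intro power_mono) auto
    also have "\<dots> = (B * ?G * ?w + B * ?G * ?T)\<^sup>2"
      by (simp add: distrib_left)
    also have "\<dots> \<le> 2 * (B * ?G * ?w)\<^sup>2 + 2 * (B * ?G * ?T)\<^sup>2"
      using sum_squares_bound[of "B * ?G * ?w" "B * ?G * ?T"] by (simp add: power2_sum)
    also have "(B * ?G * ?T)\<^sup>2 \<le> C2 * ?Q"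
      unfolding C2_def by (rule square) simp
    also have "2 * (B * ?G * ?w)\<^sup>2 + 2 * (C2 * ?Q) = 2 * (B * ?G)\<^sup>2 * ?w\<^sup>2 + 2 * C2 * ?Q"
      by (simp add: power_mult_distrib)
    also have "\<dots> \<le> C * ?w\<^sup>2 + C * ?Q"
      using CC Q_nonneg by (intro add_mono mult_right_mono) auto
    finally show "(norm (v x (restrict y {1..N})))\<^sup>2 \<le>
        C * (?w\<^sup>2 + (norm (x - t))\<^sup>2 + (\<Sum>i=1..N. (norm (y i - ?D i t))\<^sup>2))"
      by (simp add: Q_def distrib_left add.assoc)
    have "B / 2 * (B * ?G * ?T)\<^sup>2 \<le> B / 2 * (C2 * ?Q)"
      unfolding C2_def using B by (intro mult_left_mono square) auto
    also have "\<dots> \<le> C * ?Q"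
      using mult_right_mono[OF CC(8) Q_nonneg] by (simp add: mult.assoc)
    finally show "?w\<^sup>2 / C \<le> v x (restrict y {1..N}) \<bullet> (x - xs)
        + C * ((norm (x - t))\<^sup>2 + (\<Sum>i=1..N. (norm (y i - ?D i t))\<^sup>2))"
      using v_coerc[OF y, of x t] divC[of "?w\<^sup>2"] by (simp add: Q_def)
  next
    fix n x x' and y y' :: "nat \<Rightarrow> 'b"
    assume n: "n \<in> {1..N}" and y: "y \<in> Pi\<^sub>E {1..<n} V" "y' \<in> Pi\<^sub>E {1..<n} V"
    have "nested_estimate V h n C"
      using nested_estimate_mono[OF nest[OF n]] B CC by simp
    thus "norm (?s n x y - ?s n x' y') \<le> C * (norm (x - x') + (\<Sum>i\<in>{1..<n}. norm (y i - y' i)))"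
      using y unfolding nested_estimate_def by blast
  next
    show "norm (?D n x - ?D n x') \<le> C * norm (x - x')" if "n \<in> {1..N}" for n x x'
      using D_lip[OF that, of x x'] CC(2) by (meson mult_right_mono norm_ge_zero order_trans)
  qed (use CC in auto)
  thus ?thesis
    by (rule that)
qed

section \<open>Square-integrable random vectors\<close>

definition square_integrable :: "'w measure \<Rightarrow> ('w \<Rightarrow> 'c::euclidean_space) \<Rightarrow> bool"
  where "square_integrable M f \<longleftrightarrow> f \<in> borel_measurable M \<and> integrable M (\<lambda>\<omega>. (norm (f \<omega>))\<^sup>2)"

lemma square_integrableD:
  assumes "square_integrable M f"
  shows "f \<in> borel_measurable M" "integrable M (\<lambda>\<omega>. (norm (f \<omega>))\<^sup>2)"
  using assms by (auto simp: square_integrable_def)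

lemma square_integrable_bound:
  assumes "f \<in> borel_measurable M" "integrable M g"
    and "\<And>\<omega>. \<omega> \<in> space M \<Longrightarrow> (norm (f \<omega>))\<^sup>2 \<le> g \<omega>"
  shows "square_integrable M f"
proof -
  have "integrable M (\<lambda>\<omega>. (norm (f \<omega>))\<^sup>2)"
    using assms(2) by (rule Bochner_Integration.integrable_bound)
      (use assms in \<open>auto intro!: AE_I2 order_trans[OF _ abs_ge_self]\<close>)
  thus ?thesis
    using assms(1) by (simp add: square_integrable_def)
qed

lemma norm_add_square_le: "(norm (a + b))\<^sup>2 \<le> 2 * (norm a)\<^sup>2 + 2 * (norm b)\<^sup>2"
  for a b :: "'c::real_normed_vector"
proof -
  have "(norm (a + b))\<^sup>2 \<le> (norm a + norm b)\<^sup>2"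
    by (intro power_mono norm_triangle_ineq) auto
  also have "\<dots> \<le> 2 * (norm a)\<^sup>2 + 2 * (norm b)\<^sup>2"
    using sum_squares_bound[of "norm a" "norm b"] by (simp add: power2_sum)
  finally show ?thesis .
qed

lemma square_integrable_add:
  assumes "square_integrable M f" "square_integrable M g"
  shows "square_integrable M (\<lambda>\<omega>. f \<omega> + g \<omega>)"
proof (rule square_integrable_bound)
  show "integrable M (\<lambda>\<omega>. 2 * (norm (f \<omega>))\<^sup>2 + 2 * (norm (g \<omega>))\<^sup>2)"
    using assms by (auto simp: square_integrable_def)
qed (use assms in \<open>auto simp: square_integrable_def norm_add_square_le intro!: borel_measurable_add\<close>)

lemma square_integrable_scaleR:
  assumes "square_integrable M f"
  shows "square_integrable M (\<lambda>\<omega>. c *\<^sub>R f \<omega>)"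
  using assms by (auto simp: square_integrable_def power_mult_distrib)

lemma square_integrable_diff:
  assumes "square_integrable M f" "square_integrable M g"
  shows "square_integrable M (\<lambda>\<omega>. f \<omega> - g \<omega>)"
  using square_integrable_add[OF assms(1) square_integrable_scaleR[OF assms(2), of "-1"]] by simp

lemma square_integrable_const:
  assumes "finite_measure M"
  shows "square_integrable M (\<lambda>\<omega>. c)"
  using assms by (simp add: square_integrable_def finite_measure.integrable_const)

lemma square_integrable_cong:
  assumes "\<And>\<omega>. \<omega> \<in> space M \<Longrightarrow> f \<omega> = g \<omega>"
  shows "square_integrable M f \<longleftrightarrow> square_integrable M g"
  unfolding square_integrable_def
  by (intro conj_cong measurable_cong Bochner_Integration.integrable_cong) (auto simp: assms)

lemma integrable_inner_product:
  assumes "square_integrable M f" "square_integrable M g"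
  shows "integrable M (\<lambda>\<omega>. f \<omega> \<bullet> g \<omega>)"
proof (rule Bochner_Integration.integrable_bound)
  show "integrable M (\<lambda>\<omega>. (norm (f \<omega>))\<^sup>2 + (norm (g \<omega>))\<^sup>2)"
    using assms by (auto simp: square_integrable_def)
  have "\<bar>a \<bullet> b\<bar> \<le> (norm a)\<^sup>2 + (norm b)\<^sup>2" for a b :: 'b
  proof -
    have "\<bar>a \<bullet> b\<bar> \<le> norm a * norm b"
      by (rule Cauchy_Schwarz_ineq2)
    also have "\<dots> \<le> (norm a)\<^sup>2 + (norm b)\<^sup>2"
      using sum_squares_bound[of "norm a" "norm b"] mult_nonneg_nonneg[OF norm_ge_zero[of a] norm_ge_zero[of b]]
      by linarith
    finally show ?thesis .
  qed
  thus "AE \<omega> in M. norm (f \<omega> \<bullet> g \<omega>) \<le> norm ((norm (f \<omega>))\<^sup>2 + (norm (g \<omega>))\<^sup>2)"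
    by auto
  show "(\<lambda>\<omega>. f \<omega> \<bullet> g \<omega>) \<in> borel_measurable M"
    using assms by (auto simp: square_integrable_def intro!: borel_measurable_inner)
qed

section \<open>Conditional expectation and conditional variance of random vectors\<close>

lemma vec_cond_exp_inner_Basis:
  "i \<in> Basis \<Longrightarrow> vec_cond_exp M F f \<omega> \<bullet> i = real_cond_exp M F (\<lambda>\<omega>. f \<omega> \<bullet> i) \<omega>"
  unfolding vec_cond_exp_def by (rule inner_sum_left_Basis)

context sigma_finite_subalgebra
begin

lemma borel_measurable_vec_cond_exp: "vec_cond_exp M F f \<in> borel_measurable M"
  unfolding vec_cond_exp_def[abs_def] by measurable

text \<open>The measurable factor is pulled out of the scalar conditional expectations, coordinate
  by coordinate, since \<open>vec_cond_exp\<close> is defined that way.\<close>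

lemma orthogonal_if_vec_cond_exp_zero:
  fixes f g :: "'a \<Rightarrow> 'c::euclidean_space"
  assumes f: "f \<in> borel_measurable F" "square_integrable M f" and g: "square_integrable M g"
    and zero: "AE \<omega> in M. vec_cond_exp M F g \<omega> = 0"
  shows "(\<integral>\<omega>. f \<omega> \<bullet> g \<omega> \<partial>M) = 0"
proof -
  have coord: "integrable M (\<lambda>\<omega>. (f \<omega> \<bullet> i) * (g \<omega> \<bullet> i))" for i
  proof -
    \<comment> \<open>The coordinate is turned back into a vector so that integrability of the
      product becomes an instance of \<open>integrable_inner_product\<close>.\<close>
    have "square_integrable M (\<lambda>\<omega>. (f \<omega> \<bullet> i) *\<^sub>R i)"
    proof (rule square_integrable_bound)
      show "integrable M (\<lambda>\<omega>. (norm i)^4 * (norm (f \<omega>))\<^sup>2)"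
        using f by (auto simp: square_integrable_def)
      fix \<omega>
      have "(norm ((f \<omega> \<bullet> i) *\<^sub>R i))\<^sup>2 \<le> (norm (f \<omega>) * norm i * norm i)\<^sup>2"
        using Cauchy_Schwarz_ineq2[of "f \<omega>" i] by (intro power_mono) (auto intro: mult_right_mono)
      thus "(norm ((f \<omega> \<bullet> i) *\<^sub>R i))\<^sup>2 \<le> (norm i)^4 * (norm (f \<omega>))\<^sup>2"
        by (simp add: power_mult_distrib power2_eq_square power4_eq_xxxx ac_simps)
    qed (use f in \<open>auto simp: square_integrable_def intro!: borel_measurable_scaleR borel_measurable_inner\<close>)
    from integrable_inner_product[OF this g] show ?thesis
      by (simp add: inner_commute)
  qed
  have "(\<integral>\<omega>. f \<omega> \<bullet> g \<omega> \<partial>M) = (\<Sum>i\<in>Basis. \<integral>\<omega>. (f \<omega> \<bullet> i) * (g \<omega> \<bullet> i) \<partial>M)"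
    using coord by (subst euclidean_inner) (simp add: Bochner_Integration.integral_sum)
  also have "\<dots> = (\<Sum>i\<in>Basis. \<integral>\<omega>. (f \<omega> \<bullet> i) * real_cond_exp M F (\<lambda>\<omega>. g \<omega> \<bullet> i) \<omega> \<partial>M)"
    using f(1) g coord by (intro sum.cong refl real_cond_exp_intg(2)[symmetric]) (auto simp: square_integrable_def)
  also have "\<dots> = (\<Sum>i\<in>(Basis :: 'c set). \<integral>\<omega>. 0 \<partial>M)"
  proof (rule sum.cong[OF refl])
    fix i :: 'c assume i: "i \<in> Basis"
    have [measurable]: "f \<in> borel_measurable M"
      using f(2) by (rule square_integrableD)
    show "(\<integral>\<omega>. (f \<omega> \<bullet> i) * real_cond_exp M F (\<lambda>\<omega>. g \<omega> \<bullet> i) \<omega> \<partial>M) = (\<integral>\<omega>. 0 \<partial>M)"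
    proof (rule integral_cong_AE)
      show "AE \<omega> in M. (f \<omega> \<bullet> i) * real_cond_exp M F (\<lambda>\<omega>. g \<omega> \<bullet> i) \<omega> = 0"
        using zero by eventually_elim (simp add: vec_cond_exp_inner_Basis[OF i, symmetric])
    qed measurable
  qed
  finally show ?thesis by simp
qed

text \<open>Integrating the conditional variance gives the second moment, as the conditional mean is
  zero. The computation runs in nonnegative extended integrals because square integrability of
  \<open>g\<close> is itself part of the conclusion.\<close>

lemma second_moment_le_cond_variance_bound:
  assumes g: "g \<in> borel_measurable M" and zero: "AE \<omega> in M. vec_cond_exp M F g \<omega> = 0"
    and var: "AE \<omega> in M. cond_variance M F g \<omega> \<le> ennreal (b \<omega>)"
    and b: "integrable M b" "\<And>\<omega>. b \<omega> \<ge> 0"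
  shows "square_integrable M g" "(\<integral>\<omega>. (norm (g \<omega>))\<^sup>2 \<partial>M) \<le> (\<integral>\<omega>. b \<omega> \<partial>M)"
proof -
  note [measurable] = g borel_measurable_vec_cond_exp[of g]
  have "(\<integral>\<^sup>+\<omega>. ennreal ((norm (g \<omega>))\<^sup>2) \<partial>M)
      = (\<integral>\<^sup>+\<omega>. 1 * ennreal ((norm (g \<omega> - vec_cond_exp M F g \<omega>))\<^sup>2) \<partial>M)"
  proof (intro nn_integral_cong_AE)
    show "AE \<omega> in M. ennreal ((norm (g \<omega>))\<^sup>2) = 1 * ennreal ((norm (g \<omega> - vec_cond_exp M F g \<omega>))\<^sup>2)"
      using zero by eventually_elim simp
  qed
  also have "\<dots> = (\<integral>\<^sup>+\<omega>. 1 * cond_variance M F g \<omega> \<partial>M)"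
    unfolding cond_variance_def by (rule nn_cond_exp_intg[symmetric]) measurable
  also have "\<dots> \<le> (\<integral>\<^sup>+\<omega>. ennreal (b \<omega>) \<partial>M)"
    using var by (intro nn_integral_mono_AE) simp
  also have "\<dots> = ennreal (\<integral>\<omega>. b \<omega> \<partial>M)"
    using b by (intro nn_integral_eq_integral) auto
  finally have le: "(\<integral>\<^sup>+\<omega>. ennreal ((norm (g \<omega>))\<^sup>2) \<partial>M) \<le> ennreal (\<integral>\<omega>. b \<omega> \<partial>M)" .
  have "integrable M (\<lambda>\<omega>. (norm (g \<omega>))\<^sup>2)"
    using le by (intro integrableI_bounded) (auto simp: le_less_trans[OF _ ennreal_less_top])
  thus si: "square_integrable M g"
    using g by (simp add: square_integrable_def)
  have "ennreal (\<integral>\<omega>. (norm (g \<omega>))\<^sup>2 \<partial>M) \<le> ennreal (\<integral>\<omega>. b \<omega> \<partial>M)"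
    using le nn_integral_eq_integral[OF square_integrableD(2)[OF si]] by simp
  thus "(\<integral>\<omega>. (norm (g \<omega>))\<^sup>2 \<partial>M) \<le> (\<integral>\<omega>. b \<omega> \<partial>M)"
    using b(2) by (simp add: ennreal_le_iff)
qed

end

text \<open>The product of \<open>f\<close> and \<open>z\<close> is estimated by their squares, so that \<open>f\<close> need not be
  uncorrelated with the noise \<open>z\<close>.\<close>

lemma mean_square_step:
  fixes g f z :: "'w \<Rightarrow> 'c::euclidean_space"
  assumes g: "square_integrable M g" and f: "square_integrable M f" and z: "square_integrable M z"
    and orth: "(\<integral>\<omega>. g \<omega> \<bullet> z \<omega> \<partial>M) = 0" and b: "integrable M b"
    and le: "\<And>\<omega>. \<omega> \<in> space M \<Longrightarrow> (norm (g \<omega>))\<^sup>2 - 2 * t * (f \<omega> \<bullet> g \<omega>) \<le> b \<omega>"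
  shows "(\<integral>\<omega>. (norm (g \<omega> - t *\<^sub>R (f \<omega> + z \<omega>)))\<^sup>2 \<partial>M) \<le>
    (\<integral>\<omega>. b \<omega> \<partial>M) + 2 * t\<^sup>2 * ((\<integral>\<omega>. (norm (f \<omega>))\<^sup>2 \<partial>M) + (\<integral>\<omega>. (norm (z \<omega>))\<^sup>2 \<partial>M))"
proof -
  note i = g[THEN square_integrableD(2)] f[THEN square_integrableD(2)] z[THEN square_integrableD(2)]
    integrable_inner_product[OF g z] integrable_inner_product[OF f g] b
  have "(\<integral>\<omega>. (norm (g \<omega> - t *\<^sub>R (f \<omega> + z \<omega>)))\<^sup>2 \<partial>M) \<le>
     (\<integral>\<omega>. b \<omega> - 2 * t * (g \<omega> \<bullet> z \<omega>) + 2 * t\<^sup>2 * ((norm (f \<omega>))\<^sup>2 + (norm (z \<omega>))\<^sup>2) \<partial>M)"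
  proof (rule integral_mono)
    show "integrable M (\<lambda>\<omega>. (norm (g \<omega> - t *\<^sub>R (f \<omega> + z \<omega>)))\<^sup>2)"
      by (intro square_integrableD(2) square_integrable_diff square_integrable_scaleR square_integrable_add g f z)
    fix \<omega> assume \<omega>: "\<omega> \<in> space M"
    have "(norm (g \<omega> - t *\<^sub>R (f \<omega> + z \<omega>)))\<^sup>2
        = (norm (g \<omega>))\<^sup>2 - 2 * t * (f \<omega> \<bullet> g \<omega>) - 2 * t * (g \<omega> \<bullet> z \<omega>) + t\<^sup>2 * (norm (f \<omega> + z \<omega>))\<^sup>2"
      unfolding power2_norm_eq_inner by (simp add: inner_simps inner_commute algebra_simps power2_eq_square)
    also have "\<dots> \<le> b \<omega> - 2 * t * (g \<omega> \<bullet> z \<omega>) + t\<^sup>2 * (2 * (norm (f \<omega>))\<^sup>2 + 2 * (norm (z \<omega>))\<^sup>2)"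
      using le[OF \<omega>] mult_left_mono[OF norm_add_square_le[of "f \<omega>" "z \<omega>"] zero_le_power2[of t]]
      by linarith
    finally show "(norm (g \<omega> - t *\<^sub>R (f \<omega> + z \<omega>)))\<^sup>2 \<le>
        b \<omega> - 2 * t * (g \<omega> \<bullet> z \<omega>) + 2 * t\<^sup>2 * ((norm (f \<omega>))\<^sup>2 + (norm (z \<omega>))\<^sup>2)"
      by (simp add: algebra_simps)
  qed (use i in auto)
  also have "\<dots> = (\<integral>\<omega>. b \<omega> \<partial>M) + 2 * t\<^sup>2 * ((\<integral>\<omega>. (norm (f \<omega>))\<^sup>2 \<partial>M) + (\<integral>\<omega>. (norm (z \<omega>))\<^sup>2 \<partial>M))"
    using i orth by simp
  finally show ?thesis .
qed

section \<open>The Lyapunov function\<close>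

text \<open>For \<open>i < n\<close> the weight \<open>e ^ n\<close> is at most
  \<open>e * e ^ i\<close>, so each row is bounded by \<open>e\<close> times the full weighted sum,
  and there are \<open>N\<close> rows.\<close>

lemma weighted_triangular_sum_le:
  fixes U :: "nat \<Rightarrow> real"
  assumes "0 \<le> e" "e \<le> 1" "\<And>n. U n \<ge> 0"
  shows "(\<Sum>n=1..N. e ^ n * (\<Sum>i\<in>{1..<n}. U i)) \<le> N * e * (\<Sum>n=1..N. e ^ n * U n)"
proof -
  have "(\<Sum>n=1..N. e ^ n * (\<Sum>i\<in>{1..<n}. U i)) \<le> (\<Sum>n=1..N. e * (\<Sum>i=1..N. e ^ i * U i))"
  proof (rule sum_mono)
    fix n assume n: "n \<in> {1..N}"
    have "e ^ n * (\<Sum>i\<in>{1..<n}. U i) = (\<Sum>i\<in>{1..<n}. e ^ n * U i)"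
      by (rule sum_distrib_left)
    also have "\<dots> \<le> (\<Sum>i\<in>{1..<n}. e ^ Suc i * U i)"
      using assms by (intro sum_mono mult_right_mono power_decreasing) auto
    also have "\<dots> \<le> (\<Sum>i=1..N. e ^ Suc i * U i)"
      using n assms by (intro sum_mono2) auto
    finally show "e ^ n * (\<Sum>i\<in>{1..<n}. U i) \<le> e * (\<Sum>i=1..N. e ^ i * U i)"
      by (simp add: sum_distrib_left mult.assoc)
  qed
  thus ?thesis by simp
qed

text \<open>The hypotheses are the drift inequalities, with \<open>E\<close> of second order in the step sizes, for the
  mean squares \<open>W\<close> of the slow error, \<open>P\<close> of the delay, and \<open>U n\<close> of the tracking errors, which are
  coupled triangularly.\<close>

definition contracting_weights :: "nat \<Rightarrow> real \<Rightarrow> real \<Rightarrow> real \<Rightarrow> real \<Rightarrow> real \<Rightarrow> bool"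
  where "contracting_weights N A C e l r \<longleftrightarrow> 0 < e \<and> e \<le> 1 \<and> 1 \<le> l \<and> 0 < r \<and> r \<le> 1 \<and>
    (\<forall>W P U W' P' U' \<alpha> \<gamma> E.
      0 \<le> W \<longrightarrow> 0 \<le> P \<longrightarrow> (\<forall>n. 0 \<le> U n) \<longrightarrow> 0 \<le> \<alpha> \<longrightarrow> 0 < \<gamma> \<longrightarrow> \<alpha> \<le> r * \<gamma> \<longrightarrow> 0 \<le> E \<longrightarrow>
      W' \<le> (1 - 2 * \<alpha> / C) * W + 2 * \<alpha> * C * (P + (\<Sum>n=1..N. U n)) + E \<longrightarrow>
      P' \<le> (1 - \<gamma>) * P + \<alpha>\<^sup>2 / \<gamma> * C * (W + P + (\<Sum>n=1..N. U n)) + E \<longrightarrow>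
      (\<forall>n\<in>{1..N}. U' n \<le> (1 - \<gamma> / C) * U n + \<gamma> * A * (P + (\<Sum>i\<in>{1..<n}. U i)) + E) \<longrightarrow>
      W' + l * P' + (\<Sum>n=1..N. e ^ n * U' n)
        \<le> (1 - \<alpha> / (4 * C)) * (W + l * P + (\<Sum>n=1..N. e ^ n * U n)) + (1 + l + real N) * E)"

lemma contracting_weights_exist:
  fixes A C :: real and N :: nat
  assumes "A \<ge> 1" "C \<ge> 1"
  obtains e l r where "contracting_weights N A C e l r"
proof -
  \<comment> \<open>\<open>e\<close> makes the triangular coupling \<open>A * (N * e)\<close> at
    most \<open>1 / (4 * C)\<close>. \<open>l\<close> exceeds \<open>2 * A * N\<close>, so half of
    the decay of the delay pays for its effect on all tracking errors. \<open>q\<close> is the price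
    of passing from the unweighted sum of the \<open>U n\<close> to the weighted one.
    \<open>r\<close> is fixed last, so that all terms that the slow step contributes to the fast
    components cost exactly \<open>1 / (4 * C)\<close>; see \<open>rC\<close>.\<close>
  define e where "e = 1 / (4 * A * C * (real N + 1))"
  define l where "l = 2 * A * N + 1"
  define q where "q = 1 / e ^ N"
  define r where "r = 1 / (4 * C * C * q * (2 + l))"
  have AC: "A * C \<ge> 1"
    using assms by (simp add: mult_ge1_I)
  have d1: "4 * A * C * (real N + 1) \<ge> 1"
    using mult_ge1_I[OF AC, of "4 * (real N + 1)"] by (simp add: mult_ac)
  have e: "0 < e" "e \<le> 1"
    using d1 by (auto simp: e_def)
  have l: "1 \<le> l"
    using assms by (simp add: l_def)
  have q: "1 \<le> q"
    using e by (simp add: q_def power_le_one)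
  have CCq: "C * C * q * (2 + l) \<ge> 1"
    using assms q l by (intro mult_ge1_I) auto
  have r: "0 < r" "r \<le> 1"
    using CCq by (auto simp: r_def mult.assoc)
  have "contracting_weights N A C e l r"
    unfolding contracting_weights_def
  proof (intro conjI allI impI e l r)
    fix W P :: real and U :: "nat \<Rightarrow> real" and W' P' U' \<alpha> \<gamma> E
    assume nn: "0 \<le> W" "0 \<le> P" "\<forall>n. 0 \<le> U n" "0 \<le> \<alpha>" "0 < \<gamma>" "0 \<le> E" and \<alpha>\<gamma>: "\<alpha> \<le> r * \<gamma>"
      and W': "W' \<le> (1 - 2 * \<alpha> / C) * W + 2 * \<alpha> * C * (P + (\<Sum>n=1..N. U n)) + E"
      and P': "P' \<le> (1 - \<gamma>) * P + \<alpha>\<^sup>2 / \<gamma> * C * (W + P + (\<Sum>n=1..N. U n)) + E"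
      and U': "\<forall>n\<in>{1..N}. U' n \<le> (1 - \<gamma> / C) * U n + \<gamma> * A * (P + (\<Sum>i\<in>{1..<n}. U i)) + E"
    define S where "S = (\<Sum>n=1..N. e ^ n * U n)"
    define Z where "Z = l * P + S"
    have S: "S \<ge> 0"
      using e nn by (auto simp: S_def intro!: sum_nonneg)
    have Z: "Z \<ge> 0"
      using S l nn by (simp add: Z_def)
    have sumU: "(\<Sum>n=1..N. U n) \<le> q * S"
      unfolding S_def sum_distrib_left
    proof (rule sum_mono)
      fix n assume "n \<in> {1..N}"
      hence "e ^ N \<le> e ^ n"
        using e by (intro power_decreasing) auto
      hence "1 \<le> q * e ^ n"
        using e by (simp add: q_def)
      thus "U n \<le> q * (e ^ n * U n)"
        using mult_right_mono[of 1 "q * e ^ n" "U n"] nn by (simp add: mult.assoc)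
    qed
    have "P \<le> q * (l * P)"
      using q l nn mult_right_mono[of 1 "q * l" P] by (simp add: mult_ge1_I mult.assoc)
    hence PU: "P + (\<Sum>n=1..N. U n) \<le> q * Z"
      using sumU by (simp add: Z_def distrib_left)
    have sum_e: "(\<Sum>n=1..N. e ^ n * c) \<le> N * c" if "c \<ge> 0" for c :: real
    proof -
      have "(\<Sum>n=1..N. e ^ n * c) \<le> (\<Sum>n=1..N. c)"
        using e that by (intro sum_mono mult_left_le_one_le) (auto simp: power_le_one)
      thus ?thesis by simp
    qed
    have "(\<Sum>n=1..N. e ^ n * U' n) \<le>
        (\<Sum>n=1..N. (1 - \<gamma> / C) * (e ^ n * U n) + e ^ n * (\<gamma> * A * P) + \<gamma> * A * (e ^ n * (\<Sum>i\<in>{1..<n}. U i)) + e ^ n * E)"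
    proof (rule sum_mono)
      fix n assume "n \<in> {1..N}"
      hence "e ^ n * U' n \<le> e ^ n * ((1 - \<gamma> / C) * U n + \<gamma> * A * (P + (\<Sum>i\<in>{1..<n}. U i)) + E)"
        using U' e by (intro mult_left_mono) auto
      thus "e ^ n * U' n \<le> (1 - \<gamma> / C) * (e ^ n * U n) + e ^ n * (\<gamma> * A * P)
          + \<gamma> * A * (e ^ n * (\<Sum>i\<in>{1..<n}. U i)) + e ^ n * E"
        by (simp add: algebra_simps)
    qed
    also have "\<dots> = (1 - \<gamma> / C) * S + (\<Sum>n=1..N. e ^ n * (\<gamma> * A * P))
        + \<gamma> * A * (\<Sum>n=1..N. e ^ n * (\<Sum>i\<in>{1..<n}. U i)) + (\<Sum>n=1..N. e ^ n * E)"
      by (simp add: sum.distrib sum_distrib_left S_def)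
    also have "\<dots> \<le> (1 - \<gamma> / C) * S + N * (\<gamma> * A * P) + \<gamma> * A * (N * e * S) + N * E"
      unfolding S_def using nn assms e
      by (intro add_mono order_refl sum_e mult_left_mono weighted_triangular_sum_le) auto
    also have "\<gamma> * A * (N * e * S) \<le> \<gamma> / (4 * C) * S"
    proof -
      have "A * (N * e) = real N / ((real N + 1) * (4 * C))"
        using assms by (simp add: e_def divide_simps)
      also have "\<dots> \<le> 1 / (4 * C)"
        using assms by (simp add: divide_simps)
      finally have "A * (N * e) * (\<gamma> * S) \<le> 1 / (4 * C) * (\<gamma> * S)"
        using nn S by (intro mult_right_mono) auto
      thus ?thesis by (simp add: algebra_simps)
    qed
    finally have S': "(\<Sum>n=1..N. e ^ n * U' n) \<le> S - 3 / 4 * (\<gamma> / C * S) + \<gamma> * (A * N * P) + N * E"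
      by (simp add: algebra_simps)
    \<comment> \<open>Two bounds for the same coefficient: the one with \<alpha> is charged to the
      decay of \<open>W\<close>, the one with \<gamma> to the decay of \<open>Z\<close>.\<close>
    have a2: "\<alpha>\<^sup>2 / \<gamma> \<le> r * \<alpha>" "r * \<alpha> \<le> r * \<gamma>"
    proof -
      show "\<alpha>\<^sup>2 / \<gamma> \<le> r * \<alpha>"
        using mult_left_mono[OF \<alpha>\<gamma>, of \<alpha>] nn by (simp add: power2_eq_square field_simps)
      have "r * \<gamma> \<le> \<gamma>"
        using r nn by (simp add: mult_le_cancel_right1)
      thus "r * \<alpha> \<le> r * \<gamma>"
        using \<alpha>\<gamma> r by simp
    qed
    have "\<alpha>\<^sup>2 / \<gamma> * C * (W + P + (\<Sum>n=1..N. U n)) \<le> \<alpha>\<^sup>2 / \<gamma> * C * (W + q * Z)"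
      using PU nn assms by (intro mult_left_mono) auto
    also have "\<dots> = \<alpha>\<^sup>2 / \<gamma> * (C * W) + \<alpha>\<^sup>2 / \<gamma> * (C * q * Z)"
      by (simp only: distrib_left mult.assoc)
    also have "\<dots> \<le> r * \<alpha> * (C * W) + r * \<gamma> * (C * q * Z)"
      using a2 nn assms q Z by (intro add_mono mult_right_mono) auto
    finally have "P' \<le> (1 - \<gamma>) * P + (r * \<alpha> * (C * W) + r * \<gamma> * (C * q * Z)) + E"
      using P' by linarith
    hence "l * P' \<le> l * ((1 - \<gamma>) * P + (r * \<alpha> * (C * W) + r * \<gamma> * (C * q * Z)) + E)"
      using l by (intro mult_left_mono) auto
    also have "\<dots> = l * P - \<gamma> * (l * P) + \<alpha> * (l * r * C * W) + \<gamma> * (r * (l * C * q) * Z) + l * E"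
      by (simp add: algebra_simps)
    finally have lP': "l * P' \<le> l * P - \<gamma> * (l * P) + \<alpha> * (l * r * C * W) + \<gamma> * (r * (l * C * q) * Z) + l * E" .
    have "2 * \<alpha> * C * (P + (\<Sum>n=1..N. U n)) \<le> 2 * \<alpha> * C * (q * Z)"
      using PU nn assms by (intro mult_left_mono) auto
    also have "\<dots> = \<alpha> * (2 * C * q * Z)"
      by simp
    also have "\<dots> \<le> r * \<gamma> * (2 * C * q * Z)"
      using \<alpha>\<gamma> assms q Z by (intro mult_right_mono) auto
    finally have W'': "W' \<le> W - 2 * (\<alpha> / C * W) + \<gamma> * (r * (2 * C * q) * Z) + E"
      using W' by (simp add: algebra_simps)
    have AN: "\<gamma> * (A * N * P) \<le> 1 / 2 * (\<gamma> * (l * P))"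
      using nn by (simp add: l_def algebra_simps)
    have lr: "l * r * C \<le> 1 / C"
    proof -
      have "l * r * C = l / (4 * q * (2 + l)) * (1 / C)"
        using assms by (simp add: r_def divide_simps)
      also have "\<dots> \<le> 1 * (1 / C)"
      proof (rule mult_right_mono)
        have "l \<le> 4 * q * (2 + l)"
          using mult_mono[of 1 "4 * q" l "2 + l"] l q by simp
        thus "l / (4 * q * (2 + l)) \<le> 1"
          using q l by simp
      qed (use assms in auto)
      finally show ?thesis by simp
    qed
    have rC: "r * (l * C * q) + r * (2 * C * q) = 1 / (4 * C)"
    proof -
      have "r * (l * C * q) + r * (2 * C * q) = r * (C * q * (2 + l))"
        by (simp add: algebra_simps)
      thus ?thesis
        using assms q l by (simp add: r_def)
    qed
    have t1: "\<alpha> * (l * r * C * W) \<le> \<alpha> / C * W"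
      using mult_right_mono[OF lr, of "\<alpha> * W"] nn by (simp add: mult_ac)
    have t2: "\<gamma> * (r * (l * C * q) * Z) + \<gamma> * (r * (2 * C * q) * Z) = 1 / 4 * (\<gamma> / C * Z)"
    proof -
      have "\<gamma> * (r * (l * C * q) * Z) + \<gamma> * (r * (2 * C * q) * Z) = (r * (l * C * q) + r * (2 * C * q)) * (\<gamma> * Z)"
        by (simp add: algebra_simps)
      thus ?thesis by (simp add: rC)
    qed
    have t3: "\<gamma> / C * (l * P) \<le> \<gamma> * (l * P)"
      using nn l assms by (intro mult_right_mono) (auto simp: divide_le_eq mult_le_cancel_left1)
    have t4: "\<gamma> / C * Z = \<gamma> / C * (l * P) + \<gamma> / C * S"
      by (simp add: Z_def distrib_left)
    have t5: "0 \<le> \<gamma> / C * S"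
      using nn assms S by simp
    have t6: "\<alpha> / C * Z \<le> \<gamma> / C * Z"
    proof -
      have "\<alpha> \<le> \<gamma>"
        using \<alpha>\<gamma> r nn by (meson mult_left_le_one_le less_imp_le order_trans)
      thus ?thesis
        using assms Z by (intro mult_right_mono divide_right_mono) auto
    qed
    have t7: "0 \<le> \<alpha> / C * W"
      using nn assms by simp
    \<comment> \<open>The budget in units of \<gamma>/C: \<open>S\<close> retains 3/4 of its decay
      and \<open>l * P\<close> at least 1/2, and the coupling through \<open>r\<close> costs 1/4 of
      \<open>Z\<close>, so at least 1/4 of \<open>Z\<close> is left and dominates the part with
      \<alpha>/C. \<open>W\<close> decays by 2 \<alpha>/C and spends one of these on the
      delay.\<close>
    have "W' + l * P' + (\<Sum>n=1..N. e ^ n * U' n) \<le> W + Z - 1 / 4 * (\<alpha> / C * W) - 1 / 4 * (\<alpha> / C * Z) + (E + l * E + N * E)"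
    proof -
      \<comment> \<open>With names for the products the inequality is linear.\<close>
      define x1 where "x1 = \<gamma> * (r * (2 * C * q) * Z)"
      define x2 where "x2 = \<gamma> * (r * (l * C * q) * Z)"
      define x3 where "x3 = \<alpha> * (l * r * C * W)"
      define x4 where "x4 = \<gamma> * (A * N * P)"
      define x5 where "x5 = \<gamma> * (l * P)"
      define x6 where "x6 = \<gamma> / C * (l * P)"
      define x7 where "x7 = \<gamma> / C * S"
      define x8 where "x8 = \<gamma> / C * Z"
      define x9 where "x9 = \<alpha> / C * Z"
      define x10 where "x10 = \<alpha> / C * W"
      define x11 where "x11 = l * P'"
      define x12 where "x12 = (\<Sum>n=1..N. e ^ n * U' n)"
      note atoms = x1_def x2_def x3_def x4_def x5_def x6_def x7_def x8_def x9_def x10_def x11_def x12_def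
      have "Z = l * P + S"
        by (rule Z_def)
      thus ?thesis
        using W'' lP' S' AN t1 t2 t3 t4 t5 t6 t7 unfolding atoms[symmetric] by linarith
    qed
    also have "\<dots> = (1 - \<alpha> / (4 * C)) * (W + Z) + (1 + l + real N) * E"
      by (simp add: algebra_simps add_divide_distrib)
    finally show "W' + l * P' + (\<Sum>n=1..N. e ^ n * U' n)
        \<le> (1 - \<alpha> / (4 * C)) * (W + l * P + (\<Sum>n=1..N. e ^ n * U n)) + (1 + l + real N) * E"
      by (simp add: Z_def S_def add.assoc)
  qed
  thus ?thesis
    by (rule that)
qed

text \<open>\<open>g * s\<close> is the fixed point of the affine recursion, so one factor
  \<open>s\<close> of the source is lost to accumulation, whatever the number of steps.\<close>

lemma contraction_iterate_le:
  fixes L :: "nat \<Rightarrow> real"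
  assumes "\<And>k. k < K \<Longrightarrow> L (Suc k) \<le> (1 - s) * L k + g * s\<^sup>2"
    and "0 \<le> s" "s \<le> 1" "0 \<le> g" "k \<le> K"
  shows "L k \<le> (1 - s) ^ k * L 0 + g * s"
  using \<open>k \<le> K\<close>
proof (induction k)
  case 0
  thus ?case using assms by simp
next
  case (Suc k)
  have "L (Suc k) \<le> (1 - s) * L k + g * s\<^sup>2"
    using assms(1) Suc.prems by simp
  also have "\<dots> \<le> (1 - s) * ((1 - s) ^ k * L 0 + g * s) + g * s\<^sup>2"
    using Suc assms by (intro add_mono mult_left_mono) auto
  also have "\<dots> = (1 - s) ^ Suc k * L 0 + g * s"
    by (simp add: algebra_simps power2_eq_square)
  finally show ?case .
qed

section \<open>Measurability and moments of the iterates\<close>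

text \<open>Needed for \<open>y_star\<close> along the last iterate, whose values, unlike those of
  \<open>h\<close> and \<open>v\<close>, do not appear in an update rule. The Lipschitz bound covers
  only tuples with values in the sets \<open>V i\<close>, so the map is continuous merely on
  \<open>S\<close>, and the composition goes through the Borel sets restricted to
  \<open>S\<close>.\<close>

lemma borel_measurable_lipschitz_tuple:
  fixes \<phi> :: "'a::euclidean_space \<Rightarrow> (nat \<Rightarrow> 'b::euclidean_space) \<Rightarrow> 'c::euclidean_space"
  assumes "finite I"
    and lip: "\<And>x x' y y'. y \<in> Pi\<^sub>E I V \<Longrightarrow> y' \<in> Pi\<^sub>E I V \<Longrightarrow>
      norm (\<phi> x y - \<phi> x' y') \<le> c * (norm (x - x') + (\<Sum>i\<in>I. norm (y i - y' i)))"
    and X: "X \<in> borel_measurable M" and Y: "\<And>i. i \<in> I \<Longrightarrow> Y i \<in> borel_measurable M"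
    and V: "\<And>i \<omega>. i \<in> I \<Longrightarrow> \<omega> \<in> space M \<Longrightarrow> Y i \<omega> \<in> V i"
  shows "(\<lambda>\<omega>. \<phi> (X \<omega>) (restrict (\<lambda>i. Y i \<omega>) I)) \<in> borel_measurable M"
proof -
  define S where "S = {q :: 'a \<times> (nat \<Rightarrow> 'b). \<forall>i\<in>I. snd q i \<in> V i}"
  define G where "G q = \<phi> (fst q) (restrict (snd q) I)" for q
  define F where "F \<omega> = (X \<omega>, \<lambda>i. if i \<in> I then Y i \<omega> else 0)" for \<omega>
  have "continuous_on S G"
    unfolding continuous_on_def
  proof
    fix q assume q: "q \<in> S"
    let ?b = "\<lambda>q'. c * (norm (fst q' - fst q) + (\<Sum>i\<in>I. norm (snd q' i - snd q i)))"
    have coord: "continuous_on S (\<lambda>q' :: 'a \<times> (nat \<Rightarrow> 'b). snd q' i)" for i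
      by (rule continuous_on_product_then_coordinatewise) (intro continuous_intros)
    have "continuous_on S ?b"
      by (intro continuous_intros coord)
    hence "(?b \<longlongrightarrow> ?b q) (at q within S)"
      using q by (simp only: continuous_on_def)
    hence "(?b \<longlongrightarrow> 0) (at q within S)"
      by simp
    moreover have "norm (G q' - G q) \<le> ?b q'" if "q' \<in> S" for q'
    proof -
      have "restrict (snd q') I \<in> Pi\<^sub>E I V" "restrict (snd q) I \<in> Pi\<^sub>E I V"
        using q that by (auto simp: S_def)
      from lip[OF this, of "fst q'" "fst q"] show ?thesis
        by (simp add: G_def)
    qed
    hence "\<forall>\<^sub>F q' in at q within S. norm (G q' - G q) \<le> ?b q'"
      by (auto simp: eventually_at_filter)
    ultimately have "((\<lambda>q'. G q' - G q) \<longlongrightarrow> 0) (at q within S)"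
      by (rule Lim_null_comparison[rotated])
    thus "(G \<longlongrightarrow> G q) (at q within S)"
      by (rule LIM_zero_cancel)
  qed
  hence "G \<in> borel_measurable (restrict_space borel S)"
    by (rule borel_measurable_continuous_on_restrict)
  moreover have "F \<in> borel_measurable M"
    unfolding F_def
  proof (intro borel_measurable_Pair X measurable_coordinatewise_then_product)
    show "(\<lambda>\<omega>. if i \<in> I then Y i \<omega> else 0) \<in> borel_measurable M" for i
      using Y by (cases "i \<in> I") auto
  qed
  hence "F \<in> measurable M (restrict_space borel S)"
    using V by (intro measurable_restrict_space2) (auto simp: F_def S_def)
  ultimately have "(\<lambda>\<omega>. G (F \<omega>)) \<in> borel_measurable M"
    by (rule measurable_compose[rotated])
  moreover have "G (F \<omega>) = \<phi> (X \<omega>) (restrict (\<lambda>i. Y i \<omega>) I)" for \<omega>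
    by (simp add: G_def F_def restrict_def cong: if_cong)
  ultimately show ?thesis
    by simp
qed

section \<open>The natural filtration and the filter adapted to it\<close>

lemma space_history: "space (history N M X Y k) = space M"
  unfolding history_def by (rule space_measure_of) auto

lemma history_generator_in_sets:
  shows "l \<le> k \<Longrightarrow> S \<in> sets borel \<Longrightarrow> X l -` S \<inter> space M \<in> sets (history N M X Y k)"
    and "n \<in> {1..N} \<Longrightarrow> l \<le> k \<Longrightarrow> S' \<in> sets borel \<Longrightarrow> Y n l -` S' \<inter> space M \<in> sets (history N M X Y k)"
  unfolding history_def by (subst sets_measure_of; blast)+

lemma borel_measurable_history:
  shows "l \<le> k \<Longrightarrow> X l \<in> borel_measurable (history N M X Y k)"
    and "n \<in> {1..N} \<Longrightarrow> l \<le> k \<Longrightarrow> Y n l \<in> borel_measurable (history N M X Y k)"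
  by (auto intro!: measurableI simp: space_history history_generator_in_sets)

lemma subalgebra_history:
  assumes "\<And>l. l \<le> k \<Longrightarrow> X l \<in> borel_measurable M"
    and "\<And>n l. n \<in> {1..N} \<Longrightarrow> l \<le> k \<Longrightarrow> Y n l \<in> borel_measurable M"
  shows "subalgebra M (history N M X Y k)"
  unfolding subalgebra_def
proof
  let ?A = "{X l -` S \<inter> space M | l S. l \<le> k \<and> S \<in> sets borel} \<union>
     {Y n l -` S \<inter> space M | n l S. n \<in> {1..N} \<and> l \<le> k \<and> S \<in> sets borel}"
  have "?A \<subseteq> sets M"
    using assms by (auto intro: measurable_sets)
  hence "sigma_sets (space M) ?A \<subseteq> sets M"
    by (rule sets.sigma_sets_subset)
  moreover have "?A \<subseteq> Pow (space M)"
    by auto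
  ultimately show "sets (history N M X Y k) \<subseteq> sets M"
    unfolding history_def by (simp only: sets_measure_of)
qed (rule space_history)

text \<open>The value with index \<open>Suc k\<close> reads \<open>X\<close> only up to index
  \<open>k\<close>; this one-step lag is what makes it measurable for the history at
  \<open>k\<close>. Starting at \<open>X 0\<close> makes the initial delay zero.\<close>

primrec filtered :: "real \<Rightarrow> (nat \<Rightarrow> 'w \<Rightarrow> 'a::real_vector) \<Rightarrow> nat \<Rightarrow> 'w \<Rightarrow> 'a"
  where "filtered \<gamma> X 0 = X 0"
  | "filtered \<gamma> X (Suc k) = (\<lambda>\<omega>. filtered \<gamma> X k \<omega> + \<gamma> *\<^sub>R (X k \<omega> - filtered \<gamma> X k \<omega>))"

lemma borel_measurable_filtered:
  fixes X :: "nat \<Rightarrow> 'w \<Rightarrow> 'a::euclidean_space"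
  assumes "\<And>l. l \<le> k \<Longrightarrow> X l \<in> borel_measurable F"
  shows "filtered \<gamma> X k \<in> borel_measurable F"
  using assms by (induction k) auto

lemma square_integrable_filtered:
  assumes "\<And>l. l \<le> k \<Longrightarrow> square_integrable M (X l)"
  shows "square_integrable M (filtered \<gamma> X k)"
  using assms
  by (induction k) (auto intro!: square_integrable_add square_integrable_scaleR square_integrable_diff)

lemma continuous_if_norm_lipschitz:
  fixes f :: "'a::real_normed_vector \<Rightarrow> 'b::real_normed_vector"
  assumes "\<And>x y. norm (f x - f y) \<le> c * norm (x - y)"
  shows "continuous_on UNIV f"
proof (rule lipschitz_on_continuous_on)
  show "\<bar>c\<bar>-lipschitz_on UNIV f"
  proof (rule lipschitz_onI)
    show "dist (f x) (f y) \<le> \<bar>c\<bar> * dist x y" for x y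
      using assms[of x y] mult_right_mono[OF abs_ge_self[of c] norm_ge_zero[of "x - y"]] by (simp add: dist_norm)
  qed simp
qed

lemma square_integrable_lipschitz:
  fixes f :: "'a::euclidean_space \<Rightarrow> 'b::euclidean_space"
  assumes "finite_measure M" "square_integrable M g" "\<And>x y. norm (f x - f y) \<le> c * norm (x - y)"
  shows "square_integrable M (\<lambda>\<omega>. f (g \<omega>))"
proof (rule square_integrable_bound)
  show "(\<lambda>\<omega>. f (g \<omega>)) \<in> borel_measurable M"
    using borel_measurable_continuous_onI[OF continuous_if_norm_lipschitz[OF assms(3)]]
      square_integrableD(1)[OF assms(2)] by (rule measurable_compose[rotated])
  show "integrable M (\<lambda>\<omega>. 2 * (norm (f 0))\<^sup>2 + 2 * c\<^sup>2 * (norm (g \<omega>))\<^sup>2)"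
    using assms(1,2) by (auto simp: square_integrable_def finite_measure.integrable_const)
  fix \<omega>
  have "(norm (f (g \<omega>) - f 0))\<^sup>2 \<le> (c * norm (g \<omega>))\<^sup>2"
    using assms(3)[of "g \<omega>" 0] by (intro power_mono) auto
  thus "(norm (f (g \<omega>)))\<^sup>2 \<le> 2 * (norm (f 0))\<^sup>2 + 2 * c\<^sup>2 * (norm (g \<omega>))\<^sup>2"
    using norm_add_square_le[of "f 0" "f (g \<omega>) - f 0"] by (simp add: power_mult_distrib)
qed

lemmas (in finite_measure) integrable_intros =
  Bochner_Integration.integrable_add Bochner_Integration.integrable_sum integrable_mult_right integrable_const

section \<open>One run with a fixed number of iterations: measurability and second moments\<close>

locale mssa_process = tracking_estimates N V v h xs C + prob_space M
  for N :: nat and V :: "nat \<Rightarrow> 'b::euclidean_space set"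
    and v :: "'a::euclidean_space \<Rightarrow> (nat \<Rightarrow> 'b) \<Rightarrow> 'a"
    and h :: "nat \<Rightarrow> 'a \<Rightarrow> (nat \<Rightarrow> 'b) \<Rightarrow> 'b" and xs :: 'a and C :: real
    and M :: "'w measure" +
  fixes K :: nat and \<alpha> :: "nat \<Rightarrow> real" and \<beta> :: "nat \<Rightarrow> nat \<Rightarrow> real"
    and X :: "nat \<Rightarrow> 'w \<Rightarrow> 'a" and Y :: "nat \<Rightarrow> nat \<Rightarrow> 'w \<Rightarrow> 'b"
    and \<xi> :: "nat \<Rightarrow> 'w \<Rightarrow> 'a" and \<psi> :: "nat \<Rightarrow> nat \<Rightarrow> 'w \<Rightarrow> 'b"
    and \<omega>\<^sub>0 \<omega>\<^sub>1 \<omega>\<^sub>2 \<sigma> :: real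
  assumes run: "mssa_run N V v h K \<alpha> \<beta> M X Y \<xi> \<psi>"
    and noise: "noise_conditions N v h \<omega>\<^sub>0 \<omega>\<^sub>1 \<omega>\<^sub>2 \<sigma> K M X Y \<xi> \<psi>"
    and noise_pos: "0 < \<omega>\<^sub>0" "0 < \<omega>\<^sub>1" "0 < \<omega>\<^sub>2" "0 < \<sigma>"
    and initial: "integrable M (\<lambda>\<omega>. (norm (X 0 \<omega>))\<^sup>2)"
      "\<And>n. n \<in> {1..N} \<Longrightarrow> integrable M (\<lambda>\<omega>. (norm (Y n 0 \<omega>))\<^sup>2)"
begin

abbreviation D :: "nat \<Rightarrow> 'a \<Rightarrow> 'b"
  where "D \<equiv> y_diamond V h"

abbreviation Hp :: "nat \<Rightarrow> nat \<Rightarrow> 'w \<Rightarrow> 'b"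
  where "Hp n k \<omega> \<equiv> h n (X k \<omega>) (\<lambda>i\<in>{1..n}. Y i k \<omega>)"

abbreviation Vp :: "nat \<Rightarrow> 'w \<Rightarrow> 'a"
  where "Vp k \<omega> \<equiv> v (X k \<omega>) (\<lambda>i\<in>{1..N}. Y i k \<omega>)"

lemma step_pos: "k < K \<Longrightarrow> 0 < \<alpha> k" "k < K \<Longrightarrow> n \<in> {1..N} \<Longrightarrow> 0 < \<beta> n k"
  using run unfolding mssa_run_def by blast+

lemma X_measurable: "k \<le> K \<Longrightarrow> X k \<in> borel_measurable M"
  and Y_measurable: "k \<le> K \<Longrightarrow> n \<in> {1..N} \<Longrightarrow> Y n k \<in> borel_measurable M"
  and Y_in: "k \<le> K \<Longrightarrow> \<omega> \<in> space M \<Longrightarrow> n \<in> {1..N} \<Longrightarrow> Y n k \<omega> \<in> V n"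
  using run unfolding mssa_run_def by blast+

lemma X_Suc: "k < K \<Longrightarrow> \<omega> \<in> space M \<Longrightarrow> X (Suc k) \<omega> = X k \<omega> - \<alpha> k *\<^sub>R (Vp k \<omega> + \<xi> k \<omega>)"
  and Y_Suc: "k < K \<Longrightarrow> \<omega> \<in> space M \<Longrightarrow> n \<in> {1..N} \<Longrightarrow>
    Y n (Suc k) \<omega> = Y n k \<omega> - \<beta> n k *\<^sub>R (Hp n k \<omega> + \<psi> n k \<omega>)"
  using run unfolding mssa_run_def by blast+

lemma history_subalgebra: "k \<le> K \<Longrightarrow> subalgebra M (history N M X Y k)"
  using X_measurable Y_measurable by (intro subalgebra_history) auto

lemma history_sigma_finite: "k \<le> K \<Longrightarrow> sigma_finite_subalgebra M (history N M X Y k)"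
  by (intro finite_measure_subalgebra_is_sigma_finite finite_measure_subalgebra.intro
      finite_measure_subalgebra_axioms.intro history_subalgebra finite_measure_axioms)

lemma
  assumes "k < K"
  shows \<xi>_measurable: "\<xi> k \<in> borel_measurable M"
    and \<xi>_centered: "AE \<omega> in M. vec_cond_exp M (history N M X Y k) (\<xi> k) \<omega> = 0"
proof -
  have "martingale_differences K M (history N M X Y) \<xi>"
    using noise unfolding noise_conditions_def by blast
  thus "\<xi> k \<in> borel_measurable M"
    "AE \<omega> in M. vec_cond_exp M (history N M X Y k) (\<xi> k) \<omega> = 0"
    using assms measurable_from_subalg[OF history_subalgebra[of "Suc k"]]
    unfolding martingale_differences_def by auto
qed

lemma
  assumes "k < K" "n \<in> {1..N}"
  shows \<psi>_measurable: "\<psi> n k \<in> borel_measurable M"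
    and \<psi>_centered: "AE \<omega> in M. vec_cond_exp M (history N M X Y k) (\<psi> n k) \<omega> = 0"
proof -
  have "martingale_differences K M (history N M X Y) (\<psi> n)"
    using noise assms unfolding noise_conditions_def by blast
  thus "\<psi> n k \<in> borel_measurable M"
    "AE \<omega> in M. vec_cond_exp M (history N M X Y k) (\<psi> n k) \<omega> = 0"
    using assms measurable_from_subalg[OF history_subalgebra[of "Suc k"]]
    unfolding martingale_differences_def by auto
qed

text \<open>\<open>v\<close> and \<open>h\<close> need not be Borel functions, but the update rule expresses their values along the run
  through measurable functions.\<close>

lemma Vp_measurable:
  assumes "k < K"
  shows "Vp k \<in> borel_measurable M"
proof -
  have "(\<lambda>\<omega>. (1 / \<alpha> k) *\<^sub>R (X k \<omega> - X (Suc k) \<omega>) - \<xi> k \<omega>) \<in> borel_measurable M"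
    using X_measurable[of k] X_measurable[of "Suc k"] \<xi>_measurable assms by simp
  moreover have "Vp k \<omega> = (1 / \<alpha> k) *\<^sub>R (X k \<omega> - X (Suc k) \<omega>) - \<xi> k \<omega>" if "\<omega> \<in> space M" for \<omega>
    using X_Suc[OF assms that] step_pos(1)[OF assms] by simp
  ultimately show ?thesis
    by (simp cong: measurable_cong)
qed

lemma Hp_measurable:
  assumes "k < K" "n \<in> {1..N}"
  shows "Hp n k \<in> borel_measurable M"
proof -
  have "(\<lambda>\<omega>. (1 / \<beta> n k) *\<^sub>R (Y n k \<omega> - Y n (Suc k) \<omega>) - \<psi> n k \<omega>) \<in> borel_measurable M"
    using Y_measurable[of k n] Y_measurable[of "Suc k" n] \<psi>_measurable assms by simp
  moreover have "Hp n k \<omega> = (1 / \<beta> n k) *\<^sub>R (Y n k \<omega> - Y n (Suc k) \<omega>) - \<psi> n k \<omega>" if "\<omega> \<in> space M" for \<omega>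
    using Y_Suc[OF assms(1) that assms(2)] step_pos(2)[OF assms] by simp
  ultimately show ?thesis
    by (simp cong: measurable_cong)
qed

text \<open>The reference point \<open>t\<close> stays free and may depend on the outcome. Square
  integrability is obtained with \<open>t = xs\<close>, the drift with \<open>t\<close> equal to the
  filter at the same outcome.\<close>

lemma process_estimates:
  assumes "k \<le> K" "\<omega> \<in> space M"
  shows Vp_bound: "(norm (Vp k \<omega>))\<^sup>2
      \<le> C * ((norm (X k \<omega> - xs))\<^sup>2 + (norm (X k \<omega> - t))\<^sup>2 + (\<Sum>i=1..N. (norm (Y i k \<omega> - D i t))\<^sup>2))"
    and Vp_coercive: "(norm (X k \<omega> - xs))\<^sup>2 / C \<le> Vp k \<omega> \<bullet> (X k \<omega> - xs)
      + C * ((norm (X k \<omega> - t))\<^sup>2 + (\<Sum>i=1..N. (norm (Y i k \<omega> - D i t))\<^sup>2))"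
    and Hp_bound: "n \<in> {1..N} \<Longrightarrow> (norm (Hp n k \<omega>))\<^sup>2
      \<le> C * ((norm (X k \<omega> - t))\<^sup>2 + (\<Sum>i=1..N. (norm (Y i k \<omega> - D i t))\<^sup>2))"
    and Hp_coercive: "n \<in> {1..N} \<Longrightarrow> (norm (Y n k \<omega> - D n t))\<^sup>2 / C \<le> Hp n k \<omega> \<bullet> (Y n k \<omega> - D n t)
      + C * ((norm (X k \<omega> - t))\<^sup>2 + (\<Sum>i\<in>{1..<n}. (norm (Y i k \<omega> - D i t))\<^sup>2))"
    and Yp_gap: "n \<in> {1..N} \<Longrightarrow> (norm (Y n k \<omega> - y_star V h n (X k \<omega>) (\<lambda>i\<in>{1..<n}. Y i k \<omega>)))\<^sup>2
      \<le> C * ((norm (X k \<omega> - t))\<^sup>2 + (\<Sum>i=1..N. (norm (Y i k \<omega> - D i t))\<^sup>2))"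
proof -
  note Y = Y_in[OF assms]
  show "(norm (Vp k \<omega>))\<^sup>2
      \<le> C * ((norm (X k \<omega> - xs))\<^sup>2 + (norm (X k \<omega> - t))\<^sup>2 + (\<Sum>i=1..N. (norm (Y i k \<omega> - D i t))\<^sup>2))"
    by (rule v_bound[of "\<lambda>i. Y i k \<omega>"]) (rule Y)
  show "(norm (X k \<omega> - xs))\<^sup>2 / C \<le> Vp k \<omega> \<bullet> (X k \<omega> - xs)
      + C * ((norm (X k \<omega> - t))\<^sup>2 + (\<Sum>i=1..N. (norm (Y i k \<omega> - D i t))\<^sup>2))"
    by (rule v_coercive[of "\<lambda>i. Y i k \<omega>"]) (rule Y)
  show "(norm (Hp n k \<omega>))\<^sup>2
      \<le> C * ((norm (X k \<omega> - t))\<^sup>2 + (\<Sum>i=1..N. (norm (Y i k \<omega> - D i t))\<^sup>2))" if "n \<in> {1..N}"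
    by (rule h_bound[of _ "\<lambda>i. Y i k \<omega>", OF that]) (rule Y)
  show "(norm (Y n k \<omega> - D n t))\<^sup>2 / C \<le> Hp n k \<omega> \<bullet> (Y n k \<omega> - D n t)
      + C * ((norm (X k \<omega> - t))\<^sup>2 + (\<Sum>i\<in>{1..<n}. (norm (Y i k \<omega> - D i t))\<^sup>2))" if "n \<in> {1..N}"
    by (rule h_coercive[of _ "\<lambda>i. Y i k \<omega>", OF that]) (rule Y)
  show "(norm (Y n k \<omega> - y_star V h n (X k \<omega>) (\<lambda>i\<in>{1..<n}. Y i k \<omega>)))\<^sup>2
      \<le> C * ((norm (X k \<omega> - t))\<^sup>2 + (\<Sum>i=1..N. (norm (Y i k \<omega> - D i t))\<^sup>2))" if "n \<in> {1..N}"
    by (rule gap_bound[of _ "\<lambda>i. Y i k \<omega>", OF that]) (rule Y)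
qed

context
  fixes k
  assumes k: "k < K" and X_si: "square_integrable M (X k)"
    and Y_si: "\<And>n. n \<in> {1..N} \<Longrightarrow> square_integrable M (Y n k)"
begin

lemma deviation_integrable:
  "integrable M (\<lambda>\<omega>. (norm (X k \<omega> - c))\<^sup>2)"
  "n \<in> {1..N} \<Longrightarrow> integrable M (\<lambda>\<omega>. (norm (Y n k \<omega> - c'))\<^sup>2)"
  using X_si Y_si
  by (auto intro!: square_integrableD(2) square_integrable_diff square_integrable_const finite_measure_axioms)

lemma Vp_square_integrable: "square_integrable M (Vp k)"
proof (rule square_integrable_bound[OF Vp_measurable[OF k]])
  show "integrable M (\<lambda>\<omega>. C * ((norm (X k \<omega> - xs))\<^sup>2 + (norm (X k \<omega> - xs))\<^sup>2 + (\<Sum>i=1..N. (norm (Y i k \<omega> - D i xs))\<^sup>2)))"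
    by (intro integrable_intros deviation_integrable)
qed (rule Vp_bound[OF less_imp_le[OF k]])

lemma Hp_square_integrable:
  assumes n: "n \<in> {1..N}"
  shows "square_integrable M (Hp n k)"
proof (rule square_integrable_bound[OF Hp_measurable[OF k n]])
  show "integrable M (\<lambda>\<omega>. C * ((norm (X k \<omega> - xs))\<^sup>2 + (\<Sum>i=1..N. (norm (Y i k \<omega> - D i xs))\<^sup>2)))"
    by (intro integrable_intros deviation_integrable)
qed (rule Hp_bound[OF less_imp_le[OF k] _ n])

lemma \<psi>_second_moment:
  assumes n: "n \<in> {1..N}"
  shows "square_integrable M (\<psi> n k)"
    and "(\<integral>\<omega>. (norm (\<psi> n k \<omega>))\<^sup>2 \<partial>M) \<le> \<omega>\<^sub>0 * (\<integral>\<omega>. (norm (Hp n k \<omega>))\<^sup>2 \<partial>M) + \<sigma>\<^sup>2"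
proof -
  interpret F: sigma_finite_subalgebra M "history N M X Y k"
    using k by (intro history_sigma_finite) simp
  have var: "AE \<omega> in M. cond_variance M (history N M X Y k) (\<psi> n k) \<omega>
      \<le> ennreal (\<omega>\<^sub>0 * (norm (Hp n k \<omega>))\<^sup>2 + \<sigma>\<^sup>2)"
    using noise k n unfolding noise_conditions_def by blast
  have int: "integrable M (\<lambda>\<omega>. \<omega>\<^sub>0 * (norm (Hp n k \<omega>))\<^sup>2 + \<sigma>\<^sup>2)"
    using square_integrableD(2)[OF Hp_square_integrable[OF n]] by simp
  have nn: "0 \<le> \<omega>\<^sub>0 * (norm (Hp n k \<omega>))\<^sup>2 + \<sigma>\<^sup>2" for \<omega>
    using noise_pos by simp
  note F.second_moment_le_cond_variance_bound[OF \<psi>_measurable[OF k n] \<psi>_centered[OF k n] var int nn]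
  thus "square_integrable M (\<psi> n k)"
    "(\<integral>\<omega>. (norm (\<psi> n k \<omega>))\<^sup>2 \<partial>M) \<le> \<omega>\<^sub>0 * (\<integral>\<omega>. (norm (Hp n k \<omega>))\<^sup>2 \<partial>M) + \<sigma>\<^sup>2"
    using square_integrableD(2)[OF Hp_square_integrable[OF n]] by (simp_all add: prob_space)
qed

lemma \<xi>_second_moment:
  shows "square_integrable M (\<xi> k)"
    and "(\<integral>\<omega>. (norm (\<xi> k \<omega>))\<^sup>2 \<partial>M) \<le> \<omega>\<^sub>1 * (\<integral>\<omega>. (norm (Vp k \<omega>))\<^sup>2 \<partial>M) + \<sigma>\<^sup>2
      + \<omega>\<^sub>2 * (\<Sum>n=1..N. \<integral>\<omega>. (norm (Hp n k \<omega>))\<^sup>2 \<partial>M)"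
proof -
  interpret F: sigma_finite_subalgebra M "history N M X Y k"
    using k by (intro history_sigma_finite) simp
  note i = square_integrableD(2)[OF Hp_square_integrable] square_integrableD(2)[OF Vp_square_integrable]
  have var: "AE \<omega> in M. cond_variance M (history N M X Y k) (\<xi> k) \<omega>
      \<le> ennreal (\<omega>\<^sub>1 * (norm (Vp k \<omega>))\<^sup>2 + \<sigma>\<^sup>2 + \<omega>\<^sub>2 * (\<Sum>n=1..N. (norm (Hp n k \<omega>))\<^sup>2))"
    using noise k unfolding noise_conditions_def by blast
  have int: "integrable M (\<lambda>\<omega>. \<omega>\<^sub>1 * (norm (Vp k \<omega>))\<^sup>2 + \<sigma>\<^sup>2 + \<omega>\<^sub>2 * (\<Sum>n=1..N. (norm (Hp n k \<omega>))\<^sup>2))"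
    by (intro integrable_intros i)
  have nn: "0 \<le> \<omega>\<^sub>1 * (norm (Vp k \<omega>))\<^sup>2 + \<sigma>\<^sup>2 + \<omega>\<^sub>2 * (\<Sum>n=1..N. (norm (Hp n k \<omega>))\<^sup>2)" for \<omega>
    using noise_pos by (auto intro!: add_nonneg_nonneg mult_nonneg_nonneg sum_nonneg)
  note F.second_moment_le_cond_variance_bound[OF \<xi>_measurable[OF k] \<xi>_centered[OF k] var int nn]
  moreover have "(\<integral>\<omega>. (\<Sum>n=1..N. (norm (Hp n k \<omega>))\<^sup>2) \<partial>M) = (\<Sum>n=1..N. \<integral>\<omega>. (norm (Hp n k \<omega>))\<^sup>2 \<partial>M)"
    "integrable M (\<lambda>\<omega>. \<Sum>n=1..N. (norm (Hp n k \<omega>))\<^sup>2)"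
    by (auto intro!: Bochner_Integration.integral_sum integrable_intros i simp del: One_nat_def)
  ultimately show "square_integrable M (\<xi> k)"
    "(\<integral>\<omega>. (norm (\<xi> k \<omega>))\<^sup>2 \<partial>M) \<le> \<omega>\<^sub>1 * (\<integral>\<omega>. (norm (Vp k \<omega>))\<^sup>2 \<partial>M) + \<sigma>\<^sup>2
      + \<omega>\<^sub>2 * (\<Sum>n=1..N. \<integral>\<omega>. (norm (Hp n k \<omega>))\<^sup>2 \<partial>M)"
    using i by (simp_all add: prob_space del: One_nat_def)
qed

end

text \<open>Moments propagate along the run: square integrable iterates make the drifts square
  integrable, the variance bounds then give the noise a second moment, and the update carries this
  to the next iterate. The preceding lemmas therefore take square integrability at \<open>k\<close>
  as a hypothesis.\<close>

lemma iterates_square_integrable: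
  "k \<le> K \<Longrightarrow> square_integrable M (X k) \<and> (\<forall>n\<in>{1..N}. square_integrable M (Y n k))"
proof (induction k)
  case 0
  thus ?case
    using initial X_measurable Y_measurable by (auto simp: square_integrable_def)
next
  case (Suc k)
  hence k: "k < K" and si: "square_integrable M (X k)" "\<And>n. n \<in> {1..N} \<Longrightarrow> square_integrable M (Y n k)"
    by auto
  have "square_integrable M (X (Suc k))"
    using Vp_square_integrable[OF k si] \<xi>_second_moment(1)[OF k si] si
    by (subst square_integrable_cong[OF X_Suc[OF k]])
      (auto intro!: square_integrable_diff square_integrable_scaleR square_integrable_add)
  moreover have "square_integrable M (Y n (Suc k))" if n: "n \<in> {1..N}" for n
    using Hp_square_integrable[OF k si n] \<psi>_second_moment(1)[OF k si n] si(2)[OF n]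
    by (subst square_integrable_cong[OF Y_Suc[OF k _ n]])
      (auto intro!: square_integrable_diff square_integrable_scaleR square_integrable_add)
  ultimately show ?case
    by blast
qed

end

section \<open>Drift inequalities\<close>

text \<open>Here \<open>p\<close> is the delay before the filter moves and
  \<open>(1 - \<gamma>) *\<^sub>R p\<close> the delay after. Young's inequality with weight \<gamma>
  spends half of the decay rate 2 \<gamma> on the cross term; this is the origin of the factor
  \<alpha>^2/\<gamma>. The leftover \<gamma>^2 is of second order.\<close>

lemma filter_drift:
  fixes p f :: "'c::real_inner"
  assumes "0 < \<gamma>" "\<gamma> \<le> 1" "0 \<le> t"
  shows "(norm ((1 - \<gamma>) *\<^sub>R p))\<^sup>2 - 2 * t * (f \<bullet> ((1 - \<gamma>) *\<^sub>R p))
    \<le> (1 - \<gamma> + \<gamma>\<^sup>2) * (norm p)\<^sup>2 + t\<^sup>2 / \<gamma> * (norm f)\<^sup>2"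
proof -
  have "- (f \<bullet> p) \<le> norm f * norm p"
    using Cauchy_Schwarz_ineq2[of f p] by linarith
  hence "(2 * t * (1 - \<gamma>)) * (- (f \<bullet> p)) \<le> (2 * t * (1 - \<gamma>)) * (norm f * norm p)"
    using assms by (intro mult_left_mono) auto
  also have "\<dots> \<le> (2 * t * 1) * (norm f * norm p)"
    using assms by (intro mult_right_mono mult_left_mono) auto
  also have "\<dots> \<le> \<gamma> * (norm p)\<^sup>2 + t\<^sup>2 / \<gamma> * (norm f)\<^sup>2"
  proof -
    have "0 \<le> (\<gamma> * norm p - t * norm f)\<^sup>2 / \<gamma>"
      using assms by simp
    also have "\<dots> = \<gamma> * (norm p)\<^sup>2 + t\<^sup>2 / \<gamma> * (norm f)\<^sup>2 - 2 * t * (norm f * norm p)"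
      using assms by (simp add: power2_eq_square field_simps)
    finally show ?thesis by simp
  qed
  finally have "2 * t * (1 - \<gamma>) * - (f \<bullet> p) \<le> \<gamma> * (norm p)\<^sup>2 + t\<^sup>2 / \<gamma> * (norm f)\<^sup>2" .
  moreover have "(norm ((1 - \<gamma>) *\<^sub>R p))\<^sup>2 = (1 - \<gamma>)\<^sup>2 * (norm p)\<^sup>2"
    by (simp add: power_mult_distrib)
  moreover have "(1 - \<gamma>)\<^sup>2 * (norm p)\<^sup>2 + \<gamma> * (norm p)\<^sup>2 = (1 - \<gamma> + \<gamma>\<^sup>2) * (norm p)\<^sup>2"
    by (simp add: power2_eq_square algebra_simps)
  ultimately show ?thesis
    by (simp add: mult.assoc)
qed

text \<open>\<open>d\<close> is the displacement of the target when the filter moves, of size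
  \<open>C * \<gamma> * p\<close> by Lipschitz continuity of \<open>y_diamond\<close>. The product
  of \<open>u\<close> and \<open>d\<close> costs half of the decay 2 \<gamma>/C and leaves the
  coefficient \<open>C^3\<close>; the error in the coercivity leaves \<open>2 * R * C\<close>. The
  last two terms of the bound are of second order in the step sizes.\<close>

lemma tracking_drift:
  fixes u d f :: "'c::real_inner"
  assumes "1 \<le> C" "0 < \<gamma>" "\<gamma> \<le> t" "t \<le> R * \<gamma>"
    and d: "norm d \<le> C * \<gamma> * p" and p: "0 \<le> p" "p\<^sup>2 \<le> S"
    and coercive: "(norm u)\<^sup>2 / C \<le> f \<bullet> u + C * S" and f: "(norm f)\<^sup>2 \<le> C * q"
  shows "(norm (u + d))\<^sup>2 - 2 * t * (f \<bullet> (u + d))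
    \<le> (1 - \<gamma> / C) * (norm u)\<^sup>2 + \<gamma> * (C^3 + 2 * R * C) * S + 2 * C\<^sup>2 * \<gamma>\<^sup>2 * p\<^sup>2 + t\<^sup>2 * C * q"
proof -
  have S: "S \<ge> 0"
    using p(2) zero_le_power2[of p] by linarith
  have d2: "(norm d)\<^sup>2 \<le> C\<^sup>2 * \<gamma>\<^sup>2 * p\<^sup>2"
    using power_mono[OF d norm_ge_zero, of 2] by (simp add: power_mult_distrib)
  have "2 * (u \<bullet> d) \<le> 2 * (norm u * (C * \<gamma> * p))"
    using norm_cauchy_schwarz[of u d] mult_left_mono[OF d norm_ge_zero[of u]] by linarith
  also have "\<dots> = \<gamma> * (2 * norm u * (C * p))"
    by (simp add: algebra_simps)
  also have "\<dots> \<le> \<gamma> * ((norm u)\<^sup>2 / C + C^3 * p\<^sup>2)"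
  proof (rule mult_left_mono)
    have "0 \<le> (norm u - C\<^sup>2 * p)\<^sup>2 / C"
      using assms(1) by simp
    also have "\<dots> = (norm u)\<^sup>2 / C + C^3 * p\<^sup>2 - 2 * norm u * (C * p)"
      using assms(1) by (simp add: power2_eq_square power3_eq_cube field_simps)
    finally show "2 * norm u * (C * p) \<le> (norm u)\<^sup>2 / C + C^3 * p\<^sup>2"
      by simp
  qed (use assms in auto)
  also have "\<dots> \<le> \<gamma> * ((norm u)\<^sup>2 / C + C^3 * S)"
    using assms(1,2) p(2) by (intro mult_left_mono add_left_mono) auto
  finally have ud: "2 * (u \<bullet> d) \<le> \<gamma> * ((norm u)\<^sup>2 / C) + \<gamma> * (C^3 * S)"
    by (simp add: distrib_left)
  \<comment> \<open>The lower bound \<gamma> on the step secures the decay, the upper bound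
    \<open>R * \<gamma>\<close> limits the error term. This is where the spread \<open>R\<close> of
    the fast steps enters the coupling constant.\<close>
  have "2 * t * ((norm u)\<^sup>2 / C) \<le> 2 * t * (f \<bullet> u + C * S)"
    using coercive assms by (intro mult_left_mono) auto
  moreover have "2 * t * (C * S) \<le> 2 * (R * \<gamma>) * (C * S)"
    using assms(1,4) S by (intro mult_right_mono) auto
  moreover have "2 * \<gamma> * ((norm u)\<^sup>2 / C) \<le> 2 * t * ((norm u)\<^sup>2 / C)"
    using assms(1,3) by (intro mult_right_mono) auto
  ultimately have fu: "- 2 * t * (f \<bullet> u) \<le> - 2 * \<gamma> * ((norm u)\<^sup>2 / C) + \<gamma> * (2 * R * C * S)"
    by (simp add: algebra_simps)
  have "- (f \<bullet> d) \<le> norm f * norm d"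
    using Cauchy_Schwarz_ineq2[of f d] by linarith
  hence "2 * t * - (f \<bullet> d) \<le> 2 * t * (norm f * norm d)"
    using assms by (intro mult_left_mono) auto
  also have "\<dots> \<le> t\<^sup>2 * (norm f)\<^sup>2 + (norm d)\<^sup>2"
    using sum_squares_bound[of "t * norm f" "norm d"] by (simp add: power_mult_distrib mult_ac)
  also have "\<dots> \<le> t\<^sup>2 * (C * q) + C\<^sup>2 * \<gamma>\<^sup>2 * p\<^sup>2"
    using f d2 by (intro add_mono mult_left_mono) auto
  finally have fd: "- 2 * t * (f \<bullet> d) \<le> t\<^sup>2 * C * q + C\<^sup>2 * \<gamma>\<^sup>2 * p\<^sup>2"
    by (simp add: mult.assoc)
  have "(norm (u + d))\<^sup>2 - 2 * t * (f \<bullet> (u + d))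
      = (norm u)\<^sup>2 + 2 * (u \<bullet> d) + (norm d)\<^sup>2 + - 2 * t * (f \<bullet> u) + - 2 * t * (f \<bullet> d)"
    unfolding power2_norm_eq_inner by (simp add: inner_simps inner_commute algebra_simps)
  also have "\<dots> \<le> (norm u)\<^sup>2 + (\<gamma> * ((norm u)\<^sup>2 / C) + \<gamma> * (C^3 * S)) + C\<^sup>2 * \<gamma>\<^sup>2 * p\<^sup>2
      + (- 2 * \<gamma> * ((norm u)\<^sup>2 / C) + \<gamma> * (2 * R * C * S)) + (t\<^sup>2 * C * q + C\<^sup>2 * \<gamma>\<^sup>2 * p\<^sup>2)"
    by (intro add_mono order_refl ud d2 fu fd)
  also have "\<dots> = (1 - \<gamma> / C) * (norm u)\<^sup>2 + \<gamma> * (C^3 + 2 * R * C) * S + 2 * C\<^sup>2 * \<gamma>\<^sup>2 * p\<^sup>2 + t\<^sup>2 * C * q"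
    by (simp add: algebra_simps)
  finally show ?thesis .
qed

section \<open>Mean squared errors of a run and their one-step drift\<close>

context mssa_process
begin

lemma X_square_integrable: "k \<le> K \<Longrightarrow> square_integrable M (X k)"
  and Y_square_integrable: "k \<le> K \<Longrightarrow> n \<in> {1..N} \<Longrightarrow> square_integrable M (Y n k)"
  using iterates_square_integrable by blast+

lemma D_measurable: "n \<in> {1..N} \<Longrightarrow> D n \<in> borel_measurable borel"
  using diamond_lipschitz by (intro borel_measurable_continuous_onI continuous_if_norm_lipschitz)

definition eW :: "nat \<Rightarrow> real"
  where "eW k = (\<integral>\<omega>. (norm (X k \<omega> - xs))\<^sup>2 \<partial>M)"

definition eP :: "real \<Rightarrow> nat \<Rightarrow> real"
  where "eP \<gamma> k = (\<integral>\<omega>. (norm (X k \<omega> - filtered \<gamma> X k \<omega>))\<^sup>2 \<partial>M)"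

definition eU :: "real \<Rightarrow> nat \<Rightarrow> nat \<Rightarrow> real"
  where "eU \<gamma> n k = (\<integral>\<omega>. (norm (Y n k \<omega> - D n (filtered \<gamma> X k \<omega>)))\<^sup>2 \<partial>M)"

lemma errors_nonneg: "0 \<le> eW k" "0 \<le> eP \<gamma> k" "0 \<le> eU \<gamma> n k"
  by (simp_all add: eW_def eP_def eU_def)

text \<open>The part with \<open>C\<close> collects the growth of drift and noise with the errors,
  and \<sigma>^2 the noise at zero error. One value covers the slow variable and every
  layer.\<close>

definition noise_const :: real
  where "noise_const = (1 + \<omega>\<^sub>0 + \<omega>\<^sub>1 + N * \<omega>\<^sub>2) * C + \<sigma>\<^sup>2"

lemma noise_const_nonneg: "0 \<le> noise_const"
  using noise_pos C_ge_1 by (simp add: noise_const_def)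

context
  fixes \<gamma> :: real
begin

abbreviation T :: "nat \<Rightarrow> 'w \<Rightarrow> 'a"
  where "T \<equiv> filtered \<gamma> X"

abbreviation eQ :: "nat \<Rightarrow> real"
  where "eQ k \<equiv> eW k + eP \<gamma> k + (\<Sum>n=1..N. eU \<gamma> n k)"

lemma filtered_square_integrable: "k \<le> K \<Longrightarrow> square_integrable M (T k)"
  using X_square_integrable by (intro square_integrable_filtered) auto

lemma D_filtered_square_integrable: "k \<le> K \<Longrightarrow> n \<in> {1..N} \<Longrightarrow> square_integrable M (\<lambda>\<omega>. D n (T k \<omega>))"
  using diamond_lipschitz
  by (intro square_integrable_lipschitz[OF finite_measure_axioms filtered_square_integrable])

lemma deviations_square_integrable:
  assumes "k \<le> K"
  shows "square_integrable M (\<lambda>\<omega>. X k \<omega> - xs)"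
    and "square_integrable M (\<lambda>\<omega>. X k \<omega> - T k \<omega>)"
    and "n \<in> {1..N} \<Longrightarrow> square_integrable M (\<lambda>\<omega>. Y n k \<omega> - D n (T k \<omega>))"
  using assms by (intro square_integrable_diff square_integrable_const finite_measure_axioms
      X_square_integrable Y_square_integrable filtered_square_integrable D_filtered_square_integrable; simp)+

lemmas deviations_integrable = deviations_square_integrable[THEN square_integrableD(2)]

lemma sum_deviations:
  assumes "k \<le> K" "I \<subseteq> {1..N}"
  shows "integrable M (\<lambda>\<omega>. \<Sum>i\<in>I. (norm (Y i k \<omega> - D i (T k \<omega>)))\<^sup>2)"
    and "(\<integral>\<omega>. (\<Sum>i\<in>I. (norm (Y i k \<omega> - D i (T k \<omega>)))\<^sup>2) \<partial>M) = (\<Sum>i\<in>I. eU \<gamma> i k)"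
  unfolding eU_def using assms
  by (auto intro!: Bochner_Integration.integral_sum Bochner_Integration.integrable_sum deviations_integrable
      simp del: One_nat_def)

lemma Vp_second_moment:
  assumes k: "k < K"
  shows "(\<integral>\<omega>. (norm (Vp k \<omega>))\<^sup>2 \<partial>M) \<le> C * eQ k"
proof -
  note i = deviations_integrable[OF less_imp_le[OF k]] sum_deviations[OF less_imp_le[OF k] order_refl]
  have "(\<integral>\<omega>. (norm (Vp k \<omega>))\<^sup>2 \<partial>M) \<le> (\<integral>\<omega>. C * ((norm (X k \<omega> - xs))\<^sup>2 + (norm (X k \<omega> - T k \<omega>))\<^sup>2
      + (\<Sum>i=1..N. (norm (Y i k \<omega> - D i (T k \<omega>)))\<^sup>2)) \<partial>M)"
  proof (rule integral_mono)
    show "integrable M (\<lambda>\<omega>. (norm (Vp k \<omega>))\<^sup>2)"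
      using Vp_square_integrable[OF k] k X_square_integrable Y_square_integrable
      by (auto intro!: square_integrableD)
  qed (use i k in \<open>auto intro!: Vp_bound integrable_mult_right simp del: One_nat_def\<close>)
  also have "\<dots> = C * eQ k"
    using i by (simp add: eW_def eP_def del: One_nat_def)
  finally show ?thesis .
qed

lemma Hp_second_moment:
  assumes k: "k < K" and n: "n \<in> {1..N}"
  shows "(\<integral>\<omega>. (norm (Hp n k \<omega>))\<^sup>2 \<partial>M) \<le> C * eQ k"
proof -
  note i = deviations_integrable[OF less_imp_le[OF k]] sum_deviations[OF less_imp_le[OF k] order_refl]
  have "(\<integral>\<omega>. (norm (Hp n k \<omega>))\<^sup>2 \<partial>M) \<le> (\<integral>\<omega>. C * ((norm (X k \<omega> - T k \<omega>))\<^sup>2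
      + (\<Sum>i=1..N. (norm (Y i k \<omega> - D i (T k \<omega>)))\<^sup>2)) \<partial>M)"
  proof (rule integral_mono)
    show "integrable M (\<lambda>\<omega>. (norm (Hp n k \<omega>))\<^sup>2)"
      using Hp_square_integrable[OF k _ _ n] k X_square_integrable Y_square_integrable
      by (auto intro!: square_integrableD)
  qed (use i k n in \<open>auto intro!: Hp_bound integrable_mult_right simp del: One_nat_def\<close>)
  also have "\<dots> = C * (eP \<gamma> k + (\<Sum>n=1..N. eU \<gamma> n k))"
    using i by (simp add: eW_def eP_def del: One_nat_def)
  also have "\<dots> \<le> C * eQ k"
    using C_ge_1 errors_nonneg(1)[of k] by simp
  finally show ?thesis .
qed

lemma eQ_nonneg: "0 \<le> eQ k"
  using errors_nonneg by (intro add_nonneg_nonneg sum_nonneg)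

text \<open>The variance may grow with the drift, which is itself bounded by the errors. The noise
  is therefore not bounded a priori, and the factor \<open>eQ k + 1\<close> has to be reabsorbed by
  the contraction later.\<close>

lemma noise_moments:
  assumes k: "k < K"
  shows "(\<integral>\<omega>. (norm (Vp k \<omega>))\<^sup>2 \<partial>M) + (\<integral>\<omega>. (norm (\<xi> k \<omega>))\<^sup>2 \<partial>M) \<le> noise_const * (eQ k + 1)"
    and "n \<in> {1..N} \<Longrightarrow>
      (\<integral>\<omega>. (norm (Hp n k \<omega>))\<^sup>2 \<partial>M) + (\<integral>\<omega>. (norm (\<psi> n k \<omega>))\<^sup>2 \<partial>M) \<le> noise_const * (eQ k + 1)"
proof -
  have si: "square_integrable M (X k)" "\<And>n. n \<in> {1..N} \<Longrightarrow> square_integrable M (Y n k)"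
    using k X_square_integrable Y_square_integrable by auto
  have CQ: "0 \<le> C * eQ k"
    using C_ge_1 eQ_nonneg by simp
  have extra: "\<sigma>\<^sup>2 \<le> noise_const" "0 \<le> \<sigma>\<^sup>2 * eQ k"
    using noise_pos C_ge_1 eQ_nonneg by (auto simp: noise_const_def)
  have collect: "(1 + a) * (C * eQ k) + \<sigma>\<^sup>2 \<le> noise_const * (eQ k + 1)"
    if "a \<le> \<omega>\<^sub>0 + \<omega>\<^sub>1 + N * \<omega>\<^sub>2" for a
  proof -
    have "(1 + a) * (C * eQ k) \<le> (1 + \<omega>\<^sub>0 + \<omega>\<^sub>1 + N * \<omega>\<^sub>2) * (C * eQ k)"
      using that CQ by (intro mult_right_mono) auto
    also have "\<dots> \<le> noise_const * eQ k"
      using extra(2) by (simp add: noise_const_def algebra_simps)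
    finally show ?thesis
      using extra(1) by (simp add: algebra_simps)
  qed
  have "\<omega>\<^sub>2 * (\<Sum>n=1..N. \<integral>\<omega>. (norm (Hp n k \<omega>))\<^sup>2 \<partial>M) \<le> \<omega>\<^sub>2 * (\<Sum>n=1..N. C * eQ k)"
    using noise_pos k by (intro mult_left_mono sum_mono Hp_second_moment) auto
  moreover have "\<omega>\<^sub>1 * (\<integral>\<omega>. (norm (Vp k \<omega>))\<^sup>2 \<partial>M) \<le> \<omega>\<^sub>1 * (C * eQ k)"
    using noise_pos k by (intro mult_left_mono Vp_second_moment) auto
  ultimately have "(\<integral>\<omega>. (norm (Vp k \<omega>))\<^sup>2 \<partial>M) + (\<integral>\<omega>. (norm (\<xi> k \<omega>))\<^sup>2 \<partial>M)
      \<le> (1 + (\<omega>\<^sub>1 + N * \<omega>\<^sub>2)) * (C * eQ k) + \<sigma>\<^sup>2"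
    using Vp_second_moment[OF k] \<xi>_second_moment(2)[OF k si] by (simp add: algebra_simps)
  also have "\<dots> \<le> noise_const * (eQ k + 1)"
    using noise_pos by (intro collect) auto
  finally show "(\<integral>\<omega>. (norm (Vp k \<omega>))\<^sup>2 \<partial>M) + (\<integral>\<omega>. (norm (\<xi> k \<omega>))\<^sup>2 \<partial>M) \<le> noise_const * (eQ k + 1)" .
  assume n: "n \<in> {1..N}"
  have "\<omega>\<^sub>0 * (\<integral>\<omega>. (norm (Hp n k \<omega>))\<^sup>2 \<partial>M) \<le> \<omega>\<^sub>0 * (C * eQ k)"
    using noise_pos k n by (intro mult_left_mono Hp_second_moment) auto
  hence "(\<integral>\<omega>. (norm (Hp n k \<omega>))\<^sup>2 \<partial>M) + (\<integral>\<omega>. (norm (\<psi> n k \<omega>))\<^sup>2 \<partial>M) \<le> (1 + \<omega>\<^sub>0) * (C * eQ k) + \<sigma>\<^sup>2"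
    using Hp_second_moment[OF k n] \<psi>_second_moment(2)[OF k si n] by (simp add: distrib_right)
  also have "\<dots> \<le> noise_const * (eQ k + 1)"
    using noise_pos by (intro collect) auto
  finally show "(\<integral>\<omega>. (norm (Hp n k \<omega>))\<^sup>2 \<partial>M) + (\<integral>\<omega>. (norm (\<psi> n k \<omega>))\<^sup>2 \<partial>M) \<le> noise_const * (eQ k + 1)" .
qed

lemma noise_orthogonal:
  assumes k: "k < K"
  shows "f \<in> borel_measurable (history N M X Y k) \<Longrightarrow> square_integrable M f \<Longrightarrow> (\<integral>\<omega>. f \<omega> \<bullet> \<xi> k \<omega> \<partial>M) = 0"
    and "n \<in> {1..N} \<Longrightarrow> g \<in> borel_measurable (history N M X Y k) \<Longrightarrow> square_integrable M g \<Longrightarrow>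
      (\<integral>\<omega>. g \<omega> \<bullet> \<psi> n k \<omega> \<partial>M) = 0"
proof -
  interpret F: sigma_finite_subalgebra M "history N M X Y k"
    using k by (intro history_sigma_finite) simp
  have si: "square_integrable M (X k)" "\<And>n. n \<in> {1..N} \<Longrightarrow> square_integrable M (Y n k)"
    using k X_square_integrable Y_square_integrable by auto
  show "f \<in> borel_measurable (history N M X Y k) \<Longrightarrow> square_integrable M f \<Longrightarrow> (\<integral>\<omega>. f \<omega> \<bullet> \<xi> k \<omega> \<partial>M) = 0"
    by (rule F.orthogonal_if_vec_cond_exp_zero) (use \<xi>_second_moment[OF k si] \<xi>_centered[OF k] in auto)
  show "n \<in> {1..N} \<Longrightarrow> g \<in> borel_measurable (history N M X Y k) \<Longrightarrow> square_integrable M g \<Longrightarrow>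
      (\<integral>\<omega>. g \<omega> \<bullet> \<psi> n k \<omega> \<partial>M) = 0"
    by (rule F.orthogonal_if_vec_cond_exp_zero) (use \<psi>_second_moment[OF k si] \<psi>_centered[OF k] in auto)
qed

text \<open>The decisive item is \<open>T (Suc k)\<close>: deviations from the filter after its move
  are still orthogonal to the noise of step \<open>k\<close>.\<close>

lemma history_measurable:
  shows "X k \<in> borel_measurable (history N M X Y k)" "T k \<in> borel_measurable (history N M X Y k)"
    "T (Suc k) \<in> borel_measurable (history N M X Y k)"
    "n \<in> {1..N} \<Longrightarrow> Y n k \<in> borel_measurable (history N M X Y k)"
proof -
  show X: "X k \<in> borel_measurable (history N M X Y k)" and T: "T k \<in> borel_measurable (history N M X Y k)"
    and "n \<in> {1..N} \<Longrightarrow> Y n k \<in> borel_measurable (history N M X Y k)"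
    by (auto intro!: borel_measurable_filtered borel_measurable_history)
  show "T (Suc k) \<in> borel_measurable (history N M X Y k)"
    using X T by simp
qed

lemma eW_step:
  assumes k: "k < K"
  shows "eW (Suc k) \<le> (1 - 2 * \<alpha> k / C) * eW k + 2 * \<alpha> k * C * (eP \<gamma> k + (\<Sum>n=1..N. eU \<gamma> n k))
    + 2 * (\<alpha> k)\<^sup>2 * (noise_const * (eQ k + 1))"
proof -
  note kK = less_imp_le[OF k]
  note i = deviations_integrable[OF kK] sum_deviations[OF kK order_refl]
  have si: "square_integrable M (X k)" "\<And>n. n \<in> {1..N} \<Longrightarrow> square_integrable M (Y n k)"
    using kK X_square_integrable Y_square_integrable by auto
  let ?b = "\<lambda>\<omega>. (1 - 2 * \<alpha> k / C) * (norm (X k \<omega> - xs))\<^sup>2 + 2 * \<alpha> k * C * ((norm (X k \<omega> - T k \<omega>))\<^sup>2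
      + (\<Sum>i=1..N. (norm (Y i k \<omega> - D i (T k \<omega>)))\<^sup>2))"
  have "eW (Suc k) = (\<integral>\<omega>. (norm ((X k \<omega> - xs) - \<alpha> k *\<^sub>R (Vp k \<omega> + \<xi> k \<omega>)))\<^sup>2 \<partial>M)"
    unfolding eW_def by (intro Bochner_Integration.integral_cong) (auto simp: X_Suc[OF k] algebra_simps)
  also have "\<dots> \<le> (\<integral>\<omega>. ?b \<omega> \<partial>M)
      + 2 * (\<alpha> k)\<^sup>2 * ((\<integral>\<omega>. (norm (Vp k \<omega>))\<^sup>2 \<partial>M) + (\<integral>\<omega>. (norm (\<xi> k \<omega>))\<^sup>2 \<partial>M))"
  proof (rule mean_square_step)
    show "(\<integral>\<omega>. (X k \<omega> - xs) \<bullet> \<xi> k \<omega> \<partial>M) = 0"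
      using history_measurable(1)[of k] deviations_square_integrable(1)[OF kK]
      by (intro noise_orthogonal k) auto
    show "integrable M ?b"
      using i by (auto intro!: integrable_mult_right simp del: One_nat_def)
    fix \<omega> assume \<omega>: "\<omega> \<in> space M"
    have "2 * \<alpha> k * ((norm (X k \<omega> - xs))\<^sup>2 / C) \<le> 2 * \<alpha> k * (Vp k \<omega> \<bullet> (X k \<omega> - xs)
      + C * ((norm (X k \<omega> - T k \<omega>))\<^sup>2 + (\<Sum>i=1..N. (norm (Y i k \<omega> - D i (T k \<omega>)))\<^sup>2)))"
      using step_pos(1)[OF k] by (intro mult_left_mono Vp_coercive kK \<omega>) auto
    thus "(norm (X k \<omega> - xs))\<^sup>2 - 2 * \<alpha> k * (Vp k \<omega> \<bullet> (X k \<omega> - xs)) \<le> ?b \<omega>"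
      by (simp add: algebra_simps)
  qed (use deviations_square_integrable[OF kK] Vp_square_integrable[OF k si] \<xi>_second_moment[OF k si] in auto)
  also have "(\<integral>\<omega>. ?b \<omega> \<partial>M) = (1 - 2 * \<alpha> k / C) * eW k + 2 * \<alpha> k * C * (eP \<gamma> k + (\<Sum>n=1..N. eU \<gamma> n k))"
    using i by (simp add: eW_def eP_def del: One_nat_def)
  finally show ?thesis
    by (rule order_trans[OF _ add_left_mono[OF mult_left_mono[OF noise_moments(1)[OF k]]]]) simp
qed

text \<open>The filter is moved first: \<open>X k - T (Suc k)\<close> is known at time
  \<open>k\<close>, and the update of \<open>X\<close> then adds drift and centred noise to it, as
  \<open>mean_square_step\<close> requires.\<close>

lemma eP_step:
  assumes k: "k < K" and \<gamma>: "0 < \<gamma>" "\<gamma> \<le> 1"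
  shows "eP \<gamma> (Suc k) \<le> (1 - \<gamma> + \<gamma>\<^sup>2) * eP \<gamma> k + (\<alpha> k)\<^sup>2 / \<gamma> * C * eQ k
    + 2 * (\<alpha> k)\<^sup>2 * (noise_const * (eQ k + 1))"
proof -
  note kK = less_imp_le[OF k]
  note i = deviations_integrable[OF kK] sum_deviations[OF kK order_refl]
  have si: "square_integrable M (X k)" "\<And>n. n \<in> {1..N} \<Longrightarrow> square_integrable M (Y n k)"
    using kK X_square_integrable Y_square_integrable by auto
  let ?g = "\<lambda>\<omega>. X k \<omega> - T (Suc k) \<omega>"
  have g: "?g = (\<lambda>\<omega>. (1 - \<gamma>) *\<^sub>R (X k \<omega> - T k \<omega>))"
    by (auto simp: algebra_simps)
  let ?b = "\<lambda>\<omega>. (1 - \<gamma> + \<gamma>\<^sup>2) * (norm (X k \<omega> - T k \<omega>))\<^sup>2 + (\<alpha> k)\<^sup>2 / \<gamma> * (norm (Vp k \<omega>))\<^sup>2"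
  note iV = square_integrableD(2)[OF Vp_square_integrable[OF k si]]
  have g_si: "square_integrable M ?g"
    unfolding g using deviations_square_integrable(2)[OF kK] by (rule square_integrable_scaleR)
  have "eP \<gamma> (Suc k) = (\<integral>\<omega>. (norm (?g \<omega> - \<alpha> k *\<^sub>R (Vp k \<omega> + \<xi> k \<omega>)))\<^sup>2 \<partial>M)"
    unfolding eP_def by (intro Bochner_Integration.integral_cong) (auto simp: X_Suc[OF k] algebra_simps)
  also have "\<dots> \<le> (\<integral>\<omega>. ?b \<omega> \<partial>M)
      + 2 * (\<alpha> k)\<^sup>2 * ((\<integral>\<omega>. (norm (Vp k \<omega>))\<^sup>2 \<partial>M) + (\<integral>\<omega>. (norm (\<xi> k \<omega>))\<^sup>2 \<partial>M))"
  proof (rule mean_square_step[OF g_si])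
    show "(\<integral>\<omega>. ?g \<omega> \<bullet> \<xi> k \<omega> \<partial>M) = 0"
      using history_measurable(1,3)[of k] g_si
      by (intro noise_orthogonal k) (auto simp del: filtered.simps)
    show "integrable M ?b"
      using i iV by (auto intro!: integrable_mult_right)
    fix \<omega> assume \<omega>: "\<omega> \<in> space M"
    have g\<omega>: "?g \<omega> = (1 - \<gamma>) *\<^sub>R (X k \<omega> - T k \<omega>)"
      using fun_cong[OF g] .
    show "(norm (?g \<omega>))\<^sup>2 - 2 * \<alpha> k * (Vp k \<omega> \<bullet> ?g \<omega>) \<le> ?b \<omega>"
      unfolding g\<omega> using step_pos(1)[OF k] by (intro filter_drift \<gamma>) auto
  qed (use Vp_square_integrable[OF k si] \<xi>_second_moment[OF k si] in auto)
  also have "(\<integral>\<omega>. ?b \<omega> \<partial>M) = (1 - \<gamma> + \<gamma>\<^sup>2) * eP \<gamma> k + (\<alpha> k)\<^sup>2 / \<gamma> * (\<integral>\<omega>. (norm (Vp k \<omega>))\<^sup>2 \<partial>M)"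
    using i iV by (simp add: eP_def)
  finally show ?thesis
  proof (rule order_trans)
    have "(\<alpha> k)\<^sup>2 / \<gamma> * (\<integral>\<omega>. (norm (Vp k \<omega>))\<^sup>2 \<partial>M) \<le> (\<alpha> k)\<^sup>2 / \<gamma> * C * eQ k"
      unfolding mult.assoc[of _ C] using \<gamma> by (intro mult_left_mono Vp_second_moment k) auto
    thus "(1 - \<gamma> + \<gamma>\<^sup>2) * eP \<gamma> k + (\<alpha> k)\<^sup>2 / \<gamma> * (\<integral>\<omega>. (norm (Vp k \<omega>))\<^sup>2 \<partial>M)
        + 2 * (\<alpha> k)\<^sup>2 * ((\<integral>\<omega>. (norm (Vp k \<omega>))\<^sup>2 \<partial>M) + (\<integral>\<omega>. (norm (\<xi> k \<omega>))\<^sup>2 \<partial>M))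
      \<le> (1 - \<gamma> + \<gamma>\<^sup>2) * eP \<gamma> k + (\<alpha> k)\<^sup>2 / \<gamma> * C * eQ k + 2 * (\<alpha> k)\<^sup>2 * (noise_const * (eQ k + 1))"
      by (intro add_mono order_refl mult_left_mono noise_moments(1) k) auto
  qed
qed

text \<open>The target is moved first, which shifts the tracking error by a displacement known at
  time \<open>k\<close>. Had the target been \<open>y_diamond\<close> at the new \<open>X\<close>,
  the shift would contain the noise of the step.\<close>

lemma eU_step:
  assumes k: "k < K" and n: "n \<in> {1..N}" and \<gamma>: "0 < \<gamma>" "\<gamma> \<le> \<beta> n k" "\<beta> n k \<le> R * \<gamma>"
  shows "eU \<gamma> n (Suc k) \<le> (1 - \<gamma> / C) * eU \<gamma> n k
    + \<gamma> * (C^3 + 2 * R * C) * (eP \<gamma> k + (\<Sum>i\<in>{1..<n}. eU \<gamma> i k))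
    + 2 * C\<^sup>2 * \<gamma>\<^sup>2 * eP \<gamma> k + (\<beta> n k)\<^sup>2 * C * (eP \<gamma> k + (\<Sum>i=1..N. eU \<gamma> i k))
    + 2 * (\<beta> n k)\<^sup>2 * (noise_const * (eQ k + 1))"
proof -
  note kK = less_imp_le[OF k]
  have sub: "{1..<n} \<subseteq> {1..N}"
    using n by auto
  note i = deviations_integrable[OF kK] sum_deviations[OF kK order_refl] sum_deviations[OF kK sub]
  have si: "square_integrable M (X k)" "\<And>n. n \<in> {1..N} \<Longrightarrow> square_integrable M (Y n k)"
    using kK X_square_integrable Y_square_integrable by auto
  let ?g = "\<lambda>\<omega>. Y n k \<omega> - D n (T (Suc k) \<omega>)"
  let ?S = "\<lambda>\<omega> I. (norm (X k \<omega> - T k \<omega>))\<^sup>2 + (\<Sum>i\<in>I. (norm (Y i k \<omega> - D i (T k \<omega>)))\<^sup>2)"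
  let ?b = "\<lambda>\<omega>. (1 - \<gamma> / C) * (norm (Y n k \<omega> - D n (T k \<omega>)))\<^sup>2 + \<gamma> * (C^3 + 2 * R * C) * ?S \<omega> {1..<n}
    + 2 * C\<^sup>2 * \<gamma>\<^sup>2 * (norm (X k \<omega> - T k \<omega>))\<^sup>2 + (\<beta> n k)\<^sup>2 * C * ?S \<omega> {1..N}"
  have g_si: "square_integrable M ?g"
    using k by (intro square_integrable_diff Y_square_integrable D_filtered_square_integrable n) auto
  have "eU \<gamma> n (Suc k) = (\<integral>\<omega>. (norm (?g \<omega> - \<beta> n k *\<^sub>R (Hp n k \<omega> + \<psi> n k \<omega>)))\<^sup>2 \<partial>M)"
    unfolding eU_def
    by (intro Bochner_Integration.integral_cong) (auto simp: Y_Suc[OF k _ n] algebra_simps simp del: filtered.simps)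
  also have "\<dots> \<le> (\<integral>\<omega>. ?b \<omega> \<partial>M)
      + 2 * (\<beta> n k)\<^sup>2 * ((\<integral>\<omega>. (norm (Hp n k \<omega>))\<^sup>2 \<partial>M) + (\<integral>\<omega>. (norm (\<psi> n k \<omega>))\<^sup>2 \<partial>M))"
  proof (rule mean_square_step[OF g_si])
    show "(\<integral>\<omega>. ?g \<omega> \<bullet> \<psi> n k \<omega> \<partial>M) = 0"
      using history_measurable(4)[OF n, of k] measurable_compose[OF history_measurable(3) D_measurable[OF n], of k] g_si
      by (intro noise_orthogonal k n) (auto simp del: filtered.simps)
    show "integrable M ?b"
      using i n by (auto intro!: integrable_mult_right Bochner_Integration.integrable_add simp del: One_nat_def)
    fix \<omega> assume \<omega>: "\<omega> \<in> space M"
    have g\<omega>: "?g \<omega> = (Y n k \<omega> - D n (T k \<omega>)) + (D n (T k \<omega>) - D n (T (Suc k) \<omega>))"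
      by simp
    show "(norm (?g \<omega>))\<^sup>2 - 2 * \<beta> n k * (Hp n k \<omega> \<bullet> ?g \<omega>) \<le> ?b \<omega>"
      unfolding g\<omega>
    proof (rule tracking_drift[OF C_ge_1 \<gamma>])
      show "norm (D n (T k \<omega>) - D n (T (Suc k) \<omega>)) \<le> C * \<gamma> * norm (X k \<omega> - T k \<omega>)"
        using diamond_lipschitz[OF n, of "T k \<omega>" "T (Suc k) \<omega>"] \<gamma>(1) by (simp add: mult.assoc)
      show "(norm (X k \<omega> - T k \<omega>))\<^sup>2 \<le> ?S \<omega> {1..<n}"
        by (simp add: sum_nonneg)
    qed (use Hp_coercive[OF kK \<omega> n] Hp_bound[OF kK \<omega> n] in auto)
  qed (use Hp_square_integrable[OF k si n] \<psi>_second_moment[OF k si n] in auto)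
  also have "(\<integral>\<omega>. ?b \<omega> \<partial>M) = (1 - \<gamma> / C) * eU \<gamma> n k
    + \<gamma> * (C^3 + 2 * R * C) * (eP \<gamma> k + (\<Sum>i\<in>{1..<n}. eU \<gamma> i k))
    + 2 * C\<^sup>2 * \<gamma>\<^sup>2 * eP \<gamma> k + (\<beta> n k)\<^sup>2 * C * (eP \<gamma> k + (\<Sum>i=1..N. eU \<gamma> i k))"
    using i n by (simp add: eP_def eU_def del: One_nat_def)
  finally show ?thesis
    by (rule order_trans[OF _ add_left_mono[OF mult_left_mono[OF noise_moments(2)[OF k n]]]]) simp
qed

end

end

section \<open>Convergence rate\<close>

context mssa_process
begin

text \<open>All terms of second order are merged into one \<open>E\<close> for the three errors, to
  match the form of \<open>contracting_weights\<close>.\<close>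

lemma error_recursion:
  assumes k: "k < K" and \<gamma>: "0 < \<gamma>" "\<gamma> \<le> 1" and \<alpha>: "\<alpha> k \<le> \<gamma>"
    and \<beta>: "\<And>n. n \<in> {1..N} \<Longrightarrow> \<gamma> \<le> \<beta> n k \<and> \<beta> n k \<le> R * \<gamma>" and "1 \<le> R"
  defines "E \<equiv> \<gamma>\<^sup>2 * (1 + 2 * C\<^sup>2 + R\<^sup>2 * C + 2 * R\<^sup>2 * noise_const) * (eQ \<gamma> k + 1)"
  shows "eW (Suc k) \<le> (1 - 2 * \<alpha> k / C) * eW k + 2 * \<alpha> k * C * (eP \<gamma> k + (\<Sum>n=1..N. eU \<gamma> n k)) + E"
    and "eP \<gamma> (Suc k) \<le> (1 - \<gamma>) * eP \<gamma> k + (\<alpha> k)\<^sup>2 / \<gamma> * C * eQ \<gamma> k + E"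
    and "n \<in> {1..N} \<Longrightarrow> eU \<gamma> n (Suc k) \<le> (1 - \<gamma> / C) * eU \<gamma> n k
      + \<gamma> * (C^3 + 2 * R * C) * (eP \<gamma> k + (\<Sum>i\<in>{1..<n}. eU \<gamma> i k)) + E"
proof -
  define Q where "Q = eQ \<gamma> k"
  have Q: "0 \<le> Q" "eP \<gamma> k \<le> Q" "eP \<gamma> k + (\<Sum>i=1..N. eU \<gamma> i k) \<le> Q"
    using errors_nonneg eQ_nonneg by (auto simp: Q_def sum_nonneg)
  have nn: "0 \<le> noise_const * (Q + 1)"
    using noise_const_nonneg Q by simp
  have "(\<alpha> k)\<^sup>2 \<le> \<gamma>\<^sup>2"
    using \<alpha> step_pos(1)[OF k] by (intro power_mono) auto
  also have "\<gamma>\<^sup>2 \<le> R\<^sup>2 * \<gamma>\<^sup>2"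
    using \<open>1 \<le> R\<close> mult_right_mono[of 1 "R\<^sup>2" "\<gamma>\<^sup>2"] by (simp add: one_le_power)
  finally have "2 * (\<alpha> k)\<^sup>2 * (noise_const * (Q + 1)) \<le> 2 * (R\<^sup>2 * \<gamma>\<^sup>2) * (noise_const * (Q + 1))"
    using nn by (intro mult_right_mono) auto
  hence noise_\<alpha>: "2 * (\<alpha> k)\<^sup>2 * (noise_const * (Q + 1)) \<le> \<gamma>\<^sup>2 * (2 * R\<^sup>2 * noise_const) * (Q + 1)"
    by (simp add: mult_ac)
  have E: "E = \<gamma>\<^sup>2 * (1 * (Q + 1)) + \<gamma>\<^sup>2 * (2 * C\<^sup>2 * (Q + 1)) + \<gamma>\<^sup>2 * (R\<^sup>2 * C * (Q + 1))
      + \<gamma>\<^sup>2 * (2 * R\<^sup>2 * noise_const) * (Q + 1)"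
    by (simp add: E_def Q_def algebra_simps)
  have E_parts: "0 \<le> \<gamma>\<^sup>2 * (1 * (Q + 1))" "0 \<le> \<gamma>\<^sup>2 * (2 * C\<^sup>2 * (Q + 1))" "0 \<le> \<gamma>\<^sup>2 * (R\<^sup>2 * C * (Q + 1))"
    using Q C_ge_1 by auto
  show "eW (Suc k) \<le> (1 - 2 * \<alpha> k / C) * eW k + 2 * \<alpha> k * C * (eP \<gamma> k + (\<Sum>n=1..N. eU \<gamma> n k)) + E"
    using eW_step[OF k, of \<gamma>] noise_\<alpha> E_parts unfolding E Q_def[symmetric] by linarith
  have "\<gamma>\<^sup>2 * eP \<gamma> k \<le> \<gamma>\<^sup>2 * (1 * (Q + 1))"
    using Q by (intro mult_left_mono) auto
  moreover have "(1 - \<gamma> + \<gamma>\<^sup>2) * eP \<gamma> k = (1 - \<gamma>) * eP \<gamma> k + \<gamma>\<^sup>2 * eP \<gamma> k"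
    by (simp add: algebra_simps)
  ultimately show "eP \<gamma> (Suc k) \<le> (1 - \<gamma>) * eP \<gamma> k + (\<alpha> k)\<^sup>2 / \<gamma> * C * eQ \<gamma> k + E"
    using eP_step[OF k \<gamma>] noise_\<alpha> E_parts unfolding E Q_def[symmetric] by linarith
  assume n: "n \<in> {1..N}"
  have "(\<beta> n k)\<^sup>2 \<le> (R * \<gamma>)\<^sup>2"
    using \<beta>[OF n] \<gamma> by (intro power_mono) auto
  hence \<beta>2: "(\<beta> n k)\<^sup>2 \<le> R\<^sup>2 * \<gamma>\<^sup>2"
    by (simp add: power_mult_distrib)
  have "2 * (\<beta> n k)\<^sup>2 * (noise_const * (Q + 1)) \<le> 2 * (R\<^sup>2 * \<gamma>\<^sup>2) * (noise_const * (Q + 1))"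
    using nn \<beta>2 by (intro mult_right_mono) auto
  hence noise_\<beta>: "2 * (\<beta> n k)\<^sup>2 * (noise_const * (Q + 1)) \<le> \<gamma>\<^sup>2 * (2 * R\<^sup>2 * noise_const) * (Q + 1)"
    by (simp add: mult_ac)
  have "(\<beta> n k)\<^sup>2 * (C * (eP \<gamma> k + (\<Sum>i=1..N. eU \<gamma> i k))) \<le> (R\<^sup>2 * \<gamma>\<^sup>2) * (C * (Q + 1))"
    using \<beta>2 Q C_ge_1 errors_nonneg
    by (intro mult_mono mult_nonneg_nonneg add_nonneg_nonneg sum_nonneg) auto
  hence b: "(\<beta> n k)\<^sup>2 * C * (eP \<gamma> k + (\<Sum>i=1..N. eU \<gamma> i k)) \<le> \<gamma>\<^sup>2 * (R\<^sup>2 * C * (Q + 1))"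
    by (simp add: mult_ac)
  have "(2 * C\<^sup>2 * \<gamma>\<^sup>2) * eP \<gamma> k \<le> (2 * C\<^sup>2 * \<gamma>\<^sup>2) * (Q + 1)"
    using Q by (intro mult_left_mono) auto
  hence p: "2 * C\<^sup>2 * \<gamma>\<^sup>2 * eP \<gamma> k \<le> \<gamma>\<^sup>2 * (2 * C\<^sup>2 * (Q + 1))"
    by (simp add: mult_ac)
  show "eU \<gamma> n (Suc k) \<le> (1 - \<gamma> / C) * eU \<gamma> n k
      + \<gamma> * (C^3 + 2 * R * C) * (eP \<gamma> k + (\<Sum>i\<in>{1..<n}. eU \<gamma> i k)) + E"
    using eU_step[OF k n \<gamma>(1), of R] \<beta>[OF n] noise_\<beta> b p E_parts unfolding E Q_def[symmetric] by linarith
qed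

section \<open>Errors at the first and the last iterate\<close>

lemma initial_errors:
  assumes "(\<integral>\<omega>. (norm (X 0 \<omega>))\<^sup>2 \<partial>M) \<le> B" "n \<in> {1..N} \<Longrightarrow> (\<integral>\<omega>. (norm (Y n 0 \<omega>))\<^sup>2 \<partial>M) \<le> B"
  shows "eW 0 \<le> 2 * B + 2 * (norm xs)\<^sup>2" and "eP \<gamma> 0 = 0"
    and "n \<in> {1..N} \<Longrightarrow> eU \<gamma> n 0 \<le> 2 * B + 4 * (norm (D n 0))\<^sup>2 + 4 * C\<^sup>2 * B"
proof -
  show "eP \<gamma> 0 = 0"
    by (simp add: eP_def)
  have "eW 0 \<le> (\<integral>\<omega>. 2 * (norm (X 0 \<omega>))\<^sup>2 + 2 * (norm xs)\<^sup>2 \<partial>M)"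
    unfolding eW_def
  proof (rule integral_mono)
    show "integrable M (\<lambda>\<omega>. (norm (X 0 \<omega> - xs))\<^sup>2)"
      by (rule deviations_integrable) simp
    show "(norm (X 0 \<omega> - xs))\<^sup>2 \<le> 2 * (norm (X 0 \<omega>))\<^sup>2 + 2 * (norm xs)\<^sup>2" for \<omega>
      using norm_add_square_le[of "X 0 \<omega>" "- xs"] by simp
  qed (use initial in simp)
  thus "eW 0 \<le> 2 * B + 2 * (norm xs)\<^sup>2"
    using initial assms by (simp add: prob_space)
  assume n: "n \<in> {1..N}"
  have "eU \<gamma> n 0 \<le> (\<integral>\<omega>. 2 * (norm (Y n 0 \<omega>))\<^sup>2 + (4 * (norm (D n 0))\<^sup>2 + 4 * C\<^sup>2 * (norm (X 0 \<omega>))\<^sup>2) \<partial>M)"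
    unfolding eU_def
  proof (rule integral_mono)
    show "integrable M (\<lambda>\<omega>. (norm (Y n 0 \<omega> - D n (filtered \<gamma> X 0 \<omega>)))\<^sup>2)"
      by (rule deviations_integrable) (use n in simp_all)
    fix \<omega>
    have "norm (D n (X 0 \<omega>) - D n 0) \<le> C * norm (X 0 \<omega>)"
      using diamond_lipschitz[OF n, of "X 0 \<omega>" 0] by simp
    hence "(norm (D n (X 0 \<omega>) - D n 0))\<^sup>2 \<le> C\<^sup>2 * (norm (X 0 \<omega>))\<^sup>2"
      using power_mono[of "norm (D n (X 0 \<omega>) - D n 0)" "C * norm (X 0 \<omega>)" 2] by (simp add: power_mult_distrib)
    thus "(norm (Y n 0 \<omega> - D n (filtered \<gamma> X 0 \<omega>)))\<^sup>2
        \<le> 2 * (norm (Y n 0 \<omega>))\<^sup>2 + (4 * (norm (D n 0))\<^sup>2 + 4 * C\<^sup>2 * (norm (X 0 \<omega>))\<^sup>2)"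
      using norm_add_square_le[of "Y n 0 \<omega>" "- D n (X 0 \<omega>)"] norm_add_square_le[of "D n 0" "D n (X 0 \<omega>) - D n 0"]
      by simp
  qed (use initial n in simp)
  also have "\<dots> = 2 * (\<integral>\<omega>. (norm (Y n 0 \<omega>))\<^sup>2 \<partial>M) + (4 * (norm (D n 0))\<^sup>2 + 4 * C\<^sup>2 * (\<integral>\<omega>. (norm (X 0 \<omega>))\<^sup>2 \<partial>M))"
    using initial n by (simp add: prob_space)
  also have "\<dots> \<le> 2 * B + (4 * (norm (D n 0))\<^sup>2 + 4 * C\<^sup>2 * B)"
    using assms n by (intro add_mono mult_left_mono order_refl) auto
  finally show "eU \<gamma> n 0 \<le> 2 * B + 4 * (norm (D n 0))\<^sup>2 + 4 * C\<^sup>2 * B"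
    by simp
qed

lemma final_star_gap:
  assumes n: "n \<in> {1..N}"
  shows "integrable M (\<lambda>\<omega>. (norm (Y n K \<omega> - y_star V h n (X K \<omega>) (\<lambda>i\<in>{1..<n}. Y i K \<omega>)))\<^sup>2)"
    and "(\<integral>\<omega>. (norm (Y n K \<omega> - y_star V h n (X K \<omega>) (\<lambda>i\<in>{1..<n}. Y i K \<omega>)))\<^sup>2 \<partial>M) \<le> 4 * C\<^sup>2 * eQ \<gamma> K"
proof -
  note i = deviations_integrable[OF order_refl] sum_deviations[OF order_refl order_refl]
  let ?s = "\<lambda>\<omega>. y_star V h n (X K \<omega>) (\<lambda>i\<in>{1..<n}. Y i K \<omega>)"
  let ?b = "\<lambda>\<omega>. C * ((norm (X K \<omega> - filtered \<gamma> X K \<omega>))\<^sup>2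
      + (\<Sum>i=1..N. (norm (Y i K \<omega> - D i (filtered \<gamma> X K \<omega>)))\<^sup>2))"
  have b: "integrable M ?b"
    using i by (auto intro!: integrable_mult_right simp del: One_nat_def)
  have le: "(norm (Y n K \<omega> - ?s \<omega>))\<^sup>2 \<le> ?b \<omega>" if "\<omega> \<in> space M" for \<omega>
    by (rule Yp_gap[OF order_refl that n])
  have "?s \<in> borel_measurable M"
  proof (rule borel_measurable_lipschitz_tuple[where V = V and c = C and \<phi> = "y_star V h n"
        and X = "X K" and Y = "\<lambda>i. Y i K"])
    show "Y i K \<in> borel_measurable M" if "i \<in> {1..<n}" for i
      using Y_measurable[OF order_refl, of i] that n by simp
    show "Y i K \<omega> \<in> V i" if "i \<in> {1..<n}" "\<omega> \<in> space M" for i \<omega>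
      using Y_in[OF order_refl that(2), of i] that n by simp
  qed (simp, erule (1) star_lipschitz[OF n], rule X_measurable[OF order_refl])
  hence "square_integrable M (\<lambda>\<omega>. Y n K \<omega> - ?s \<omega>)"
    using Y_measurable[OF order_refl n] by (intro square_integrable_bound[OF _ b] le) auto
  thus int: "integrable M (\<lambda>\<omega>. (norm (Y n K \<omega> - ?s \<omega>))\<^sup>2)"
    by (rule square_integrableD)
  have "(\<integral>\<omega>. (norm (Y n K \<omega> - ?s \<omega>))\<^sup>2 \<partial>M) \<le> (\<integral>\<omega>. ?b \<omega> \<partial>M)"
    by (intro integral_mono int b le)
  also have "\<dots> = C * (eP \<gamma> K + (\<Sum>n=1..N. eU \<gamma> n K))"
    using i by (simp add: eP_def del: One_nat_def)
  also have "\<dots> \<le> 4 * C\<^sup>2 * eQ \<gamma> K"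
  \<comment> \<open>The constant is weakened to the one of the diamond gap, so that both claims end
    in the same bound.\<close>
  proof (rule mult_mono)
    show "C \<le> 4 * C\<^sup>2"
      using C_ge_1 mult_mono[of 1 C C C] by (simp add: power2_eq_square)
  qed (use errors_nonneg C_ge_1 in \<open>auto intro!: add_nonneg_nonneg sum_nonneg\<close>)
  finally show "(\<integral>\<omega>. (norm (Y n K \<omega> - ?s \<omega>))\<^sup>2 \<partial>M) \<le> 4 * C\<^sup>2 * eQ \<gamma> K" .
qed

text \<open>The comparison passes through the diamond of the filter, whose distance from
  \<open>xs\<close> is at most that of \<open>X K\<close> plus the delay. The second rate is thus
  read off the Lyapunov errors directly and not from the first rate.\<close>

lemma final_diamond_gap:
  assumes n: "n \<in> {1..N}"
  shows "integrable M (\<lambda>\<omega>. (norm (Y n K \<omega> - D n xs))\<^sup>2)"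
    and "(\<integral>\<omega>. (norm (Y n K \<omega> - D n xs))\<^sup>2 \<partial>M) \<le> 4 * C\<^sup>2 * eQ \<gamma> K"
proof -
  note i = deviations_integrable[OF order_refl] sum_deviations[OF order_refl order_refl]
  let ?t = "filtered \<gamma> X K"
  let ?b = "\<lambda>\<omega>. 4 * C\<^sup>2 * ((norm (X K \<omega> - xs))\<^sup>2 + (norm (X K \<omega> - ?t \<omega>))\<^sup>2 + (norm (Y n K \<omega> - D n (?t \<omega>)))\<^sup>2)"
  show int: "integrable M (\<lambda>\<omega>. (norm (Y n K \<omega> - D n xs))\<^sup>2)"
    using Y_square_integrable[OF order_refl n]
    by (intro square_integrableD(2) square_integrable_diff square_integrable_const finite_measure_axioms)
  have "(\<integral>\<omega>. (norm (Y n K \<omega> - D n xs))\<^sup>2 \<partial>M) \<le> (\<integral>\<omega>. ?b \<omega> \<partial>M)"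
  proof (rule integral_mono[OF int])
    show "integrable M ?b"
      using i n by auto
    fix \<omega>
    let ?w = "X K \<omega> - xs" and ?p = "X K \<omega> - ?t \<omega>" and ?u = "Y n K \<omega> - D n (?t \<omega>)"
    have "(norm (D n (?t \<omega>) - D n xs))\<^sup>2 \<le> C\<^sup>2 * (norm (?t \<omega> - xs))\<^sup>2"
      using power_mono[OF diamond_lipschitz[OF n, of "?t \<omega>" xs], of 2] by (simp add: power_mult_distrib)
    also have "\<dots> \<le> C\<^sup>2 * (2 * (norm ?w)\<^sup>2 + 2 * (norm ?p)\<^sup>2)"
      using norm_add_square_le[of ?w "- ?p"] by (intro mult_left_mono) (auto simp: norm_minus_commute)
    finally have "(norm (Y n K \<omega> - D n xs))\<^sup>2 \<le> 2 * (norm ?u)\<^sup>2 + 2 * (C\<^sup>2 * (2 * (norm ?w)\<^sup>2 + 2 * (norm ?p)\<^sup>2))"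
      using norm_add_square_le[of ?u "D n (?t \<omega>) - D n xs"] by simp
    also have "2 * (norm ?u)\<^sup>2 \<le> 4 * C\<^sup>2 * (norm ?u)\<^sup>2"
      using one_le_power[OF C_ge_1, of 2] by (intro mult_right_mono) auto
    finally show "(norm (Y n K \<omega> - D n xs))\<^sup>2 \<le> ?b \<omega>"
      by (simp add: algebra_simps)
  qed
  also have "\<dots> = 4 * C\<^sup>2 * (eW K + eP \<gamma> K + eU \<gamma> n K)"
    using i n by (simp add: eW_def eP_def eU_def)
  also have "\<dots> \<le> 4 * C\<^sup>2 * eQ \<gamma> K"
    using n errors_nonneg by (intro mult_left_mono add_left_mono member_le_sum) auto
  finally show "(\<integral>\<omega>. (norm (Y n K \<omega> - D n xs))\<^sup>2 \<partial>M) \<le> 4 * C\<^sup>2 * eQ \<gamma> K" .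
qed

lemma final_errors:
  shows "(\<integral>\<omega>. (norm (X K \<omega> - xs))\<^sup>2 \<partial>M)
      + (\<Sum>n=1..N. \<integral>\<omega>. (norm (Y n K \<omega> - y_star V h n (X K \<omega>) (\<lambda>i\<in>{1..<n}. Y i K \<omega>)))\<^sup>2 \<partial>M)
      \<le> (1 + N * (4 * C\<^sup>2)) * eQ \<gamma> K"
    and "(\<integral>\<omega>. (norm (X K \<omega> - xs))\<^sup>2 \<partial>M) + (\<Sum>n=1..N. \<integral>\<omega>. (norm (Y n K \<omega> - D n xs))\<^sup>2 \<partial>M)
      \<le> (1 + N * (4 * C\<^sup>2)) * eQ \<gamma> K"
proof -
  have "(\<integral>\<omega>. (norm (X K \<omega> - xs))\<^sup>2 \<partial>M) + (\<Sum>n=1..N. f n) \<le> (1 + N * (4 * C\<^sup>2)) * eQ \<gamma> K"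
    if "\<And>n. n \<in> {1..N} \<Longrightarrow> f n \<le> 4 * C\<^sup>2 * eQ \<gamma> K" for f
  proof -
    have "(\<Sum>n=1..N. f n) \<le> N * (4 * C\<^sup>2 * eQ \<gamma> K)"
      using sum_bounded_above[of "{1..N}" f, OF that] by simp
    moreover have "(\<integral>\<omega>. (norm (X K \<omega> - xs))\<^sup>2 \<partial>M) \<le> eQ \<gamma> K"
      using errors_nonneg by (simp add: eW_def[symmetric] sum_nonneg)
    ultimately show ?thesis
      by (simp add: distrib_right)
  qed
  note le = this
  show "(\<integral>\<omega>. (norm (X K \<omega> - xs))\<^sup>2 \<partial>M)
      + (\<Sum>n=1..N. \<integral>\<omega>. (norm (Y n K \<omega> - y_star V h n (X K \<omega>) (\<lambda>i\<in>{1..<n}. Y i K \<omega>)))\<^sup>2 \<partial>M)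
      \<le> (1 + N * (4 * C\<^sup>2)) * eQ \<gamma> K"
    by (rule le) (rule final_star_gap(2))
  show "(\<integral>\<omega>. (norm (X K \<omega> - xs))\<^sup>2 \<partial>M) + (\<Sum>n=1..N. \<integral>\<omega>. (norm (Y n K \<omega> - D n xs))\<^sup>2 \<partial>M)
      \<le> (1 + N * (4 * C\<^sup>2)) * eQ \<gamma> K"
    by (rule le) (rule final_diamond_gap(2))
qed

text \<open>With \<gamma> equal to \<open>b * s\<close>, the lower end of the fast steps, the
  contraction \<alpha>/(4 C) is at least \<open>2 * s\<close> because \<open>a\<close> is at least
  \<open>8 * C\<close>. The condition \<open>small\<close> holds for large \<open>K\<close>, as
  \<open>G\<close> and \<open>b\<close> do not depend on \<open>K\<close>.\<close>

lemma final_error_bounds: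
  assumes weights: "contracting_weights N (C^3 + 2 * R * C) C e l r" and "1 \<le> R"
    and s: "0 < s" "s \<le> 1" and b: "0 < b" "b * s \<le> 1" and a: "8 * C \<le> a"
    and \<alpha>: "\<And>k. k < K \<Longrightarrow> a * s \<le> \<alpha> k \<and> \<alpha> k \<le> r * (b * s)"
    and \<beta>: "\<And>k n. k < K \<Longrightarrow> n \<in> {1..N} \<Longrightarrow> b * s \<le> \<beta> n k \<and> \<beta> n k \<le> R * (b * s)"
    and B: "(\<integral>\<omega>. (norm (X 0 \<omega>))\<^sup>2 \<partial>M) \<le> B" "\<And>n. n \<in> {1..N} \<Longrightarrow> (\<integral>\<omega>. (norm (Y n 0 \<omega>))\<^sup>2 \<partial>M) \<le> B"
    and G: "G = (1 + l + real N) * (1 + 2 * C\<^sup>2 + R\<^sup>2 * C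
      + 2 * R\<^sup>2 * ((1 + \<omega>\<^sub>0 + \<omega>\<^sub>1 + N * \<omega>\<^sub>2) * C + \<sigma>\<^sup>2)) * (1 / e ^ N)"
    and small: "G * b\<^sup>2 * s \<le> 1"
  defines "bound \<equiv> (1 + N * (4 * C\<^sup>2)) * (1 / e ^ N * ((1 - s) ^ K *
    (2 * B + 2 * (norm xs)\<^sup>2 + (\<Sum>n=1..N. 2 * B + 4 * (norm (D n 0))\<^sup>2 + 4 * C\<^sup>2 * B)) + G * b\<^sup>2 * s))"
  shows "(\<integral>\<omega>. (norm (X K \<omega> - xs))\<^sup>2 \<partial>M)
      + (\<Sum>n=1..N. \<integral>\<omega>. (norm (Y n K \<omega> - y_star V h n (X K \<omega>) (\<lambda>i\<in>{1..<n}. Y i K \<omega>)))\<^sup>2 \<partial>M) \<le> bound"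
    and "(\<integral>\<omega>. (norm (X K \<omega> - xs))\<^sup>2 \<partial>M) + (\<Sum>n=1..N. \<integral>\<omega>. (norm (Y n K \<omega> - D n xs))\<^sup>2 \<partial>M) \<le> bound"
proof -
  \<comment> \<open>The hypothesis spells out \<open>noise_const\<close> so that \<open>G\<close> is
    visibly one constant for all runs, whatever \<open>K\<close>.\<close>
  note G = G[folded noise_const_def]
  let ?\<gamma> = "b * s" and ?A = "C^3 + 2 * R * C" and ?q = "1 / e ^ N"
  let ?g = "1 + 2 * C\<^sup>2 + R\<^sup>2 * C + 2 * R\<^sup>2 * noise_const"
  define L where "L k = eW k + l * eP ?\<gamma> k + (\<Sum>n=1..N. e ^ n * eU ?\<gamma> n k)" for k
  have w: "0 < e" "e \<le> 1" "1 \<le> l" "0 < r" "r \<le> 1"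
    using weights by (simp_all add: contracting_weights_def)
  have q: "1 \<le> ?q"
    using w by (simp add: power_le_one)
  have L_nonneg: "0 \<le> L k" for k
    unfolding L_def using w errors_nonneg by (intro add_nonneg_nonneg sum_nonneg mult_nonneg_nonneg) auto
  \<comment> \<open>Removing the weights: \<open>e ^ N\<close> is the smallest of them.\<close>
  have eQ_le: "eQ ?\<gamma> k \<le> ?q * L k" for k
  proof -
    have "eW k \<le> ?q * eW k"
      using mult_right_mono[OF q errors_nonneg(1)] by simp
    moreover have "eP ?\<gamma> k \<le> ?q * (l * eP ?\<gamma> k)"
    proof -
      have "1 * eP ?\<gamma> k \<le> (?q * l) * eP ?\<gamma> k"
        using q w(3) errors_nonneg(2) by (intro mult_right_mono mult_ge1_I)
      thus ?thesis
        by (simp only: mult.assoc mult_1)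
    qed
    moreover have "(\<Sum>n=1..N. eU ?\<gamma> n k) \<le> (\<Sum>n=1..N. ?q * (e ^ n * eU ?\<gamma> n k))"
    proof (rule sum_mono)
      fix n assume "n \<in> {1..N}"
      hence "e ^ N \<le> e ^ n"
        using w by (intro power_decreasing) auto
      hence "1 \<le> ?q * e ^ n"
        using w by simp
      thus "eU ?\<gamma> n k \<le> ?q * (e ^ n * eU ?\<gamma> n k)"
        using mult_right_mono[of 1 "?q * e ^ n", OF _ errors_nonneg(3)] by (simp add: mult.assoc)
    qed
    ultimately show ?thesis
      unfolding L_def distrib_left sum_distrib_left by linarith
  qed
  have g: "0 \<le> ?g"
    using C_ge_1 noise_const_nonneg by simp
  have "L (Suc k) \<le> (1 - s) * L k + G * b\<^sup>2 * s\<^sup>2" if k: "k < K" for k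
  proof -
    let ?E = "?\<gamma>\<^sup>2 * ?g * (eQ ?\<gamma> k + 1)"
    have \<gamma>: "0 < ?\<gamma>"
      using b s by simp
    have "r * ?\<gamma> \<le> ?\<gamma>"
      using w \<gamma> by (intro mult_left_le_one_le) auto
    hence \<alpha>\<gamma>: "\<alpha> k \<le> ?\<gamma>"
      using \<alpha>[OF k] by linarith
    note rec = error_recursion[OF k \<gamma> b(2) \<alpha>\<gamma> \<beta>[OF k] \<open>1 \<le> R\<close>]
    have "L (Suc k) \<le> (1 - \<alpha> k / (4 * C)) * L k + (1 + l + real N) * ?E"
      unfolding L_def
    proof (rule weights[unfolded contracting_weights_def, THEN conjunct2, THEN conjunct2, THEN conjunct2,
          THEN conjunct2, THEN conjunct2, rule_format])
      show "0 \<le> ?E"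
        using g eQ_nonneg[where \<gamma> = ?\<gamma> and k = k] by (intro mult_nonneg_nonneg) auto
      show "0 \<le> \<alpha> k" "\<alpha> k \<le> r * ?\<gamma>"
        using \<alpha>[OF k] step_pos(1)[OF k] by auto
    qed (use rec errors_nonneg \<gamma> in auto)
    also have "\<dots> \<le> (1 - 2 * s) * L k + (G * b\<^sup>2 * s\<^sup>2) * (L k + 1)"
    proof (rule add_mono)
      have "2 * s \<le> \<alpha> k / (4 * C)"
      proof -
        have "8 * C * s \<le> \<alpha> k"
          using \<alpha>[OF k] mult_right_mono[OF a, of s] s by linarith
        thus ?thesis
          using C_ge_1 by (simp add: field_simps)
      qed
      thus "(1 - \<alpha> k / (4 * C)) * L k \<le> (1 - 2 * s) * L k"
        using L_nonneg by (intro mult_right_mono) auto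
      have "eQ ?\<gamma> k + 1 \<le> ?q * (L k + 1)"
        using eQ_le[of k] q by (simp add: distrib_left)
      hence "(1 + l + real N) * (?\<gamma>\<^sup>2 * ?g) * (eQ ?\<gamma> k + 1) \<le> (1 + l + real N) * (?\<gamma>\<^sup>2 * ?g) * (?q * (L k + 1))"
        using w g by (intro mult_left_mono) auto
      thus "(1 + l + real N) * ?E \<le> (G * b\<^sup>2 * s\<^sup>2) * (L k + 1)"
        by (simp add: G power_mult_distrib mult_ac)
    qed
    \<comment> \<open>The part of the source proportional to \<open>L k\<close> is split off; by
      \<open>small\<close> it is at most \<open>s * L k\<close>, which costs one of the two
      \<open>s\<close> of the contraction.\<close>
    also have "\<dots> = (1 - 2 * s) * L k + (G * b\<^sup>2 * s) * (s * L k) + G * b\<^sup>2 * s\<^sup>2"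
      by (simp add: algebra_simps power2_eq_square)
    also have "(G * b\<^sup>2 * s) * (s * L k) \<le> 1 * (s * L k)"
      using small s L_nonneg by (intro mult_right_mono) auto
    finally show ?thesis
      by (simp add: algebra_simps)
  qed
  note step = this
  have "0 \<le> G * b\<^sup>2"
    unfolding G using w g by (intro mult_nonneg_nonneg) auto
  hence LK: "L K \<le> (1 - s) ^ K * L 0 + G * b\<^sup>2 * s"
    using s by (intro contraction_iterate_le[where L = L and K = K, OF step]) auto
  have L0: "L 0 \<le> 2 * B + 2 * (norm xs)\<^sup>2 + (\<Sum>n=1..N. 2 * B + 4 * (norm (D n 0))\<^sup>2 + 4 * C\<^sup>2 * B)"
  proof -
    have "(\<Sum>n=1..N. e ^ n * eU ?\<gamma> n 0) \<le> (\<Sum>n=1..N. 2 * B + 4 * (norm (D n 0))\<^sup>2 + 4 * C\<^sup>2 * B)"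
    proof (rule sum_mono)
      fix n assume n: "n \<in> {1..N}"
      have "e ^ n * eU ?\<gamma> n 0 \<le> eU ?\<gamma> n 0"
        using w errors_nonneg by (intro mult_left_le_one_le) (auto simp: power_le_one)
      thus "e ^ n * eU ?\<gamma> n 0 \<le> 2 * B + 4 * (norm (D n 0))\<^sup>2 + 4 * C\<^sup>2 * B"
        using initial_errors(3)[OF B(1) B(2) n, of ?\<gamma>] n by simp
    qed
    thus ?thesis
      using initial_errors(1,2)[OF B(1) B(2)] by (simp add: L_def)
  qed
  have "(1 - s) ^ K * L 0 \<le> (1 - s) ^ K *
      (2 * B + 2 * (norm xs)\<^sup>2 + (\<Sum>n=1..N. 2 * B + 4 * (norm (D n 0))\<^sup>2 + 4 * C\<^sup>2 * B))"
    using L0 s by (intro mult_left_mono) auto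
  hence "L K \<le> (1 - s) ^ K *
      (2 * B + 2 * (norm xs)\<^sup>2 + (\<Sum>n=1..N. 2 * B + 4 * (norm (D n 0))\<^sup>2 + 4 * C\<^sup>2 * B)) + G * b\<^sup>2 * s"
    using LK by linarith
  hence "?q * L K \<le> ?q * ((1 - s) ^ K *
    (2 * B + 2 * (norm xs)\<^sup>2 + (\<Sum>n=1..N. 2 * B + 4 * (norm (D n 0))\<^sup>2 + 4 * C\<^sup>2 * B)) + G * b\<^sup>2 * s)"
    by (rule mult_left_mono) (use w in simp)
  hence "(1 + N * (4 * C\<^sup>2)) * eQ ?\<gamma> K \<le> bound"
    unfolding bound_def using eQ_le[of K] by (intro mult_left_mono) auto
  thus "(\<integral>\<omega>. (norm (X K \<omega> - xs))\<^sup>2 \<partial>M)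
      + (\<Sum>n=1..N. \<integral>\<omega>. (norm (Y n K \<omega> - y_star V h n (X K \<omega>) (\<lambda>i\<in>{1..<n}. Y i K \<omega>)))\<^sup>2 \<partial>M) \<le> bound"
    "(\<integral>\<omega>. (norm (X K \<omega> - xs))\<^sup>2 \<partial>M) + (\<Sum>n=1..N. \<integral>\<omega>. (norm (Y n K \<omega> - D n xs))\<^sup>2 \<partial>M) \<le> bound"
    using final_errors[where \<gamma> = ?\<gamma>] by linarith+
qed

lemma final_integrable: "integrable M (\<lambda>\<omega>. (norm (X K \<omega> - xs))\<^sup>2)"
  by (rule deviations_integrable) simp

end

section \<open>Passage to the asymptotic rate\<close>

lemma soft_O_I:
  fixes f :: "nat \<Rightarrow> real"
  assumes "\<forall>\<^sub>F K in sequentially. 0 \<le> f K \<and> f K \<le> c * (ln (real K) / real K)" "0 \<le> c"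
  shows "f \<in> soft_O (\<lambda>K. 1 / real K)"
  unfolding soft_O_def
proof (rule bigoI)
  show "\<forall>\<^sub>F K in sequentially. norm (f K) \<le> c * norm (1 / real K * max 1 \<bar>ln (1 / real K)\<bar>)"
    using assms(1) eventually_gt_at_top[of 0]
  proof eventually_elim
    case (elim K)
    have "ln (real K) / real K \<le> 1 / real K * max 1 \<bar>ln (1 / real K)\<bar>"
      using elim by (simp add: ln_div divide_right_mono)
    hence "c * (ln (real K) / real K) \<le> c * (1 / real K * max 1 \<bar>ln (1 / real K)\<bar>)"
      using assms(2) by (rule mult_left_mono)
    thus ?case
      using elim by (simp add: abs_mult)
  qed
qed

lemma mssa_rate:
  fixes N :: nat
    and V :: "nat \<Rightarrow> 'b::euclidean_space set"
    and v :: "'a::euclidean_space \<Rightarrow> (nat \<Rightarrow> 'b) \<Rightarrow> 'a"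
    and h :: "nat \<Rightarrow> 'a \<Rightarrow> (nat \<Rightarrow> 'b) \<Rightarrow> 'b"
    and M :: "nat \<Rightarrow> 'w measure"
  assumes est: "tracking_estimates N V v h xs C"
    and weights: "contracting_weights N (C^3 + 2 * R * C) C e l r" and R: "1 \<le> R"
    and ab: "8 * C \<le> a" "a \<le> a'" "a' \<le> r * b" "b \<le> b'" "b' \<le> R * b"
    and \<alpha>: "step_size_theta a a' \<alpha>" and \<beta>: "\<forall>n\<in>{1..N}. step_size_theta b b' (\<lambda>K. \<beta> K n)"
    and pos: "\<omega>\<^sub>0 > 0" "\<omega>\<^sub>1 > 0" "\<omega>\<^sub>2 > 0" "\<sigma> > 0"
    and init: "bounded_initial_moments N M X Y"
    and run: "\<forall>K. mssa_run N V v h K (\<alpha> K) (\<beta> K) (M K) (X K) (Y K) (\<xi> K) (\<psi> K)"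
    and noise: "\<forall>K. noise_conditions N v h \<omega>\<^sub>0 \<omega>\<^sub>1 \<omega>\<^sub>2 \<sigma> K (M K) (X K) (Y K) (\<xi> K) (\<psi> K)"
  shows "(\<forall>K. integrable (M K) (\<lambda>\<omega>. (norm (X K K \<omega> - xs))\<^sup>2) \<and>
        (\<forall>n\<in>{1..N}.
          integrable (M K) (\<lambda>\<omega>. (norm (Y K n K \<omega>
              - y_star V h n (X K K \<omega>) (\<lambda>i\<in>{1..<n}. Y K i K \<omega>)))\<^sup>2) \<and>
          integrable (M K) (\<lambda>\<omega>. (norm (Y K n K \<omega> - y_diamond V h n xs))\<^sup>2))) \<and>
      (\<lambda>K. (\<integral>\<omega>. (norm (X K K \<omega> - xs))\<^sup>2 \<partial>M K)
          + (\<Sum>n=1..N. \<integral>\<omega>. (norm (Y K n K \<omega>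
              - y_star V h n (X K K \<omega>) (\<lambda>i\<in>{1..<n}. Y K i K \<omega>)))\<^sup>2 \<partial>M K))
        \<in> soft_O (\<lambda>K. 1 / real K) \<and>
      (\<lambda>K. (\<integral>\<omega>. (norm (X K K \<omega> - xs))\<^sup>2 \<partial>M K)
          + (\<Sum>n=1..N. \<integral>\<omega>. (norm (Y K n K \<omega> - y_diamond V h n xs))\<^sup>2 \<partial>M K))
        \<in> soft_O (\<lambda>K. 1 / real K)"
proof -
  interpret tracking_estimates N V v h xs C
    by (rule est)
  obtain B where B: "\<And>K. integrable (M K) (\<lambda>\<omega>. (norm (X K 0 \<omega>))\<^sup>2)" "\<And>K. (\<integral>\<omega>. (norm (X K 0 \<omega>))\<^sup>2 \<partial>M K) \<le> B"
    "\<And>K n. n \<in> {1..N} \<Longrightarrow> integrable (M K) (\<lambda>\<omega>. (norm (Y K n 0 \<omega>))\<^sup>2)"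
    "\<And>K n. n \<in> {1..N} \<Longrightarrow> (\<integral>\<omega>. (norm (Y K n 0 \<omega>))\<^sup>2 \<partial>M K) \<le> B"
    using init unfolding bounded_initial_moments_def by blast
  have process: "mssa_process N V v h xs C (M K) K (\<alpha> K) (\<beta> K) (X K) (Y K) (\<xi> K) (\<psi> K) \<omega>\<^sub>0 \<omega>\<^sub>1 \<omega>\<^sub>2 \<sigma>" for K
  proof (intro mssa_process.intro mssa_process_axioms.intro est)
    show "prob_space (M K)"
      using run unfolding mssa_run_def by blast
  qed (use run noise pos B in auto)
  have w: "0 < e" "e \<le> 1" "1 \<le> l" "0 < r" "r \<le> 1"
    using weights by (simp_all add: contracting_weights_def)
  \<comment> \<open>The chain \<open>8 * C\<close>, \<open>a\<close>, \<open>a'\<close>,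
    \<open>r * b\<close> is increasing and starts at a positive number.\<close>
  have b: "0 < b"
  proof -
    have "0 < r * b"
      using ab C_ge_1 by linarith
    thus ?thesis
      using w by (simp add: zero_less_mult_iff)
  qed
  define s where "s K = ln (real K) / real K" for K :: nat
  define G where "G = (1 + l + real N) * (1 + 2 * C\<^sup>2 + R\<^sup>2 * C
      + 2 * R\<^sup>2 * ((1 + \<omega>\<^sub>0 + \<omega>\<^sub>1 + N * \<omega>\<^sub>2) * C + \<sigma>\<^sup>2)) * (1 / e ^ N)"
  define L0 where "L0 = 2 * B + 2 * (norm xs)\<^sup>2 + (\<Sum>n=1..N. 2 * B + 4 * (norm (y_diamond V h n 0))\<^sup>2 + 4 * C\<^sup>2 * B)"
  define c where "c = (1 + N * (4 * C\<^sup>2)) * (1 / e ^ N * (L0 + G * b\<^sup>2))"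
  have "0 \<le> B"
    by (rule order_trans[OF _ B(2)[of 0]]) simp
  hence L0: "0 \<le> L0"
    unfolding L0_def by (auto intro!: add_nonneg_nonneg sum_nonneg)
  have G: "0 \<le> G"
    unfolding G_def using w pos C_ge_1 by (intro mult_nonneg_nonneg add_nonneg_nonneg) auto
  have c: "0 \<le> c"
    unfolding c_def using w L0 G by (intro mult_nonneg_nonneg add_nonneg_nonneg) auto
  have s_small: "\<forall>\<^sub>F K in sequentially. s K < \<epsilon>" if "0 < \<epsilon>" for \<epsilon>
    using lim_ln_over_n order_tendstoD(2)[OF _ that] unfolding s_def by blast
  have pos1: "0 < 1 / b" and pos2: "0 < 1 / (G * b\<^sup>2 + 1)"
    using b G by (auto simp: add_nonneg_pos)
  \<comment> \<open>There are finitely many layers, so their thresholds on \<open>K\<close> can be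
    merged.\<close>
  have steps: "\<forall>\<^sub>F K in sequentially. (\<forall>k<K. a * s K \<le> \<alpha> K k \<and> \<alpha> K k \<le> a' * s K) \<and>
      (\<forall>n\<in>{1..N}. \<forall>k<K. b * s K \<le> \<beta> K n k \<and> \<beta> K n k \<le> b' * s K)"
    using \<alpha> \<beta> unfolding step_size_theta_def s_def
    by (intro eventually_conj eventually_ball_finite) auto
  define bound where "bound K = (1 + N * (4 * C\<^sup>2)) * (1 / e ^ N * ((1 - s K) ^ K * L0 + G * b\<^sup>2 * s K))" for K
  have main: "\<forall>\<^sub>F K in sequentially.
      (\<integral>\<omega>. (norm (X K K \<omega> - xs))\<^sup>2 \<partial>M K) + (\<Sum>n=1..N. \<integral>\<omega>. (norm (Y K n K \<omega>
              - y_star V h n (X K K \<omega>) (\<lambda>i\<in>{1..<n}. Y K i K \<omega>)))\<^sup>2 \<partial>M K) \<le> c * s K \<and>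
      (\<integral>\<omega>. (norm (X K K \<omega> - xs))\<^sup>2 \<partial>M K)
          + (\<Sum>n=1..N. \<integral>\<omega>. (norm (Y K n K \<omega> - y_diamond V h n xs))\<^sup>2 \<partial>M K) \<le> c * s K"
    \<comment> \<open>From \<open>K = 3\<close> on the logarithm is at least 1, so
      \<open>1 / K\<close> is at most \<open>s K\<close> and the contracted initial error is
      absorbed into the noise level.\<close>
    using steps s_small[OF pos1] s_small[OF pos2] s_small[OF zero_less_one] eventually_ge_at_top[of 3]
  proof eventually_elim
    case (elim K)
    have lnK: "1 \<le> ln (real K)"
    proof -
      have "ln 3 \<le> ln (real K)"
        using elim(5) by (intro ln_mono) auto
      thus ?thesis
        using ln3_gt_1 by linarith
    qed
    hence s0: "0 < s K" and sK: "1 / real K \<le> s K"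
      using elim(5) by (auto simp: s_def divide_right_mono)
    have bs: "b * s K \<le> 1"
      using elim(2) b by (simp add: field_simps)
    have "(G * b\<^sup>2 + 1) * s K \<le> 1"
    proof -
      have "0 < G * b\<^sup>2 + 1"
        using G by (intro add_nonneg_pos) auto
      hence "s K * (G * b\<^sup>2 + 1) < 1"
        using elim(3) by (simp only: pos_less_divide_eq)
      thus ?thesis
        by (simp add: mult.commute)
    qed
    hence small: "G * b\<^sup>2 * s K \<le> 1"
      using s0 by (simp add: algebra_simps)
    have \<alpha>K: "a * s K \<le> \<alpha> K k \<and> \<alpha> K k \<le> r * (b * s K)" if "k < K" for k
    proof -
      have "a' * s K \<le> r * b * s K"
        using ab s0 by (intro mult_right_mono) auto
      thus ?thesis
        using elim(1) that by (auto simp: mult.assoc intro: order_trans)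
    qed
    have \<beta>K: "b * s K \<le> \<beta> K n k \<and> \<beta> K n k \<le> R * (b * s K)" if "k < K" "n \<in> {1..N}" for k n
    proof -
      have "b' * s K \<le> R * b * s K"
        using ab s0 by (intro mult_right_mono) auto
      moreover have "b * s K \<le> \<beta> K n k" "\<beta> K n k \<le> b' * s K"
        using elim(1) that by blast+
      ultimately show ?thesis
        by (simp add: mult.assoc)
    qed
    have "bound K \<le> c * s K"
    proof -
      \<comment> \<open>The choice of \<open>s\<close> makes \<open>K\<close> times
        \<open>s K\<close> equal to the logarithm of \<open>K\<close>, so the contraction over the
        whole run is at most \<open>1 / K\<close>.\<close>
      have "(1 - s K) ^ K \<le> exp (- s K) ^ K"
        using elim(4) exp_ge_add_one_self[of "- s K"] by (intro power_mono) auto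
      also have "\<dots> = exp (real K * - s K)"
        by (rule exp_of_nat_mult[symmetric])
      also have "\<dots> = 1 / real K"
        using elim(5) by (simp add: s_def exp_minus inverse_eq_divide)
      finally have "(1 - s K) ^ K * L0 \<le> s K * L0"
        using sK L0 by (intro mult_right_mono) auto
      hence "1 / e ^ N * ((1 - s K) ^ K * L0 + G * b\<^sup>2 * s K) \<le> 1 / e ^ N * (s K * L0 + G * b\<^sup>2 * s K)"
        using w by (intro mult_left_mono add_right_mono) auto
      hence "bound K \<le> (1 + N * (4 * C\<^sup>2)) * (1 / e ^ N * (s K * L0 + G * b\<^sup>2 * s K))"
        unfolding bound_def by (rule mult_left_mono) simp
      also have "\<dots> = c * s K"
        by (simp add: c_def algebra_simps)
      finally show ?thesis .
    qed
    moreover note mssa_process.final_error_bounds[OF process weights R s0 less_imp_le[OF elim(4)] b bs ab(1)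
        \<alpha>K \<beta>K B(2) B(4) G_def small, folded L0_def, folded bound_def]
    ultimately show ?case
      by (meson order_trans)
  qed
  have "(\<lambda>K. (\<integral>\<omega>. (norm (X K K \<omega> - xs))\<^sup>2 \<partial>M K) + (\<Sum>n=1..N. \<integral>\<omega>. (norm (Y K n K \<omega>
              - y_star V h n (X K K \<omega>) (\<lambda>i\<in>{1..<n}. Y K i K \<omega>)))\<^sup>2 \<partial>M K)) \<in> soft_O (\<lambda>K. 1 / real K)"
    using main by (intro soft_O_I[OF _ c]) (auto simp: s_def elim!: eventually_mono intro!: add_nonneg_nonneg sum_nonneg)
  moreover have "(\<lambda>K. (\<integral>\<omega>. (norm (X K K \<omega> - xs))\<^sup>2 \<partial>M K)
          + (\<Sum>n=1..N. \<integral>\<omega>. (norm (Y K n K \<omega> - y_diamond V h n xs))\<^sup>2 \<partial>M K)) \<in> soft_O (\<lambda>K. 1 / real K)"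
    using main by (intro soft_O_I[OF _ c]) (auto simp: s_def elim!: eventually_mono intro!: add_nonneg_nonneg sum_nonneg)
  ultimately show ?thesis
    using mssa_process.final_integrable[OF process] mssa_process.final_star_gap(1)[OF process]
      mssa_process.final_diamond_gap(1)[OF process] by blast
qed

text \<open>The spread \<open>R\<close> is quantified before \<open>c\<close> and \<open>r\<close>
  because the coupling between fast errors grows with it. The constants \<open>c\<close> and
  \<open>r\<close> come from the operators, \<open>N\<close> and \<open>R\<close> alone; noise
  levels and initial moments affect only the implied constant of the rate and the threshold on
  \<open>K\<close>.\<close>

theorem theorem1:
  fixes N :: nat
    and V :: "nat \<Rightarrow> 'b::euclidean_space set"
    and v :: "'a::euclidean_space \<Rightarrow> (nat \<Rightarrow> 'b) \<Rightarrow> 'a"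
    and h :: "nat \<Rightarrow> 'a \<Rightarrow> (nat \<Rightarrow> 'b) \<Rightarrow> 'b"
    and xs :: 'a
  assumes "well_typed N V h"
    and "strongly_monotone_h N V h"
    and "regular_h N V h"
    and "lipschitz_v N V v h"
    and "strongly_monotone_v N V v h xs"
  shows "\<forall>R\<ge>1. \<exists>c>0. \<exists>r>0. \<forall>a a' b b'.
    c \<le> a \<and> a \<le> a' \<and> a' \<le> r * b \<and> b \<le> b' \<and> b' \<le> R * b \<longrightarrow>
    (\<forall>(\<alpha> :: nat \<Rightarrow> nat \<Rightarrow> real) (\<beta> :: nat \<Rightarrow> nat \<Rightarrow> nat \<Rightarrow> real) \<omega>\<^sub>0 \<omega>\<^sub>1 \<omega>\<^sub>2 \<sigma>
       (M :: nat \<Rightarrow> 'w measure) (X :: nat \<Rightarrow> nat \<Rightarrow> 'w \<Rightarrow> 'a) (Y :: nat \<Rightarrow> nat \<Rightarrow> nat \<Rightarrow> 'w \<Rightarrow> 'b)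
       (\<xi> :: nat \<Rightarrow> nat \<Rightarrow> 'w \<Rightarrow> 'a) (\<psi> :: nat \<Rightarrow> nat \<Rightarrow> nat \<Rightarrow> 'w \<Rightarrow> 'b).
      step_size_theta a a' \<alpha> \<and>
      (\<forall>n\<in>{1..N}. step_size_theta b b' (\<lambda>K. \<beta> K n)) \<and>
      \<omega>\<^sub>0 > 0 \<and> \<omega>\<^sub>1 > 0 \<and> \<omega>\<^sub>2 > 0 \<and> \<sigma> > 0 \<and>
      bounded_initial_moments N M X Y \<and>
      (\<forall>K. mssa_run N V v h K (\<alpha> K) (\<beta> K) (M K) (X K) (Y K) (\<xi> K) (\<psi> K)) \<and>
      (\<forall>K. noise_conditions N v h \<omega>\<^sub>0 \<omega>\<^sub>1 \<omega>\<^sub>2 \<sigma> K (M K) (X K) (Y K) (\<xi> K) (\<psi> K))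
    \<longrightarrow>
      (\<forall>K. integrable (M K) (\<lambda>\<omega>. (norm (X K K \<omega> - xs))\<^sup>2) \<and>
        (\<forall>n\<in>{1..N}.
          integrable (M K) (\<lambda>\<omega>. (norm (Y K n K \<omega>
              - y_star V h n (X K K \<omega>) (\<lambda>i\<in>{1..<n}. Y K i K \<omega>)))\<^sup>2) \<and>
          integrable (M K) (\<lambda>\<omega>. (norm (Y K n K \<omega> - y_diamond V h n xs))\<^sup>2))) \<and>
      (\<lambda>K. (\<integral>\<omega>. (norm (X K K \<omega> - xs))\<^sup>2 \<partial>M K)
          + (\<Sum>n=1..N. \<integral>\<omega>. (norm (Y K n K \<omega>
              - y_star V h n (X K K \<omega>) (\<lambda>i\<in>{1..<n}. Y K i K \<omega>)))\<^sup>2 \<partial>M K))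
        \<in> soft_O (\<lambda>K. 1 / real K) \<and>
      (\<lambda>K. (\<integral>\<omega>. (norm (X K K \<omega> - xs))\<^sup>2 \<partial>M K)
          + (\<Sum>n=1..N. \<integral>\<omega>. (norm (Y K n K \<omega> - y_diamond V h n xs))\<^sup>2 \<partial>M K))
        \<in> soft_O (\<lambda>K. 1 / real K))"
proof (intro allI impI, goal_cases)
  case (1 R)
  obtain C where est: "tracking_estimates N V v h xs C"
    by (rule tracking_estimates_exist[OF assms])
  have C: "1 \<le> C"
    using est by (rule tracking_estimates.C_ge_1)
  \<comment> \<open>This is the coupling constant that \<open>tracking_drift\<close> produces. From
    it the weights, and with them \<open>r\<close>, are obtained, while \<open>8 * C\<close> is the
    lower bound for the slow steps.\<close>
  have "1 \<le> C^3 + 2 * R * C"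
    using C 1 one_le_power[OF C, of 3] by (intro add_increasing2) auto
  then obtain e l r where weights: "contracting_weights N (C^3 + 2 * R * C) C e l r"
    using C by (rule contracting_weights_exist)
  hence "r > 0"
    by (simp add: contracting_weights_def)
  show ?case
  proof (rule exI[of _ "8 * C"], rule conjI, goal_cases)
    case 2
    show ?case
      by (rule exI[of _ r], rule conjI, rule \<open>r > 0\<close>, intro allI impI, elim conjE)
        (rule mssa_rate[OF est weights 1]; assumption)
  qed (use C in simp)
qed

end
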